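(* Let $\beta_2\ge\beta_1>0$ and let $V\in L^\infty_{\mathrm{loc}}(\mathbb{R})$ be a nonnegative real-valued potential for which there exist constants $c_1,c_2,c_3>0$ with $$c_1(|x|-c_3)_+^{\beta_1}\le V(x)\le c_2\langle x\rangle^{\beta_2},\qquad \forall x\in\mathbb{R}.$$ Let $\Omega\subset\mathbb{R}$ be thick of type $(\rho,\tau)$ with $$\rho(x):=\min\left\{\left(R\log\log\langle x\rangle-R^{-1}\right)\frac{1}{\langle x\rangle^{\beta_2/2}},\,1\right\}$$ for some $R>0$ and $\tau\ge 0$. Then for any $\varepsilon>0$, and any $R$ sufficiently small, there exists a constant $C=C(\varepsilon,R,V,\Omega)>0$, depending only on $\varepsilon$, $R$, $V$ and $\Omega$, such that for any $\lambda>0$ and any $\phi\in\mathcal{E}_\lambda(\sqrt H)$, $$\|\phi\|_{L^2(\mathbb{R})}\le Ce^{C\lambda^{\zeta}}\|\phi\|_{L^2(\Omega)},\qquad \text{where }\zeta=\frac{4\tau+\varepsilon}{\beta_1}+1.$$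
   Context: Notation: $(a)_+:=\max\{0,a\}$, $\langle x\rangle:=(1+|x|^2)^{1/2}$, $I_r(x):=[x-r,x+r]$, and $|E|$ is the Lebesgue measure of a measurable set $E\subset\mathbb{R}$. A measurable set $\Omega\subset\mathbb{R}$ is thick of type $(\rho,\tau)$ if there exist $\gamma\in(0,1)$ and $L>0$ such that $|\Omega\cap I_{L\rho(x)}(x)|\ge\gamma^{\langle x\rangle^\tau}|I_{L\rho(x)}(x)|$ for all $x\in\mathbb{R}$. For the function $\rho$ of the claim, the condition is understood to be void at those $x$ where $\rho(x)\le 0$ (including $x=0$, where $\log\log\langle x\rangle$ is interpreted as $-\infty$). $H=-\partial_x^2+V(x)$ is the Schrödinger operator, i.e. the unique self-adjoint operator on $L^2(\mathbb{R})$ extending $-\partial_x^2+V$ from the Schwartz space. Since $V(x)\to\infty$ as $|x|\to\infty$, there are an orthonormal basis $\{\phi_k\}_{k\in\mathbb{N}}$ of $L^2(\mathbb{R})$ and numbers $0<\lambda_0\le\lambda_1\le\cdots$, $\lambda_k\to\infty$, with $H\phi_k=\lambda_k^2\phi_k$. The spectral subspace is $\mathcal{E}_\lambda(\sqrt H)=\mathrm{span}\{\phi_k:\lambda_k\le\lambda\}$. *)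

theory Defs
  imports "HOL-Analysis.Analysis"
begin

definition jbracket :: "real \<Rightarrow> real" where
  "jbracket x = sqrt (1 + \<bar>x\<bar>\<^sup>2)"

definition Ivl :: "real \<Rightarrow> real \<Rightarrow> real set" where
  "Ivl r x = {x - r .. x + r}"

definition Linf_loc :: "(real \<Rightarrow> real) set" where
  "Linf_loc = {V. V \<in> borel_measurable lebesgue \<and>
     (\<forall>K. compact K \<longrightarrow> (\<exists>M. AE x in lebesgue. x \<in> K \<longrightarrow> \<bar>V x\<bar> \<le> M))}"

text \<open>The density condition is void at points where \<open>\<rho>\<close> is not positive.\<close>

definition thick :: "(real \<Rightarrow> real) \<Rightarrow> real \<Rightarrow> real set \<Rightarrow> bool" where
  "thick \<rho> \<tau> \<Omega> \<longleftrightarrow> \<Omega> \<in> sets lebesgue \<and>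
     (\<exists>\<gamma> L. 0 < \<gamma> \<and> \<gamma> < 1 \<and> 0 < L \<and>
        (\<forall>x. 0 < \<rho> x \<longrightarrow>
           measure lebesgue (\<Omega> \<inter> Ivl (L * \<rho> x) x)
             \<ge> \<gamma> powr (jbracket x powr \<tau>) * measure lebesgue (Ivl (L * \<rho> x) x)))"

text \<open>At \<open>x = 0\<close> the double logarithm is \<open>ln 0\<close>, whose value in HOL is \<open>0\<close> and not
  \<open>-\<infinity>\<close>; for \<open>R > 0\<close> the scale is negative there in either convention, so the
  density condition is void at \<open>0\<close>.\<close>

definition loglog_scale :: "real \<Rightarrow> real \<Rightarrow> real \<Rightarrow> real" where
  "loglog_scale \<beta>\<^sub>2 R x =
     min ((R * ln (ln (jbracket x)) - inverse R) * (1 / jbracket x powr (\<beta>\<^sub>2 / 2))) 1"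

text \<open>The complex Hilbert space of square-integrable functions on the line is represented by
  functions, with almost everywhere equality in the role of equality.\<close>

definition L2 :: "(real \<Rightarrow> complex) set" where
  "L2 = {f. f \<in> borel_measurable lebesgue \<and> integrable lebesgue (\<lambda>x. (cmod (f x))\<^sup>2)}"

definition L2_norm_on :: "real set \<Rightarrow> (real \<Rightarrow> complex) \<Rightarrow> real" where
  "L2_norm_on A f = sqrt (LINT x:A|lebesgue. (cmod (f x))\<^sup>2)"

definition L2_inner :: "(real \<Rightarrow> complex) \<Rightarrow> (real \<Rightarrow> complex) \<Rightarrow> complex" where
  "L2_inner f g = (LINT x|lebesgue. f x * cnj (g x))"

text \<open>The complex linear span of the members of a family with index in \<open>K\<close>.\<close>

definition L2_span :: "(nat \<Rightarrow> real \<Rightarrow> complex) \<Rightarrow> nat set \<Rightarrow> (real \<Rightarrow> complex) set" where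
  "L2_span \<phi> K = {f \<in> L2. \<exists>F a. finite F \<and> F \<subseteq> K \<and>
     (AE x in lebesgue. f x = (\<Sum>k\<in>F. a k * \<phi> k x))}"

definition L2_dense :: "(real \<Rightarrow> complex) set \<Rightarrow> bool" where
  "L2_dense D \<longleftrightarrow> (\<forall>f\<in>L2. \<forall>e>0. \<exists>g\<in>D. L2_norm_on UNIV (\<lambda>x. f x - g x) < e)"

definition orthonormal_basis :: "(nat \<Rightarrow> real \<Rightarrow> complex) \<Rightarrow> bool" where
  "orthonormal_basis \<phi> \<longleftrightarrow> (\<forall>k. \<phi> k \<in> L2) \<and>
     (\<forall>j k. L2_inner (\<phi> j) (\<phi> k) = (if j = k then 1 else 0)) \<and>
     L2_dense (L2_span \<phi> UNIV)"

text \<open>An unbounded operator is represented by its graph: a linear relation on \<^term>\<open>L2\<close> that is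
  saturated under, and single-valued up to, almost everywhere equality.\<close>

type_synonym L2_graph = "((real \<Rightarrow> complex) \<times> (real \<Rightarrow> complex)) set"

definition L2_operator :: "L2_graph \<Rightarrow> bool" where
  "L2_operator T \<longleftrightarrow> T \<subseteq> L2 \<times> L2 \<and> (\<lambda>x. 0, \<lambda>x. 0) \<in> T \<and>
     (\<forall>f g f' g'. (f, g) \<in> T \<and> f' \<in> L2 \<and> g' \<in> L2 \<and>
        (AE x in lebesgue. f' x = f x) \<and> (AE x in lebesgue. g' x = g x) \<longrightarrow> (f', g') \<in> T) \<and>
     (\<forall>f g f' g' a b. (f, g) \<in> T \<and> (f', g') \<in> T \<longrightarrow>
        (\<lambda>x. a * f x + b * f' x, \<lambda>x. a * g x + b * g' x) \<in> T) \<and>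
     (\<forall>f g g'. (f, g) \<in> T \<and> (f, g') \<in> T \<longrightarrow> (AE x in lebesgue. g x = g' x))"

definition L2_adjoint :: "L2_graph \<Rightarrow> L2_graph" where
  "L2_adjoint T = {(u, v). u \<in> L2 \<and> v \<in> L2 \<and>
     (\<forall>(f, g) \<in> T. L2_inner g u = L2_inner f v)}"

definition self_adjoint :: "L2_graph \<Rightarrow> bool" where
  "self_adjoint T \<longleftrightarrow> L2_operator T \<and> L2_dense (Domain T) \<and> L2_adjoint T = T"

definition nth_deriv :: "nat \<Rightarrow> (real \<Rightarrow> complex) \<Rightarrow> real \<Rightarrow> complex" where
  "nth_deriv n f = ((\<lambda>g x. vector_derivative g (at x)) ^^ n) f"

definition schwartz :: "(real \<Rightarrow> complex) set" where
  "schwartz = {f. (\<forall>n x. nth_deriv n f differentiable at x) \<and>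
     (\<forall>m n. bounded (range (\<lambda>x. of_real (x ^ m) * nth_deriv n f x)))}"

text \<open>For the potentials considered here there is exactly one such \<open>H\<close>.\<close>

definition is_schrodinger_operator :: "(real \<Rightarrow> real) \<Rightarrow> L2_graph \<Rightarrow> bool" where
  "is_schrodinger_operator V H \<longleftrightarrow> self_adjoint H \<and>
     (\<forall>u\<in>schwartz. (u, \<lambda>x. - nth_deriv 2 u x + of_real (V x) * u x) \<in> H)"

definition is_eigenbasis ::
    "L2_graph \<Rightarrow> (nat \<Rightarrow> real \<Rightarrow> complex) \<Rightarrow> (nat \<Rightarrow> real) \<Rightarrow> bool" where
  "is_eigenbasis H \<phi> \<mu> \<longleftrightarrow> orthonormal_basis \<phi> \<and>
     0 < \<mu> 0 \<and> incseq \<mu> \<and> filterlim \<mu> at_top sequentially \<and>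
     (\<forall>k. (\<phi> k, \<lambda>x. of_real ((\<mu> k)\<^sup>2) * \<phi> k x) \<in> H)"

definition spectral_subspace ::
    "(nat \<Rightarrow> real \<Rightarrow> complex) \<Rightarrow> (nat \<Rightarrow> real) \<Rightarrow> real \<Rightarrow> (real \<Rightarrow> complex) set" where
  "spectral_subspace \<phi> \<mu> l = L2_span \<phi> {k. \<mu> k \<le> l}"

end

(* The argument is one-dimensional and real. For f in the span of the eigenfunctions with frequency at
   most m >= 1, the functions u_j = (d^2/dx^2 - V)^j f lie in the same span and |u_j| <= 2 m^(2j+1) ||f||.
   If w > 0 solves w'' = V w on an interval, then u_0/w, w u_0' - w' u_0, u_1/w, w u_1' - w' u_1, ... is a
   chain v_0, v_1, ... with v_i' = g_i v_(i+1), where g_i is w^(-2) or w^2, and Rolle's theorem applies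
   along it as it does to the derivatives of one function. If |v_0| is small on a set of positive measure,
   counting zeros yields points at which v_i is small for each i < n; since v_n is at most of the order
   m^n, the chain can be integrated back, and for n of the order of m it bounds f on the whole interval up
   to an error 4^(-n) ||f||. At least half of the mass of f lies in |x| <= C m^(2/beta_1), where the scale
   rho keeps the ratio sup w / inf w below a power of log <x>. *)

theory Submission
  imports Defs "HOL-Analysis.Analysis"
begin

section \<open>A Remez inequality for chains of derivatives\<close>

text \<open>As V is only measurable and locally bounded, f has in general no classical derivatives
  beyond the first, so neither Taylor expansion nor analytic continuation is available. The
  factorization u'' - V u = w^(-1) (w^2 (u / w)')' gives steps in which V no longer occurs; the
  price is a weight between W^(-2) and W^2 when 1 <= w <= W. Integrating back over an interval of
  length d is harmless once the number n of steps exceeds a multiple of m W^2 d. This is why the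
  growth of W matters: a power of log <x> stays below m^e for every e > 0, so n exceeds m only by
  such a factor. A set of measure \<delta> enters through Q^n, with Q polynomial in n, W and 1 /
  \<delta>. Thickness makes \<delta> about \<gamma>^(J^\<tau>) with J of the order m^(2 / \<beta>1);
  hence log Q is of the order m^(2 \<tau> / \<beta>1), up to a factor m^e, and n log Q stays within
  the exponent claimed. The error 4^(-n) is multiplied by at most e^(n / 2) and a power of m, so for
  large n it is absorbed by half of the norm of f.\<close>

lemma mvt_within:
  fixes f f' :: "real \<Rightarrow> real"
  assumes "\<And>x. x \<in> {a..b} \<Longrightarrow> (f has_real_derivative f' x) (at x within {a..b})"
    and "a \<le> s" "s < t" "t \<le> b"
  obtains z where "s < z" "z < t" "f t - f s = f' z * (t - s)"
proof -
  have "\<exists>z\<in>{s<..<t}. f t - f s = (\<lambda>h. f' z * h) (t - s)"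
  proof (rule mvt_simple)
    fix x assume "s \<le> x" "x \<le> t"
    then have "(f has_real_derivative f' x) (at x within {s..t})"
      using assms by (intro DERIV_subset[OF assms(1)]) auto
    then show "(f has_derivative (\<lambda>h. f' x * h)) (at x within {s..t})"
      by (simp add: has_field_derivative_def)
  qed fact
  then show thesis using that by auto
qed

text \<open>Rolle's theorem for finitely many level points. The induction adds the largest point;
  the zero gained lies beyond the old maximum, and the clause \<open>z < Max T\<close> is what shows
  that it is new.\<close>

lemma zeros_between_level_points:
  fixes f f' :: "real \<Rightarrow> real"
  assumes d: "\<And>x. x \<in> {a..b} \<Longrightarrow> (f has_real_derivative f' x) (at x within {a..b})"
    and "finite T" "T \<noteq> {}" "T \<subseteq> {x\<in>{a..b}. f x = c}"
  shows "\<exists>Z. finite Z \<and> Suc (card Z) = card T \<and> Z \<subseteq> {x\<in>{a..b}. f' x = 0} \<and> (\<forall>z\<in>Z. z < Max T)"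
  using assms(2-4)
proof (induction T rule: finite_linorder_max_induct)
  case empty
  then show ?case by simp
next
  case (insert t A)
  show ?case
  proof (cases "A = {}")
    case True
    then show ?thesis by (intro exI[of _ "{}"]) auto
  next
    case False
    define s where "s = Max A"
    have s: "s \<in> A" unfolding s_def using insert False by simp
    from insert False obtain Z where Z: "finite Z" "Suc (card Z) = card A"
      "Z \<subseteq> {x\<in>{a..b}. f' x = 0}" "\<forall>z\<in>Z. z < Max A" by blast
    have st: "s < t" "a \<le> s" "t \<le> b" "f s = c" "f t = c" using s insert by auto
    obtain z where z: "s < z" "z < t" "f t - f s = f' z * (t - s)"
      using mvt_within[OF d st(2,1,3)] by blast
    then have "f' z = 0" using st by auto
    moreover have "Max (insert t A) = t"
      by (intro Max_eqI) (use insert in \<open>auto intro: less_imp_le\<close>)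
    moreover have "z \<notin> Z" using Z(4) z(1) by (auto simp: s_def)
    moreover have "t \<notin> A" using insert by auto
    ultimately show ?thesis
      using Z z st insert(1) by (intro exI[of _ "insert z Z"]) (force simp: s_def)
  qed
qed

text \<open>The count is made for finite subsets; a subset with k + 2 points would contradict it,
  which excludes an infinite level set as well.\<close>

lemma card_level_set_le:
  fixes f f' :: "real \<Rightarrow> real"
  assumes d: "\<And>x. x \<in> {a..b} \<Longrightarrow> (f has_real_derivative f' x) (at x within {a..b})"
    and Z: "finite {x\<in>{a..b}. f' x = 0}" "card {x\<in>{a..b}. f' x = 0} \<le> k"
  shows "finite {x\<in>{a..b}. f x = c} \<and> card {x\<in>{a..b}. f x = c} \<le> Suc k"
proof -
  have *: "card T \<le> Suc k" if T: "finite T" "T \<subseteq> {x\<in>{a..b}. f x = c}" for T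
  proof (cases "T = {}")
    case False
    then obtain Y where "Suc (card Y) = card T" "Y \<subseteq> {x\<in>{a..b}. f' x = 0}"
      using zeros_between_level_points[OF d T(1) _ T(2)] by blast
    then show ?thesis using card_mono[OF Z(1), of Y] Z(2) by simp
  qed simp
  have "finite {x\<in>{a..b}. f x = c}"
  proof (rule ccontr)
    assume "infinite {x\<in>{a..b}. f x = c}"
    then obtain T where "finite T" "card T = Suc (Suc k)" "T \<subseteq> {x\<in>{a..b}. f x = c}"
      using infinite_arbitrarily_large by blast
    then show False using * by fastforce
  qed
  then show ?thesis using * by blast
qed

section \<open>Measure of sets with short gaps\<close>

lemma measure_le_diameter:
  fixes E :: "real set"
  assumes E: "E \<in> sets lebesgue" "E \<subseteq> {a..b}" and d: "0 \<le> d"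
    and diam: "\<And>x y. x \<in> E \<Longrightarrow> y \<in> E \<Longrightarrow> x < y \<Longrightarrow> y - x \<le> d"
  shows "measure lebesgue E \<le> d"
proof (cases "E = {}")
  case False
  have bdd: "bdd_below E" using E(2) by (meson bdd_below_mono bdd_below_Icc)
  define i where "i = Inf E"
  have "E \<subseteq> {i..i+d}"
  proof
    fix y assume y: "y \<in> E"
    have "y - d \<le> i" unfolding i_def
    proof (rule cInf_greatest[OF False])
      fix x assume "x \<in> E"
      then show "y - d \<le> x" using diam[of x y] y d by (cases "x < y") auto
    qed
    moreover have "i \<le> y" unfolding i_def using bdd y by (rule cInf_lower[rotated])
    ultimately show "y \<in> {i..i+d}" by auto
  qed
  then have "measure lebesgue E \<le> measure lebesgue {i..i+d}"
    using E by (intro measure_mono_fmeasurable) auto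
  then show ?thesis using d by simp
qed (use d in simp)

text \<open>The points of \<open>S\<close> cut the line into \<open>card S + 1\<close> pieces, and
  in each of them \<open>E\<close> has diameter at most \<open>d\<close>. The induction splits off
  the part beyond the largest point; the cutting points have measure zero.\<close>

lemma measure_le_of_short_gaps:
  fixes E :: "real set"
  assumes "finite S" and "E \<in> sets lebesgue" "E \<subseteq> {a..b}" "0 \<le> d"
    and "\<And>x y. x \<in> E \<Longrightarrow> y \<in> E \<Longrightarrow> x < y \<Longrightarrow> S \<inter> {x..y} = {} \<Longrightarrow> y - x \<le> d"
  shows "measure lebesgue E \<le> (real (card S) + 1) * d"
  using assms
proof (induction S arbitrary: E b rule: finite_linorder_max_induct)
  case empty
  then show ?case using measure_le_diameter[of E a b d] by simp
next
  case (insert s A)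
  have E: "E \<in> lmeasurable"
    using insert by (meson bounded_closed_interval bounded_subset bounded_set_imp_lmeasurable)
  have m: "E \<inter> {..<s} \<in> lmeasurable" "E \<inter> {s<..} \<in> lmeasurable" "{s} \<in> lmeasurable"
    using E lmeasurable_compact[of "{s}"] by (auto intro!: fmeasurable_Int_fmeasurable)
  have 1: "measure lebesgue (E \<inter> {..<s}) \<le> (real (card A) + 1) * d"
  proof (rule insert.IH)
    show "E \<inter> {..<s} \<subseteq> {a..b}" "E \<inter> {..<s} \<in> sets lebesgue" "0 \<le> d"
      using insert.prems m by auto
    fix x y assume "x \<in> E \<inter> {..<s}" "y \<in> E \<inter> {..<s}" "x < y" "A \<inter> {x..y} = {}"
    then show "y - x \<le> d" by (intro insert.prems) auto
  qed
  have 2: "measure lebesgue (E \<inter> {s<..}) \<le> d"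
  proof (rule measure_le_diameter)
    show "E \<inter> {s<..} \<in> sets lebesgue" "E \<inter> {s<..} \<subseteq> {a..b}" "0 \<le> d"
      using m insert.prems by auto
    fix x y assume "x \<in> E \<inter> {s<..}" "y \<in> E \<inter> {s<..}" "x < y"
    moreover have "insert s A \<inter> {x..y} = {}" using \<open>x \<in> E \<inter> {s<..}\<close> insert.hyps by fastforce
    ultimately show "y - x \<le> d" by (intro insert.prems(4)) auto
  qed
  have "measure lebesgue E \<le> measure lebesgue ((E \<inter> {..<s}) \<union> {s} \<union> (E \<inter> {s<..}))"
    using m E by (intro measure_mono_fmeasurable fmeasurable.Un) auto
  also have "\<dots> \<le> measure lebesgue (E \<inter> {..<s}) + measure lebesgue {s} + measure lebesgue (E \<inter> {s<..})"
    using fmeasurableD[OF m(1)] fmeasurableD[OF m(2)] fmeasurableD[OF m(3)]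
    by (intro order_trans[OF measure_Un_le] add_right_mono measure_Un_le sets.Un)
  also have "\<dots> \<le> (real (card A) + 1) * d + d" using 1 2 by simp
  also have "\<dots> = (real (card (insert s A)) + 1) * d"
  proof -
    have "s \<notin> A" using insert.hyps by auto
    then show ?thesis using insert.hyps by (simp add: algebra_simps)
  qed
  finally show ?case .
qed

text \<open>Rolle's theorem only asks that the weights \<open>g i\<close> do not vanish; the
  quantitative bounds use that they lie between \<open>1 / K\<close> and \<open>K\<close>.
  Continuity is demanded of the last function alone, because the others are differentiable.\<close>

locale derivative_chain =
  fixes a b K :: real and n :: nat and g v :: "nat \<Rightarrow> real \<Rightarrow> real"
  assumes K: "1 \<le> K"
    and g: "\<And>i x. i < n \<Longrightarrow> x \<in> {a..b} \<Longrightarrow> 1 / K \<le> g i x \<and> g i x \<le> K"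
    and deriv: "\<And>i x. i < n \<Longrightarrow> x \<in> {a..b} \<Longrightarrow>
      (v i has_real_derivative g i x * v (Suc i) x) (at x within {a..b})"
    and cont_top: "continuous_on {a..b} (v n)"
begin

lemma cont: "i \<le> n \<Longrightarrow> continuous_on {a..b} (v i)"
  using DERIV_continuous_on[OF deriv, of i] cont_top by (cases "i = n") auto

lemma g_pos: "i < n \<Longrightarrow> x \<in> {a..b} \<Longrightarrow> 0 < g i x"
  using g[of i x] K by (smt (verit) divide_pos_pos)

text \<open>Two restrictions occur below: to a short piece of the interval, and to an initial
  segment of the chain.\<close>

lemma restrict:
  assumes "a \<le> a'" "b' \<le> b" "m \<le> n"
  shows "derivative_chain a' b' K m g v"
proof
  fix i x assume *: "i < m" "x \<in> {a'..b'}"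
  then show "1 / K \<le> g i x \<and> g i x \<le> K" using g assms by auto
  show "(v i has_real_derivative g i x * v (Suc i) x) (at x within {a'..b'})"
    using * assms by (intro DERIV_subset[OF deriv]) auto
next
  show "continuous_on {a'..b'} (v m)"
    using assms by (intro continuous_on_subset[OF cont]) auto
qed (rule K)

text \<open>Downward induction from the last function, which has no zeros. Since \<open>g i\<close>
  is positive, the zeros of the derivative of \<open>v i\<close> are those of
  \<open>v (Suc i)\<close>, and Rolle's theorem adds at most one point per step.\<close>

lemma card_level_set:
  assumes "\<And>x. x \<in> {a..b} \<Longrightarrow> v n x \<noteq> 0" "i < n"
  shows "finite {x\<in>{a..b}. v i x = c} \<and> card {x\<in>{a..b}. v i x = c} \<le> n - i"
  using \<open>i < n\<close>
proof (induction "n - i" arbitrary: i c)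
  case 0
  then show ?case by simp
next
  case (Suc k)
  have eq: "{x\<in>{a..b}. g i x * v (Suc i) x = 0} = {x\<in>{a..b}. v (Suc i) x = 0}"
    using g_pos[OF Suc.prems] by fastforce
  have "finite {x\<in>{a..b}. v (Suc i) x = 0} \<and> card {x\<in>{a..b}. v (Suc i) x = 0} \<le> k"
  proof (cases "Suc i = n")
    case True
    then have "{x\<in>{a..b}. v (Suc i) x = 0} = {}" using assms(1) by auto
    then show ?thesis by (simp only: finite.emptyI card.empty) simp
  next
    case False
    moreover have "k = n - Suc i" using Suc.hyps(2) by simp
    ultimately show ?thesis using Suc.hyps(1)[of "Suc i" 0] Suc.prems by simp
  qed
  then show ?case
    using card_level_set_le[OF deriv[OF Suc.prems], of k c] Suc.hyps(2) eq by simp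
qed

text \<open>On \<open>E\<close> the function \<open>v 0\<close> is below its threshold while
  \<open>v n\<close> is above, so somewhere along the chain the relation switches. This covers
  \<open>E\<close> by n sets on which \<open>v i\<close> is still small and \<open>v (Suc i)\<close>
  already large; each of them lies in at most 2 n short pieces.\<close>

lemma sublevel_measure_le:
  assumes E: "E \<in> sets lebesgue" "E \<subseteq> {a..b}" "\<And>x. x \<in> E \<Longrightarrow> \<bar>v 0 x\<bar> \<le> \<eta>"
    and pos: "0 < \<eta>" "0 < q"
    and large: "\<And>x. x \<in> {a..b} \<Longrightarrow> \<eta> * q ^ n < \<bar>v n x\<bar>"
  shows "measure lebesgue E \<le> 4 * n\<^sup>2 * K / q"
proof -
  (* The thresholds grow by the factor q, so on A i the slope of v i is large compared with its size:
     between two zeros of v (Suc i) -/+ the threshold the set A i is shorter than 2 K / q. *)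
  define A where "A i = {x\<in>{a..b}. \<bar>v i x\<bar> \<le> \<eta> * q ^ i} - {x\<in>{a..b}. \<bar>v (Suc i) x\<bar> \<le> \<eta> * q ^ Suc i}" for i
  have clm: "{x\<in>{a..b}. \<bar>v i x\<bar> \<le> c} \<in> lmeasurable" if "i \<le> n" for i c
  proof -
    have "closed {x\<in>{a..b}. \<bar>v i x\<bar> \<le> c}"
      using cont[OF that] by (intro continuous_on_closed_Collect_le continuous_on_rabs) auto
    moreover have "bounded {x\<in>{a..b}. \<bar>v i x\<bar> \<le> c}"
      by (rule bounded_subset[OF bounded_closed_interval[of a b]]) auto
    ultimately show ?thesis by (simp add: lmeasurable_compact compact_eq_bounded_closed)
  qed
  have Am: "A i \<in> lmeasurable" if "i < n" for i
    unfolding A_def using clm[of i] clm[of "Suc i"] that by (intro fmeasurable_Diff fmeasurableD) auto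
  have nz: "v n x \<noteq> 0" if "x \<in> {a..b}" for x
    using large[OF that] pos by (smt (verit) mult_pos_pos zero_less_power)
  have A: "measure lebesgue (A i) \<le> 2 * n * (2 * K / q)" if i: "i < n" for i
  proof -
    define c where "c = \<eta> * q ^ Suc i"
    have c: "0 < c" using pos by (simp add: c_def)
    define S where "S = {x\<in>{a..b}. \<bar>v (Suc i) x\<bar> = c}"
    \<comment> \<open>Two levels, c and -c, are counted, each at most \<open>n - Suc i\<close>
      times. For the last function the count is zero, because \<open>large\<close> keeps it above
      the level.\<close>
    have S: "finite S \<and> card S \<le> 2 * (n - Suc i)"
    proof (cases "Suc i = n")
      case True
      then have "S = {}" using large by (fastforce simp: S_def c_def)
      then show ?thesis by simp
    next
      case False
      then have "Suc i < n" using i by simp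
      note l = card_level_set[OF nz this]
      have eq: "S = {x\<in>{a..b}. v (Suc i) x = c} \<union> {x\<in>{a..b}. v (Suc i) x = - c}"
        using c by (auto simp: S_def)
      have "card S \<le> card {x\<in>{a..b}. v (Suc i) x = c} + card {x\<in>{a..b}. v (Suc i) x = - c}"
        unfolding eq by (rule card_Un_le)
      then show ?thesis using l[of c] l[of "-c"] by (auto simp: eq)
    qed
    have "measure lebesgue (A i) \<le> (real (card S) + 1) * (2 * K / q)"
    proof (rule measure_le_of_short_gaps)
      show "finite S" using S by blast
      show "A i \<in> sets lebesgue" using Am[OF i] by auto
      show "A i \<subseteq> {a..b}" by (auto simp: A_def)
      show "0 \<le> 2 * K / q" using K pos by simp
      fix x y assume xy: "x \<in> A i" "y \<in> A i" "x < y" "S \<inter> {x..y} = {}"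
      have sub: "{x..y} \<subseteq> {a..b}" using xy by (auto simp: A_def)
      have xc: "c < \<bar>v (Suc i) x\<bar>" using xy by (auto simp: A_def c_def)
      \<comment> \<open>At x the modulus of \<open>v (Suc i)\<close> exceeds \<open>c\<close>;
        falling to \<open>c\<close> before y would produce a point of \<open>S\<close> by the
        intermediate value theorem.\<close>
      have big: "c < \<bar>v (Suc i) z\<bar>" if z: "z \<in> {x..y}" for z
      proof (rule ccontr)
        assume "\<not> c < \<bar>v (Suc i) z\<bar>"
        then have "\<exists>w\<ge>x. w \<le> z \<and> \<bar>v (Suc i) w\<bar> = c"
          using xc z i sub by (intro IVT2') (auto intro!: continuous_on_rabs continuous_on_subset[OF cont])
        then obtain w where w: "x \<le> w" "w \<le> z" "\<bar>v (Suc i) w\<bar> = c" by blast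
        then have "w \<in> S \<inter> {x..y}" using z sub by (auto simp: S_def)
        then show False using xy(4) by blast
      qed
      obtain z where z: "x < z" "z < y" "v i y - v i x = g i z * v (Suc i) z * (y - x)"
        using mvt_within[OF deriv[OF i] _ xy(3)] sub xy(3) by auto
      have "c / K \<le> g i z * \<bar>v (Suc i) z\<bar>"
      proof -
        have "1 / K * c \<le> g i z * \<bar>v (Suc i) z\<bar>"
          using g[OF i, of z] g_pos[OF i, of z] big[of z] z sub c K by (intro mult_mono) auto
        then show ?thesis by simp
      qed
      \<comment> \<open>The slope of \<open>v i\<close> is at least c / K in modulus, while its end
        values differ by at most twice their threshold; since \<open>c\<close> is q times that
        threshold, the length is at most 2 K / q.\<close>
      then have "c / K * (y - x) \<le> g i z * \<bar>v (Suc i) z\<bar> * (y - x)"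
        using xy(3) by (intro mult_right_mono) auto
      also have "\<dots> = \<bar>v i y - v i x\<bar>"
        unfolding z(3) using g_pos[OF i, of z] z sub xy(3) by (simp add: abs_mult)
      also have "\<dots> \<le> 2 * (\<eta> * q ^ i)" using xy by (auto simp: A_def)
      finally have "(\<eta> * q ^ i) * (q / K * (y - x)) \<le> (\<eta> * q ^ i) * 2" by (simp add: c_def mult_ac)
      then have "q / K * (y - x) \<le> 2" using pos by (subst (asm) mult_le_cancel_left_pos) auto
      then show "y - x \<le> 2 * K / q" using K pos by (simp add: field_simps)
    qed
    also have "\<dots> \<le> 2 * n * (2 * K / q)"
      using S i K pos by (intro mult_right_mono) auto
    finally show ?thesis .
  qed
  have "E \<subseteq> (\<Union>i<n. A i)"
  proof
    fix x assume x: "x \<in> E"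
    have "\<exists>i<n. \<bar>v i x\<bar> \<le> \<eta> * q ^ i \<and> \<not> \<bar>v (Suc i) x\<bar> \<le> \<eta> * q ^ Suc i"
    proof (rule ccontr)
      assume H: "\<not> ?thesis"
      have "i \<le> n \<Longrightarrow> \<bar>v i x\<bar> \<le> \<eta> * q ^ i" for i
        by (induction i) (use H E(3)[OF x] in auto)
      then show False using large[of x] x E(2) by force
    qed
    then show "x \<in> (\<Union>i<n. A i)" using x E(2) by (auto simp: A_def)
  qed
  then have "measure lebesgue E \<le> measure lebesgue (\<Union>i<n. A i)"
    using Am E by (intro measure_mono_fmeasurable) auto
  also have "\<dots> \<le> (\<Sum>i<n. measure lebesgue (A i))"
    using Am by (intro measure_UNION_le) auto
  also have "\<dots> \<le> (\<Sum>i<n. 2 * n * (2 * K / q))"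
    using A by (intro sum_mono) auto
  also have "\<dots> = 4 * n\<^sup>2 * K / q" by (simp add: power2_eq_square)
  finally show ?thesis .
qed

text \<open>By contraposition: if \<open>v j\<close> stayed above its threshold on the whole
  interval, the chain cut off after \<open>j\<close> would force \<open>E\<close> to be
  small.\<close>

lemma exists_small_points:
  assumes E: "E \<in> sets lebesgue" "E \<subseteq> {a..b}" "\<And>x. x \<in> E \<Longrightarrow> \<bar>v 0 x\<bar> \<le> \<eta>"
    and pos: "0 < \<eta>" "0 < q"
    and big: "4 * n\<^sup>2 * K / q < measure lebesgue E" and j: "j \<le> n"
  shows "\<exists>x\<in>{a..b}. \<bar>v j x\<bar> \<le> \<eta> * q ^ j"
proof (rule ccontr)
  assume "\<not> ?thesis"
  then have *: "\<And>x. x \<in> {a..b} \<Longrightarrow> \<eta> * q ^ j < \<bar>v j x\<bar>" by force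
  interpret J: derivative_chain a b K j g v by (rule restrict) (use j in auto)
  have "measure lebesgue E \<le> 4 * j\<^sup>2 * K / q"
    by (rule J.sublevel_measure_le[OF E pos *])
  also have "\<dots> \<le> 4 * n\<^sup>2 * K / q"
    using j K pos by (intro divide_right_mono mult_right_mono mult_left_mono power_mono) auto
  finally show False using big by simp
qed

text \<open>Downward induction. The scale \<open>(4 * \<Lambda>) ^ j\<close> in place of
  \<open>\<Lambda> ^ j\<close> turns the bound on the last function into \<open>M / 4 ^ n\<close>.
  At each level one half of the bound is spent on the value at the small point, the other on the
  variation over the interval, which \<open>short\<close> controls.\<close>

lemma small_on_short_interval:
  assumes pts: "\<And>j. j < n \<Longrightarrow> \<exists>x\<in>{a..b}. \<bar>v j x\<bar> \<le> \<eta> * q ^ j"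
    and pos: "0 < \<eta>" "1 \<le> q" "0 \<le> M" "1 \<le> \<Lambda>"
    and short: "8 * K * \<Lambda> * (b - a) \<le> 1"
    and top: "\<And>x. x \<in> {a..b} \<Longrightarrow> \<bar>v n x\<bar> \<le> M * \<Lambda> ^ n"
    and "j \<le> n" "x \<in> {a..b}"
  shows "\<bar>v j x\<bar> \<le> (4 * \<Lambda>) ^ j * (2 * \<eta> * q ^ n + M / 4 ^ n)"
  using \<open>j \<le> n\<close> \<open>x \<in> {a..b}\<close>
proof (induction "n - j" arbitrary: j x)
  case 0
  then have "j = n" by simp
  have "M * \<Lambda> ^ n = (4 * \<Lambda>) ^ n * (M / 4 ^ n)" by (simp add: power_mult_distrib)
  also have "\<dots> \<le> (4 * \<Lambda>) ^ n * (2 * \<eta> * q ^ n + M / 4 ^ n)"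
    using pos by (intro mult_left_mono) auto
  finally show ?case using top[OF 0(3)] \<open>j = n\<close> by simp
next
  case (Suc k)
  then have j: "j < n" by simp
  define Q where "Q = 2 * \<eta> * q ^ n + M / 4 ^ n"
  have Q: "2 * (\<eta> * q ^ n) \<le> Q" "0 \<le> Q" using pos by (auto simp: Q_def)
  obtain y where y: "y \<in> {a..b}" "\<bar>v j y\<bar> \<le> \<eta> * q ^ j" using pts[OF j] by blast
  have "norm (v j x - v j y) \<le> (K * ((4 * \<Lambda>) ^ Suc j * Q)) * norm (x - y)"
  proof (rule field_differentiable_bound[where S = "{a..b}"])
    fix z assume z: "z \<in> {a..b}"
    show "(v j has_real_derivative g j z * v (Suc j) z) (at z within {a..b})" by (rule deriv[OF j z])
    have "\<bar>v (Suc j) z\<bar> \<le> (4 * \<Lambda>) ^ Suc j * Q"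
      unfolding Q_def using Suc.hyps(2) j z by (intro Suc.hyps(1)) auto
    then show "norm (g j z * v (Suc j) z) \<le> K * ((4 * \<Lambda>) ^ Suc j * Q)"
      using g[OF j z] g_pos[OF j z] K unfolding norm_mult by (intro mult_mono) auto
  qed (use Suc.prems y in auto)
  also have "\<dots> \<le> (K * ((4 * \<Lambda>) ^ Suc j * Q)) * (b - a)"
    using Suc.prems y pos Q K by (intro mult_left_mono) auto
  also have "\<dots> = (8 * K * \<Lambda> * (b - a)) * ((4 * \<Lambda>) ^ j * (Q / 2))" by simp
  also have "\<dots> \<le> 1 * ((4 * \<Lambda>) ^ j * (Q / 2))"
    using short pos Q by (intro mult_right_mono) auto
  finally have "\<bar>v j x - v j y\<bar> \<le> (4 * \<Lambda>) ^ j * (Q / 2)" by simp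
  then have "\<bar>v j x\<bar> \<le> \<eta> * q ^ j + (4 * \<Lambda>) ^ j * (Q / 2)" using y(2) by linarith
  also have "\<eta> * q ^ j \<le> 1 * (\<eta> * q ^ n)"
    using pos j by (simp add: power_increasing)
  also have "\<dots> \<le> (4 * \<Lambda>) ^ j * (Q / 2)"
    using pos Q by (intro mult_mono one_le_power) auto
  finally show ?case by (simp add: Q_def mult_ac)
qed

end

text \<open>Comparison with the exponential: its difference to f, and to -f, is nonnegative at y and
  cannot decrease on the way from y to x.\<close>

lemma exp_growth_bound:
  fixes f f' :: "real \<Rightarrow> real"
  assumes d: "\<And>x. x \<in> {a..b} \<Longrightarrow> (f has_real_derivative f' x) (at x within {a..b})"
    and bd: "\<And>x. x \<in> {a..b} \<Longrightarrow> \<bar>f' x\<bar> \<le> c * C * exp (c * \<bar>x - y\<bar>)"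
    and "x \<in> {a..b}" "y \<in> {a..b}" "\<bar>f y\<bar> \<le> C" "0 \<le> c"
  shows "\<bar>f x\<bar> \<le> C * exp (c * \<bar>x - y\<bar>)"
proof (cases "x = y")
  case False
  \<comment> \<open>The modulus is not differentiable at y, so the side on which x lies is fixed
    first: between y and x the distance is \<open>s * (t - y)\<close>, which is linear in t. The
    sign \<sigma> chooses between f and -f.\<close>
  define s where "s = sgn (x - y)"
  define h where "h \<sigma> t = C * exp (c * (s * (t - y))) - \<sigma> * f t" for \<sigma> t
  define h' where "h' \<sigma> t = C * (exp (c * (s * (t - y))) * (c * s)) - \<sigma> * f' t" for \<sigma> t
  have dh: "(h \<sigma> has_real_derivative h' \<sigma> t) (at t within {a..b})" if "t \<in> {a..b}" for \<sigma> t
    unfolding h_def h'_def by (rule derivative_eq_intros d[OF that] refl | simp)+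
  have s: "s = 1 \<or> s = -1" "s * (x - y) = \<bar>x - y\<bar>" using False by (auto simp: s_def sgn_if)
  have "\<sigma> * f x \<le> C * exp (c * \<bar>x - y\<bar>)" if \<sigma>: "\<sigma> = 1 \<or> \<sigma> = -1" for \<sigma>
  proof -
    have "\<exists>z\<in>{a..b}. h \<sigma> x - h \<sigma> y = h' \<sigma> z * (x - y) \<and> s * (z - y) = \<bar>z - y\<bar>"
    proof (cases "y < x")
      case True
      obtain z where "y < z" "z < x" "h \<sigma> x - h \<sigma> y = h' \<sigma> z * (x - y)"
        using mvt_within[OF dh, of y x] True assms(3,4) by auto
      then show ?thesis using True assms(3,4) by (intro bexI[of _ z]) (auto simp: s_def)
    next
      case no: False
      then have "x < y" using False by simp
      then obtain z where "x < z" "z < y" "h \<sigma> y - h \<sigma> x = h' \<sigma> z * (y - x)"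
        using mvt_within[OF dh, of x y] assms(3,4) by auto
      then show ?thesis using no assms(3,4) by (intro bexI[of _ z]) (auto simp: s_def sgn_if algebra_simps)
    qed
    then obtain z where z: "z \<in> {a..b}" "h \<sigma> x - h \<sigma> y = h' \<sigma> z * (x - y)" "s * (z - y) = \<bar>z - y\<bar>"
      by blast
    have "h' \<sigma> z * (x - y) = \<bar>x - y\<bar> * (c * C * exp (c * \<bar>z - y\<bar>) - \<sigma> * s * f' z)"
      unfolding s(2)[symmetric] h'_def z(3) using s(1) by (auto simp: algebra_simps)
    also have "\<dots> \<ge> 0"
      using bd[OF z(1)] s(1) \<sigma> by (intro mult_nonneg_nonneg) auto
    finally have "h \<sigma> y \<le> h \<sigma> x" using z(2) by simp
    moreover have "0 \<le> h \<sigma> y" using assms(5) \<sigma> by (auto simp: h_def)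
    ultimately show ?thesis by (simp add: h_def s(2))
  qed
  from this[of 1] this[of "-1"] show ?thesis by auto
qed (use assms in auto)

context derivative_chain
begin

text \<open>The rate is the same at every level: the bound for \<open>v (Suc j)\<close> times the
  weight \<open>K\<close> is exactly \<open>4 * \<Lambda> * K\<close> times the bound for
  \<open>v j\<close>. Hence no loss accumulates over the levels.\<close>

lemma exp_growth:
  assumes Q: "0 \<le> Q" "1 \<le> \<Lambda>" and y: "y \<in> {a..b}"
    and at_y: "\<And>j. j < n \<Longrightarrow> \<bar>v j y\<bar> \<le> (4 * \<Lambda>) ^ j * Q"
    and top: "\<And>x. x \<in> {a..b} \<Longrightarrow> \<bar>v n x\<bar> \<le> (4 * \<Lambda>) ^ n * Q"
    and "j \<le> n" "x \<in> {a..b}"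
  shows "\<bar>v j x\<bar> \<le> (4 * \<Lambda>) ^ j * Q * exp (4 * \<Lambda> * K * \<bar>x - y\<bar>)"
  using \<open>j \<le> n\<close> \<open>x \<in> {a..b}\<close>
proof (induction "n - j" arbitrary: j x)
  case 0
  have "(4 * \<Lambda>) ^ n * Q * 1 \<le> (4 * \<Lambda>) ^ n * Q * exp (4 * \<Lambda> * K * \<bar>x - y\<bar>)"
    using Q K by (intro mult_left_mono) auto
  moreover have "j = n" using 0 by simp
  ultimately show ?case using top[OF 0(3)] by (simp only: mult_1_right)
next
  case (Suc k)
  then have j: "j < n" by simp
  show ?case
  proof (rule exp_growth_bound[OF deriv[OF j]])
    fix z assume z: "z \<in> {a..b}"
    have "\<bar>v (Suc j) z\<bar> \<le> (4 * \<Lambda>) ^ Suc j * Q * exp (4 * \<Lambda> * K * \<bar>z - y\<bar>)"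
      using Suc.hyps(2) j z by (intro Suc.hyps(1)) auto
    then have "\<bar>g j z * v (Suc j) z\<bar> \<le> K * ((4 * \<Lambda>) ^ Suc j * Q * exp (4 * \<Lambda> * K * \<bar>z - y\<bar>))"
      using g[OF j z] g_pos[OF j z] K unfolding abs_mult by (intro mult_mono) auto
    then show "\<bar>g j z * v (Suc j) z\<bar>
        \<le> 4 * \<Lambda> * K * ((4 * \<Lambda>) ^ j * Q) * exp (4 * \<Lambda> * K * \<bar>z - y\<bar>)"
      by (simp add: mult_ac)
  qed (use Suc.prems y at_y j Q K in auto)
qed

lemma exists_dense_piece:
  assumes E: "E \<in> sets lebesgue" "E \<subseteq> {a..b}" and "a < b" "0 < m"
  obtains a' b' where "a \<le> a'" "a' \<le> b'" "b' \<le> b" "b' - a' = (b - a) / real m"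
    "measure lebesgue E / real m \<le> measure lebesgue (E \<inter> {a'..b'})"
proof -
  define h where "h = (b - a) / real m"
  have h: "0 < h" "real m * h = b - a" using assms by (auto simp: h_def)
  define J where "J i = {a + real i * h .. a + real (Suc i) * h}" for i :: nat
  have "E \<subseteq> (\<Union>i<m. E \<inter> J i)"
  proof
    fix x assume x: "x \<in> E"
    define y where "y = (x - a) / h"
    have y: "0 \<le> y" "y \<le> real m" "x = a + y * h"
      using x E(2) h by (auto simp: y_def field_simps)
    \<comment> \<open>The ceiling minus one, rather than the floor, puts the right end point y = m
      into the last piece; truncated subtraction takes care of y = 0.\<close>
    define i where "i = nat \<lceil>y\<rceil> - 1"
    have "\<lceil>y\<rceil> \<le> int m" "0 \<le> \<lceil>y\<rceil>" using y by (auto simp: ceiling_le_iff)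
    then have "i < m" "real i \<le> y" "y \<le> real (Suc i)"
      unfolding i_def using y \<open>0 < m\<close> by linarith+
    then show "x \<in> (\<Union>i<m. E \<inter> J i)"
      using x h y by (auto simp: J_def intro!: bexI[of _ i] mult_right_mono)
  qed
  moreover have lm: "E \<inter> J i \<in> lmeasurable" for i
    by (rule bounded_set_imp_lmeasurable, rule bounded_subset[OF bounded_closed_interval[of a b]])
       (use E in \<open>auto simp: J_def\<close>)
  ultimately have "measure lebesgue E \<le> measure lebesgue (\<Union>i<m. E \<inter> J i)"
    using E by (intro measure_mono_fmeasurable fmeasurable.finite_UN) auto
  also have "\<dots> \<le> (\<Sum>i<m. measure lebesgue (E \<inter> J i))"
    using lm by (intro measure_UNION_le) auto
  finally have le: "measure lebesgue E \<le> (\<Sum>i<m. measure lebesgue (E \<inter> J i))" .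
  have "\<exists>i<m. measure lebesgue E / m \<le> measure lebesgue (E \<inter> J i)"
  proof (rule ccontr)
    assume "\<not> ?thesis"
    then have "(\<Sum>i<m. measure lebesgue (E \<inter> J i)) < (\<Sum>i<m. measure lebesgue E / m)"
      using \<open>0 < m\<close> by (intro sum_strict_mono) (auto simp: not_le)
    then show False using le \<open>0 < m\<close> by simp
  qed
  then obtain i where i: "i < m" "measure lebesgue E / m \<le> measure lebesgue (E \<inter> J i)" by blast
  have "real (Suc i) * h \<le> real m * h" using i h by (intro mult_right_mono) auto
  then show thesis
    using that[of "a + real i * h" "a + real (Suc i) * h"] i h
    by (auto simp: J_def h_def[symmetric] algebra_simps)
qed

text \<open>After division into n equal pieces, \<open>large\<close> makes each piece short in the
  sense of \<open>small_on_short_interval\<close>, and a piece with its share of \<open>E\<close>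
  contains small values of every \<open>v j\<close> with j < n. From its left end point the bounds
  spread over the interval at the cost of exp (n / 2).\<close>

lemma remez_inequality:
  assumes E: "E \<in> sets lebesgue" "E \<subseteq> {a..b}" "\<And>x. x \<in> E \<Longrightarrow> \<bar>v 0 x\<bar> \<le> \<eta>"
    and E_pos: "0 < measure lebesgue E" and \<eta>: "0 < \<eta>" and n: "0 < n"
    and M: "0 \<le> M" "1 \<le> \<Lambda>" "\<And>x. x \<in> {a..b} \<Longrightarrow> \<bar>v n x\<bar> \<le> M * \<Lambda> ^ n"
    and large: "8 * \<Lambda> * K * (b - a) \<le> n" and x: "x \<in> {a..b}"
  shows "\<bar>v 0 x\<bar> \<le> (2 * \<eta> * (1 + 8 * real n ^ 3 * K / measure lebesgue E) ^ n + M / 4 ^ n) * exp (n / 2)"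
proof -
  \<comment> \<open>The quotient makes \<open>4 * n\<^sup>2 * K / q\<close> less than
    \<open>measure lebesgue E / n\<close>, the share of the chosen piece; the summand 1 ensures that
    powers of \<open>q\<close> increase.\<close>
  define q where "q = 1 + 8 * real n ^ 3 * K / measure lebesgue E"
  have q: "1 \<le> q" using K E_pos by (simp add: q_def)
  have ab: "a < b"
  proof (rule ccontr)
    assume "\<not> a < b"
    then have "measure lebesgue E \<le> measure lebesgue {a..b}"
      using E by (intro measure_mono_fmeasurable) auto
    then show False using E_pos \<open>\<not> a < b\<close> by (simp split: if_splits)
  qed
  obtain a' b' where J: "a \<le> a'" "a' \<le> b'" "b' \<le> b" "b' - a' = (b - a) / real n"
    and EJ: "measure lebesgue E / real n \<le> measure lebesgue (E \<inter> {a'..b'})"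
    using exists_dense_piece[OF E(1,2) ab n] by blast
  interpret J: derivative_chain a' b' K n g v by (rule restrict) (use J in auto)
  have dense: "4 * (real n)\<^sup>2 * K / q < measure lebesgue (E \<inter> {a'..b'})"
  proof -
    have "8 * real n ^ 3 * K / measure lebesgue E \<le> q" by (simp add: q_def)
    then have "8 * real n ^ 3 * K \<le> q * measure lebesgue E" using E_pos by (simp add: field_simps)
    then have "8 * (real n)\<^sup>2 * K / q \<le> measure lebesgue E / real n"
      using n q by (simp add: field_simps power2_eq_square power3_eq_cube)
    moreover have "4 * (real n)\<^sup>2 * K / q < 8 * (real n)\<^sup>2 * K / q"
      using n q K by (intro divide_strict_right_mono) auto
    ultimately show ?thesis using EJ by linarith
  qed
  define Q where "Q = 2 * \<eta> * q ^ n + M / 4 ^ n"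
  have Q0: "0 \<le> Q" using \<eta> q M by (simp add: Q_def)
  have top': "\<bar>v n x\<bar> \<le> (4 * \<Lambda>) ^ n * Q" if "x \<in> {a..b}" for x
  proof -
    have "M * \<Lambda> ^ n = (4 * \<Lambda>) ^ n * (M / 4 ^ n)" by (simp add: power_mult_distrib)
    also have "\<dots> \<le> (4 * \<Lambda>) ^ n * Q"
      unfolding Q_def using M q \<eta> by (intro mult_left_mono) auto
    finally show ?thesis using M(3)[OF that] by simp
  qed
  have at_a': "\<bar>v j a'\<bar> \<le> (4 * \<Lambda>) ^ j * Q" if "j < n" for j
    unfolding Q_def
  proof (rule J.small_on_short_interval)
    fix i assume i: "i < n"
    show "\<exists>x\<in>{a'..b'}. \<bar>v i x\<bar> \<le> \<eta> * q ^ i"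
      by (rule J.exists_small_points[where E = "E \<inter> {a'..b'}"]) (use E \<eta> q dense i in auto)
  next
    have "8 * K * \<Lambda> * (b' - a') = (8 * \<Lambda> * K * (b - a)) / real n" by (simp add: J(4))
    also have "\<dots> \<le> 1" using large n by simp
    finally show "8 * K * \<Lambda> * (b' - a') \<le> 1" .
  qed (use \<eta> q M J that in auto)
  have "\<bar>v 0 x\<bar> \<le> (4 * \<Lambda>) ^ 0 * Q * exp (4 * \<Lambda> * K * \<bar>x - a'\<bar>)"
    by (rule exp_growth[OF Q0 M(2) _ at_a' top']) (use J x in auto)
  also have "\<dots> \<le> Q * exp (n / 2)"
  proof -
    have "4 * \<Lambda> * K * \<bar>x - a'\<bar> \<le> 4 * \<Lambda> * K * (b - a)"
      using x J M K by (intro mult_left_mono) auto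
    also have "\<dots> \<le> n / 2" using large by simp
    finally show ?thesis using Q0 by (simp add: mult_left_mono)
  qed
  finally show ?thesis by (simp add: Q_def q_def)
qed

end

section \<open>Absolutely continuous primitives\<close>

text \<open>Expresses that F is locally absolutely continuous on S with derivative f almost
  everywhere, in the form of the fundamental theorem of calculus. An equation w'' = V w with merely
  measurable V has to be read in this way.\<close>

definition primitive_on :: "real set \<Rightarrow> (real \<Rightarrow> real) \<Rightarrow> (real \<Rightarrow> real) \<Rightarrow> bool" where
  "primitive_on S F f \<longleftrightarrow> (\<forall>x y. x \<le> y \<longrightarrow> {x..y} \<subseteq> S \<longrightarrow>
     f absolutely_integrable_on {x..y} \<and> integral {x..y} f = F y - F x)"

lemma primitive_on_absolutely_integrable:
  "primitive_on S F f \<Longrightarrow> {x..y} \<subseteq> S \<Longrightarrow> f absolutely_integrable_on {x..y}"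
  by (cases "x \<le> y") (auto simp: primitive_on_def)

lemma primitive_on_integrable:
  "primitive_on S F f \<Longrightarrow> {x..y} \<subseteq> S \<Longrightarrow> f integrable_on {x..y}"
  using primitive_on_absolutely_integrable set_lebesgue_integral_eq_integral(1) by blast

lemma primitive_on_integral:
  "primitive_on S F f \<Longrightarrow> x \<le> y \<Longrightarrow> {x..y} \<subseteq> S \<Longrightarrow> integral {x..y} f = F y - F x"
  by (auto simp: primitive_on_def)

lemma primitive_on_subset: "primitive_on S F f \<Longrightarrow> T \<subseteq> S \<Longrightarrow> primitive_on T F f"
  unfolding primitive_on_def by blast

lemma primitive_on_cong:
  assumes "primitive_on S F f" "\<And>x. x \<in> S \<Longrightarrow> f x = g x" "\<And>x. x \<in> S \<Longrightarrow> F x = G x"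
  shows "primitive_on S G g"
  unfolding primitive_on_def
proof (intro allI impI conjI)
  fix x y :: real assume xy: "x \<le> y" "{x..y} \<subseteq> S"
  show "g absolutely_integrable_on {x..y}"
    using primitive_on_absolutely_integrable[OF assms(1) xy(2)] assms(2) xy
    by (subst set_integrable_cong[where f' = f]) (auto simp: subset_iff)
  have "integral {x..y} g = integral {x..y} f"
    using assms(2) xy by (intro integral_cong) (auto simp: subset_iff)
  then show "integral {x..y} g = G y - G x"
    using primitive_on_integral[OF assms(1) xy] assms(3)[of x] assms(3)[of y] xy
    by (auto simp: subset_iff)
qed

lemma primitive_on_cong_AE:
  assumes "primitive_on S F f" "AE x in lebesgue. f x = g x"
  shows "primitive_on S F g"
  unfolding primitive_on_def
proof (intro allI impI conjI)
  fix x y :: real assume xy: "x \<le> y" "{x..y} \<subseteq> S"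
  obtain N where N: "{x. f x \<noteq> g x} \<subseteq> N" "N \<in> null_sets lebesgue"
    using assms(2) by (auto simp: eventually_ae_filter)
  then have neg: "negligible N" by (simp add: negligible_iff_null_sets)
  have eq: "g t = f t" if "t \<in> {x..y} - N" for t using that N by (force simp: subset_iff)
  show "g absolutely_integrable_on {x..y}"
    by (rule absolutely_integrable_spike[OF primitive_on_absolutely_integrable[OF assms(1) xy(2)] neg eq])
  show "integral {x..y} g = F y - F x"
    using integral_spike[of N "{x..y}" g f, OF neg eq] primitive_on_integral[OF assms(1) xy] by simp
qed

lemma primitive_on_add:
  assumes "primitive_on S F f" "primitive_on S G g"
  shows "primitive_on S (\<lambda>x. F x + G x) (\<lambda>x. f x + g x)"
  using assms unfolding primitive_on_def
  by (auto intro!: set_integral_add simp: integral_add set_lebesgue_integral_eq_integral(1))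

lemma primitive_on_cmult:
  assumes "primitive_on S F f"
  shows "primitive_on S (\<lambda>x. c * F x) (\<lambda>x. c * f x)"
  using assms unfolding primitive_on_def by (auto simp: right_diff_distrib)

lemma primitive_on_diff:
  assumes "primitive_on S F f" "primitive_on S G g"
  shows "primitive_on S (\<lambda>x. F x - G x) (\<lambda>x. f x - g x)"
  using primitive_on_add[OF assms(1) primitive_on_cmult[OF assms(2), of "-1"]] by simp

lemma primitive_on_sum:
  assumes "\<And>i. i \<in> I \<Longrightarrow> primitive_on S (F i) (f i)"
  shows "primitive_on S (\<lambda>x. \<Sum>i\<in>I. F i x) (\<lambda>x. \<Sum>i\<in>I. f i x)"
  using assms
proof (induction I rule: infinite_finite_induct)
  case (insert i I)
  then show ?case using primitive_on_add[of S "F i" "f i"] by simp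
qed (auto simp: primitive_on_def set_integrable_def)

lemma primitive_on_continuous:
  assumes "primitive_on S F f" "{a..b} \<subseteq> S"
  shows "continuous_on {a..b} F"
proof -
  have "continuous_on {a..b} (\<lambda>x. F a + integral {a..x} f)"
    by (intro continuous_intros indefinite_integral_continuous_1 primitive_on_integrable[OF assms])
  then show ?thesis
  proof (rule continuous_on_eq)
    fix x assume "x \<in> {a..b}"
    then show "F a + integral {a..x} f = F x"
      using primitive_on_integral[OF assms(1), of a x] assms(2)
      by (auto simp: subset_iff)
  qed
qed

lemma primitive_on_UNIV_continuous:
  assumes "primitive_on UNIV F f"
  shows "continuous_on UNIV F"
proof -
  have "isCont F x" for x
    using primitive_on_continuous[OF assms, of "x - 1" "x + 1"]
    by (auto intro: continuous_on_interior)
  then show ?thesis by (simp add: continuous_on_eq_continuous_at)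
qed

text \<open>The way back to classical derivatives, on which Rolle's theorem and the mean value
  theorem depend.\<close>

lemma primitive_on_has_derivative:
  assumes "primitive_on {a..b} F f" "continuous_on {a..b} f" "x \<in> {a..b}"
  shows "(F has_real_derivative f x) (at x within {a..b})"
proof -
  have "((\<lambda>x. F a + integral {a..x} f) has_real_derivative 0 + f x) (at x within {a..b})"
    by (intro derivative_intros integral_has_real_derivative assms)
  then have "((\<lambda>x. F a + integral {a..x} f) has_real_derivative f x) (at x within {a..b})" by simp
  then show ?thesis
  proof (rule has_field_derivative_transform_within[OF _ zero_less_one assms(3)])
    fix z assume "z \<in> {a..b}"
    then show "F a + integral {a..z} f = F z"
      using primitive_on_integral[OF assms(1), of a z] by (auto simp: subset_iff)
  qed
qed

lemma primitive_on_of_derivative: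
  assumes d: "\<And>x. x \<in> {a..b} \<Longrightarrow> (F has_real_derivative f x) (at x within {a..b})"
    and c: "continuous_on {a..b} f"
  shows "primitive_on {a..b} F f"
  unfolding primitive_on_def
proof (intro allI impI conjI)
  fix x y :: real assume xy: "x \<le> y" "{x..y} \<subseteq> {a..b}"
  show "f absolutely_integrable_on {x..y}"
    by (intro absolutely_integrable_continuous_real continuous_on_subset[OF c] xy)
  have "(f has_integral F y - F x) {x..y}"
  proof (rule fundamental_theorem_of_calculus[OF xy(1)])
    fix z assume "z \<in> {x..y}"
    then show "(F has_vector_derivative f z) (at z within {x..y})"
      using DERIV_subset[OF d xy(2)] xy(2) by (auto simp: has_real_derivative_iff_has_vector_derivative)
  qed
  then show "integral {x..y} f = F y - F x" by (rule integral_unique)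
qed

lemma primitive_on_indefinite_integral:
  assumes "f absolutely_integrable_on {a..b}"
  shows "primitive_on {a..b} (\<lambda>x. c + integral {a..x} f) f"
  unfolding primitive_on_def
proof (intro allI impI conjI)
  fix x y :: real assume xy: "x \<le> y" "{x..y} \<subseteq> {a..b}"
  show "f absolutely_integrable_on {x..y}"
    by (rule set_integrable_subset[OF assms]) (use xy in auto)
  have "f integrable_on {a..y}"
    by (rule integrable_subinterval_real[of _ a b]) (use assms xy set_lebesgue_integral_eq_integral(1) in auto)
  then have "integral {a..x} f + integral {x..y} f = integral {a..y} f"
    using xy by (intro Henstock_Kurzweil_Integration.integral_combine) auto
  then show "integral {x..y} f = c + integral {a..y} f - (c + integral {a..x} f)" by simp
qed

lemma primitive_on_UNIV_exists:
  assumes "\<And>r. f absolutely_integrable_on {-r..r}"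
  shows "\<exists>F. primitive_on UNIV F f"
proof -
  have int: "f integrable_on {x..y}" and ai: "f absolutely_integrable_on {x..y}" for x y
  proof -
    show "f absolutely_integrable_on {x..y}"
      by (rule set_integrable_subset[OF assms[of "max \<bar>x\<bar> \<bar>y\<bar>"]]) auto
    then show "f integrable_on {x..y}" using set_lebesgue_integral_eq_integral(1) by blast
  qed
  \<comment> \<open>For either sign of x one of the two intervals is empty or a point, so the
    formula is the oriented integral from 0 to x.\<close>
  define F where "F x = integral {0..x} f - integral {x..0} f" for x
  have "integral {x..y} f = F y - F x" if xy: "x \<le> y" for x y
  proof -
    note c = Henstock_Kurzweil_Integration.integral_combine[OF _ _ int]
    have e: "integral {s..t} f = 0" if "t \<le> s" for s t
      using that by (cases "s = t") auto
    consider "0 \<le> x" | "x \<le> 0" "0 \<le> y" | "y \<le> 0" by linarith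
    then show ?thesis
    proof cases
      case 1 then show ?thesis using c[of 0 x y] xy e[of 0 x] e[of 0 y] by (simp add: F_def)
    next
      case 2 then show ?thesis using c[of x 0 y] xy e[of x 0] e[of 0 y] by (simp add: F_def)
    next
      case 3 then show ?thesis using c[of x y 0] xy e[of x 0] e[of y 0] by (simp add: F_def)
    qed
  qed
  then show ?thesis using ai by (auto simp: primitive_on_def)
qed

section \<open>The product rule for absolutely continuous functions\<close>

lemma absolutely_integrable_continuous_mult:
  fixes f G :: "real \<Rightarrow> real"
  assumes "f absolutely_integrable_on {a..b}" "continuous_on {a..b} G"
  shows "(\<lambda>x. G x * f x) absolutely_integrable_on {a..b}" "(\<lambda>x. f x * G x) absolutely_integrable_on {a..b}"
proof -
  show "(\<lambda>x. G x * f x) absolutely_integrable_on {a..b}"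
    by (rule absolutely_integrable_bounded_measurable_product_real)
       (use assms in \<open>auto intro!: continuous_imp_measurable_on_sets_lebesgue
          compact_imp_bounded compact_continuous_image\<close>)
  then show "(\<lambda>x. f x * G x) absolutely_integrable_on {a..b}" by (simp add: mult.commute)
qed

lemma integral_product_rule:
  fixes F G f g :: "real \<Rightarrow> real"
  assumes F: "primitive_on {a..b} F f" and G: "primitive_on {a..b} G g" and ab: "a \<le> b"
  shows "integral {a..b} (\<lambda>t. f t * G t + F t * g t) = F b * G b - F a * G a"
proof -
  define h where "h t = f t * G t + F t * g t" for t
  define N where "N t = \<bar>f t\<bar> + \<bar>g t\<bar>" for t
  have cF: "continuous_on {a..b} F" and cG: "continuous_on {a..b} G"
    using primitive_on_continuous F G by auto
  have ai: "f absolutely_integrable_on {a..b}" "g absolutely_integrable_on {a..b}"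
    using F G primitive_on_absolutely_integrable by auto
  have ih: "h integrable_on {x..y}" and iN: "N integrable_on {x..y}" if "{x..y} \<subseteq> {a..b}" for x y
  proof -
    have "h absolutely_integrable_on {a..b}"
      unfolding h_def using ai cF cG
      by (intro set_integral_add absolutely_integrable_continuous_mult)
    then show "h integrable_on {x..y}"
      using that set_lebesgue_integral_eq_integral(1) integrable_on_subinterval by blast
    have "N absolutely_integrable_on {a..b}"
      unfolding N_def using ai by (intro set_integral_add set_integrable_abs)
    then show "N integrable_on {x..y}"
      using that set_lebesgue_integral_eq_integral(1) integrable_on_subinterval by blast
  qed
  define D where "D x y = F y * G y - F x * G x - integral {x..y} h" for x y
  (* On a short interval F and G are within e of their end values, so D is at most e times the integral of N;
     D is additive, hence the same bound holds on {a..b}. *)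
  have small: "\<bar>D a b\<bar> \<le> e * integral {a..b} N" if e: "0 < e" for e
  proof -
    have uc: "uniformly_continuous_on {a..b} F" "uniformly_continuous_on {a..b} G"
      using cF cG by (auto intro: compact_uniformly_continuous)
    obtain d1 where d1: "0 < d1" "\<And>x y. x \<in> {a..b} \<Longrightarrow> y \<in> {a..b} \<Longrightarrow> dist y x < d1 \<Longrightarrow> dist (F y) (F x) < e"
      using uc(1) e unfolding uniformly_continuous_on_def by meson
    obtain d2 where d2: "0 < d2" "\<And>x y. x \<in> {a..b} \<Longrightarrow> y \<in> {a..b} \<Longrightarrow> dist y x < d2 \<Longrightarrow> dist (G y) (G x) < e"
      using uc(2) e unfolding uniformly_continuous_on_def by meson
    define d where "d = min d1 d2"
    have local: "\<bar>D x y\<bar> \<le> e * integral {x..y} N" if xy: "a \<le> x" "x \<le> y" "y \<le> b" "y - x < d" for x y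
    proof -
      have sub: "{x..y} \<subseteq> {a..b}" using xy by auto
      note i = primitive_on_integrable[OF F sub] primitive_on_integrable[OF G sub]
      \<comment> \<open>Freezing G at x and F at y turns the increment of the product into an
        integral of f and g with constant coefficients; compared with \<open>h\<close>, the error
        stems only from the oscillation of F and G.\<close>
      have "F y * G y - F x * G x = G x * (F y - F x) + F y * (G y - G x)" by (simp add: algebra_simps)
      also have "\<dots> = integral {x..y} (\<lambda>t. G x * f t + F y * g t)"
        using primitive_on_integral[OF F xy(2) sub] primitive_on_integral[OF G xy(2) sub] i
        by (subst integral_add) (auto intro: integrable_on_mult_right)
      finally have "D x y = integral {x..y} (\<lambda>t. (G x * f t + F y * g t) - h t)"
        unfolding D_def using i ih[OF sub]
        by (subst Henstock_Kurzweil_Integration.integral_diff) (auto intro!: integrable_add integrable_on_mult_right)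
      also have "norm \<dots> \<le> integral {x..y} (\<lambda>t. e * N t)"
      proof (rule integral_norm_bound_integral)
        show "(\<lambda>t. G x * f t + F y * g t - h t) integrable_on {x..y}"
          using i ih[OF sub] by (intro integrable_diff integrable_add integrable_on_mult_right)
        show "(\<lambda>t. e * N t) integrable_on {x..y}" using iN[OF sub] by (intro integrable_on_mult_right)
        fix t assume t: "t \<in> {x..y}"
        have 1: "\<bar>G x - G t\<bar> \<le> e" using d2(2)[of x t] t xy by (auto simp: dist_real_def d_def)
        have 2: "\<bar>F y - F t\<bar> \<le> e" using d1(2)[of y t] t xy by (auto simp: dist_real_def d_def)
        have "G x * f t + F y * g t - h t = (G x - G t) * f t + (F y - F t) * g t"
          by (simp add: h_def algebra_simps)
        also have "\<bar>\<dots>\<bar> \<le> \<bar>G x - G t\<bar> * \<bar>f t\<bar> + \<bar>F y - F t\<bar> * \<bar>g t\<bar>"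
          by (metis abs_mult abs_triangle_ineq)
        also have "\<dots> \<le> e * \<bar>f t\<bar> + e * \<bar>g t\<bar>"
          using 1 2 by (intro add_mono mult_right_mono) auto
        finally show "norm (G x * f t + F y * g t - h t) \<le> e * N t"
          by (simp add: N_def distrib_left)
      qed
      finally show ?thesis by simp
    qed
    obtain m :: nat where m: "(b - a) / d < m" using reals_Archimedean2 by blast
    have d: "0 < d" using d1 d2 by (simp add: d_def)
    then have m0: "0 < m" using m ab by (smt (verit) divide_nonneg_pos of_nat_0_less_iff)
    define t where "t i = a + real i * ((b - a) / m)" for i
    have "b - a < real m * d" using m d by (simp add: field_simps)
    then have "(b - a) / m < d" using m0 by (simp add: field_simps)
    moreover have "t (Suc i) - t i = (b - a) / m" for i by (simp add: t_def distrib_right add_divide_distrib)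
    moreover have "0 \<le> (b - a) / m" using ab by simp
    ultimately have step: "t (Suc i) - t i < d" "t i \<le> t (Suc i)" for i by (metis, metis diff_ge_0_iff_ge)
    have tb: "t i \<le> b" "a \<le> t i" if "i \<le> m" for i
    proof -
      have "real i * ((b - a) / m) \<le> real m * ((b - a) / m)"
        using that ab by (intro mult_right_mono) auto
      then show "t i \<le> b" using m0 by (simp add: t_def)
      show "a \<le> t i" using ab by (simp add: t_def)
    qed
    have "i \<le> m \<Longrightarrow> \<bar>D a (t i)\<bar> \<le> e * integral {a..t i} N" for i
    proof (induction i)
      case 0
      then show ?case by (simp add: t_def D_def)
    next
      case (Suc i)
      note b = tb[OF Suc.prems] tb[of i]
      have c: "integral {a..t i} h + integral {t i..t (Suc i)} h = integral {a..t (Suc i)} h"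
        "integral {a..t i} N + integral {t i..t (Suc i)} N = integral {a..t (Suc i)} N"
        using b Suc.prems step(2)[of i]
        by (auto intro!: Henstock_Kurzweil_Integration.integral_combine ih iN)
      have "\<bar>D a (t (Suc i))\<bar> \<le> \<bar>D a (t i)\<bar> + \<bar>D (t i) (t (Suc i))\<bar>"
        using c(1) by (simp add: D_def)
      also have "\<dots> \<le> e * integral {a..t i} N + e * integral {t i..t (Suc i)} N"
        using Suc b step[of i] local[of "t i" "t (Suc i)"] by auto
      finally show ?case using c(2) by (simp add: distrib_left[symmetric])
    qed
    from this[of m] show ?thesis using m0 by (simp add: t_def)
  qed
  have "\<bar>D a b\<bar> \<le> 0"
  proof (rule field_le_epsilon)
    fix e :: real assume e: "0 < e"
    define I where "I = integral {a..b} N"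
    have I: "0 \<le> I" unfolding I_def by (rule integral_nonneg) (use iN in \<open>auto simp: N_def\<close>)
    \<comment> \<open>The integral of \<open>N\<close> may vanish, hence the denominator I +
      1.\<close>
    have "\<bar>D a b\<bar> \<le> e / (I + 1) * I" unfolding I_def by (rule small) (use e I in \<open>auto simp: I_def\<close>)
    also have "\<dots> \<le> e" using e I by (simp add: field_simps)
    finally show "\<bar>D a b\<bar> \<le> 0 + e" by simp
  qed
  then show ?thesis by (simp add: D_def h_def[abs_def])
qed

lemma primitive_on_mult:
  assumes F: "primitive_on S F f" and G: "primitive_on S G g"
  shows "primitive_on S (\<lambda>x. F x * G x) (\<lambda>x. f x * G x + F x * g x)"
  unfolding primitive_on_def
proof (intro allI impI conjI)
  fix x y :: real assume xy: "x \<le> y" "{x..y} \<subseteq> S"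
  show "(\<lambda>x. f x * G x + F x * g x) absolutely_integrable_on {x..y}"
    using primitive_on_absolutely_integrable[OF F xy(2)] primitive_on_absolutely_integrable[OF G xy(2)]
      primitive_on_continuous[OF F xy(2)] primitive_on_continuous[OF G xy(2)]
    by (intro set_integral_add absolutely_integrable_continuous_mult)
  show "integral {x..y} (\<lambda>x. f x * G x + F x * g x) = F y * G y - F x * G x"
    using primitive_on_subset[OF F xy(2)] primitive_on_subset[OF G xy(2)] xy(1)
    by (rule integral_product_rule)
qed

lemma bounded_measurable_absolutely_integrable:
  fixes V :: "real \<Rightarrow> real"
  assumes "V \<in> borel_measurable lebesgue" "\<And>x. x \<in> {a..b} \<Longrightarrow> \<bar>V x\<bar> \<le> M"
  shows "V absolutely_integrable_on {a..b}"
  by (rule measurable_bounded_by_integrable_imp_absolutely_integrable[where g = "\<lambda>_. M"])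
     (use assms in \<open>auto intro: measurable_restrict_space1\<close>)

text \<open>Picard iteration for w(a) = 1, w'(a) = 0. As V >= 0 the integral operator is monotone,
  so the iterates starting from 0 increase; as V <= \<sigma>^2, the exponential of rate \<sigma> is
  a supersolution and bounds them. The limit exists on intervals of any length, and its lower bound
  1 makes division by w safe.\<close>

lemma exists_positive_solution:
  fixes V :: "real \<Rightarrow> real"
  assumes V: "V \<in> borel_measurable lebesgue" "\<And>x. x \<in> {a..b} \<Longrightarrow> 0 \<le> V x \<and> V x \<le> \<sigma>\<^sup>2"
    and \<sigma>: "0 \<le> \<sigma>"
  obtains w w' where "primitive_on {a..b} w w'" "primitive_on {a..b} w' (\<lambda>x. V x * w x)"
    "\<And>x. x \<in> {a..b} \<Longrightarrow> 1 \<le> w x \<and> w x \<le> exp (\<sigma> * (b - a))"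
proof -
  have aiV: "V absolutely_integrable_on {a..b}"
    by (rule bounded_measurable_absolutely_integrable[OF V(1), where M = "\<sigma>\<^sup>2"]) (use V(2) in auto)
  define e where "e x = exp (\<sigma> * (x - a))" for x
  \<comment> \<open>Keeping \<sigma> as a factor of the integral also covers \<sigma> = 0, where one
    cannot divide by it.\<close>
  have e: "integral {a..x} e \<ge> 0" "\<sigma> * integral {a..x} e = e x - 1" "e integrable_on {a..x}" if "a \<le> x" for x
  proof -
    have "((\<lambda>t. \<sigma> * e t) has_integral e x - e a) {a..x}"
    proof (rule fundamental_theorem_of_calculus[OF that])
      fix t assume "t \<in> {a..x}"
      have "(e has_real_derivative \<sigma> * e t) (at t within {a..x})"
        unfolding e_def[abs_def] by (rule derivative_eq_intros refl | simp)+
      then show "(e has_vector_derivative \<sigma> * e t) (at t within {a..x})"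
        by (simp add: has_real_derivative_iff_has_vector_derivative)
    qed
    then show "\<sigma> * integral {a..x} e = e x - 1"
      by (subst integral_mult_right[symmetric], subst integral_unique) (auto simp: e_def)
    show "e integrable_on {a..x}"
      unfolding e_def[abs_def] by (intro integrable_continuous_real continuous_intros)
    then show "integral {a..x} e \<ge> 0" by (rule integral_nonneg) (auto simp: e_def)
  qed
  define z where "z f x = integral {a..x} (\<lambda>t. V t * f t)" for f x
  define T where "T f x = 1 + integral {a..x} (z f)" for f x
  \<comment> \<open>The order interval that \<open>T\<close> maps into itself; integrability against
    V is included so that the iterated integrals exist.\<close>
  define ok where "ok f \<longleftrightarrow> (\<lambda>t. V t * f t) integrable_on {a..b} \<and> (\<forall>x\<in>{a..b}. 0 \<le> f x \<and> f x \<le> e x)" for f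
  have iz: "(\<lambda>t. V t * f t) integrable_on {a..x}" if "ok f" "x \<in> {a..b}" for f x
    using that unfolding ok_def by (auto intro: integrable_on_subinterval)
  have cz: "continuous_on {a..b} (z f)" if "ok f" for f
    unfolding z_def using that by (intro indefinite_integral_continuous_1) (auto simp: ok_def)
  have izz: "z f integrable_on {a..x}" if "ok f" "x \<in> {a..b}" for f x
    by (intro integrable_continuous_real continuous_on_subset[OF cz[OF that(1)]]) (use that in auto)
  have z_bounds: "0 \<le> z f x \<and> z f x \<le> \<sigma> * e x" if f: "ok f" and x: "x \<in> {a..b}" for f x
  proof
    show "0 \<le> z f x" unfolding z_def
      by (rule integral_nonneg[OF iz[OF f x]]) (use f x V in \<open>auto simp: ok_def\<close>)
    have "z f x \<le> integral {a..x} (\<lambda>t. \<sigma>\<^sup>2 * e t)" unfolding z_def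
    proof (rule integral_le[OF iz[OF f x]])
      show "(\<lambda>t. \<sigma>\<^sup>2 * e t) integrable_on {a..x}" using e(3)[of x] x by (intro integrable_on_mult_right) auto
      fix t assume "t \<in> {a..x}"
      then show "V t * f t \<le> \<sigma>\<^sup>2 * e t"
        using f x V(2)[of t] by (intro mult_mono) (auto simp: ok_def e_def)
    qed
    also have "\<dots> = \<sigma> * (\<sigma> * integral {a..x} e)" by (simp add: power2_eq_square)
    also have "\<dots> \<le> \<sigma> * e x" using x \<sigma> e(2)[of x] by (intro mult_left_mono) auto
    finally show "z f x \<le> \<sigma> * e x" .
  qed
  have T_bounds: "1 \<le> T f x \<and> T f x \<le> e x" if f: "ok f" and x: "x \<in> {a..b}" for f x
  proof
    show "1 \<le> T f x" unfolding T_def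
      using integral_nonneg[OF izz[OF f x]] z_bounds[OF f] x by auto
    have "integral {a..x} (z f) \<le> integral {a..x} (\<lambda>t. \<sigma> * e t)"
      by (rule integral_le[OF izz[OF f x]]) (use e(3)[of x] x z_bounds[OF f] in \<open>auto intro: integrable_on_mult_right\<close>)
    then show "T f x \<le> e x" using e(2)[of x] x by (simp add: T_def)
  qed
  have okT: "ok (T f)" if f: "ok f" for f
  proof -
    have "continuous_on {a..b} (T f)" unfolding T_def
      using cz[OF f] by (intro continuous_intros indefinite_integral_continuous_1 integrable_continuous_real)
    then have "(\<lambda>t. V t * T f t) absolutely_integrable_on {a..b}"
      by (rule absolutely_integrable_continuous_mult(2)[OF aiV])
    then show ?thesis using T_bounds[OF f] set_lebesgue_integral_eq_integral(1)
      by (force simp: ok_def)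
  qed
  have T_mono: "T f x \<le> T h x" if f: "ok f" "ok h" "\<And>t. t \<in> {a..b} \<Longrightarrow> f t \<le> h t" and x: "x \<in> {a..b}" for f h x
  proof -
    have "z f t \<le> z h t" if t: "t \<in> {a..b}" for t unfolding z_def
      by (rule integral_le[OF iz[OF f(1) t] iz[OF f(2) t]]) (use f(3) V t in \<open>auto intro: mult_left_mono\<close>)
    then show ?thesis unfolding T_def
      using integral_le[OF izz[OF f(1) x] izz[OF f(2) x]] x by auto
  qed
  define u where "u k = (T ^^ k) (\<lambda>_. 0)" for k
  have u_Suc: "u (Suc k) = T (u k)" for k by (simp add: u_def)
  have ok_u: "ok (u k)" for k
    by (induction k) (auto simp: u_Suc okT, simp add: ok_def u_def e_def integrable_0)
  have u_mono: "x \<in> {a..b} \<Longrightarrow> u k x \<le> u (Suc k) x" for k x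
  proof (induction k arbitrary: x)
    case 0
    then show ?case using ok_u[of 1] by (simp add: u_def ok_def)
  next
    case (Suc k)
    show ?case unfolding u_Suc[of k] u_Suc[of "Suc k"]
      by (rule T_mono) (use ok_u okT Suc u_Suc in auto)
  qed
  define w where "w x = lim (\<lambda>k. u k x)" for x
  have lim: "(\<lambda>k. u k x) \<longlonglongrightarrow> w x" if x: "x \<in> {a..b}" for x
  proof -
    have "incseq (\<lambda>k. u k x)" using u_mono[OF x] by (rule incseq_SucI)
    then have "convergent (\<lambda>k. u k x)"
      using ok_u x by (intro Bseq_monoseq_convergent BseqI'[where K = "e x"])
        (auto simp: ok_def incseq_imp_monoseq)
    then show ?thesis by (simp add: w_def convergent_LIMSEQ_iff)
  qed
  have conv_z: "(\<lambda>t. V t * w t) integrable_on {a..x} \<and> (\<lambda>k. z (u k) x) \<longlonglongrightarrow> z w x" if x: "x \<in> {a..b}" for x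
  proof -
    have 1: "(\<lambda>t. V t * u k t) integrable_on {a..x}" for k by (rule iz[OF ok_u x])
    have 2: "(\<lambda>t. \<sigma>\<^sup>2 * e t) integrable_on {a..x}"
      using e(3)[of x] x by (intro integrable_on_mult_right) auto
    have 3: "norm (V t * u k t) \<le> \<sigma>\<^sup>2 * e t" if "t \<in> {a..x}" for k t
      unfolding norm_mult using that ok_u[of k] x V(2)[of t] by (intro mult_mono) (auto simp: ok_def e_def)
    have 4: "(\<lambda>k. V t * u k t) \<longlonglongrightarrow> V t * w t" if "t \<in> {a..x}" for t
      by (intro tendsto_intros lim) (use that x in auto)
    have "(\<lambda>t. V t * w t) integrable_on {a..x} \<and>
        (\<lambda>k. integral {a..x} (\<lambda>t. V t * u k t)) \<longlonglongrightarrow> integral {a..x} (\<lambda>t. V t * w t)"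
      using dominated_convergence[OF 1 2 3 4] by blast
    then show ?thesis by (simp add: z_def)
  qed
  \<comment> \<open>Dominated convergence for the outer integral; \<open>conv_z\<close> has settled
    the inner one.\<close>
  have w_eq: "w x = T w x" if x: "x \<in> {a..b}" for x
  proof -
    have "(\<lambda>k. integral {a..x} (z (u k))) \<longlonglongrightarrow> integral {a..x} (z w)"
    proof (rule dominated_convergence(2))
      show "(\<lambda>t. \<sigma> * e t) integrable_on {a..x}" using e(3)[of x] x by (intro integrable_on_mult_right) auto
      show "z (u k) integrable_on {a..x}" for k by (rule izz[OF ok_u x])
      show "norm (z (u k) t) \<le> \<sigma> * e t" if "t \<in> {a..x}" for k t
        using z_bounds[OF ok_u, of t k] that x by auto
      show "(\<lambda>k. z (u k) t) \<longlonglongrightarrow> z w t" if "t \<in> {a..x}" for t using conv_z[of t] that x by auto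
    qed
    then have "(\<lambda>k. u (Suc k) x) \<longlonglongrightarrow> T w x"
      unfolding u_Suc T_def by (intro tendsto_intros)
    then show ?thesis using LIMSEQ_unique LIMSEQ_Suc[OF lim[OF x]] by blast
  qed
  show thesis
  proof (cases "a \<le> b")
    case True
    have ok_w: "ok w"
      unfolding ok_def
    proof (intro conjI ballI)
      show "(\<lambda>t. V t * w t) integrable_on {a..b}" using conv_z[of b] True by auto
      fix x assume x: "x \<in> {a..b}"
      show "0 \<le> w x" by (rule LIMSEQ_le_const[OF lim[OF x]]) (use ok_u x in \<open>auto simp: ok_def\<close>)
      show "w x \<le> e x" by (rule LIMSEQ_le_const2[OF lim[OF x]]) (use ok_u x in \<open>auto simp: ok_def\<close>)
    qed
    have aw: "(\<lambda>t. V t * w t) absolutely_integrable_on {a..b}"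
      by (rule nonnegative_absolutely_integrable_1) (use ok_w V in \<open>auto simp: ok_def\<close>)
    have pz: "primitive_on {a..b} (z w) (\<lambda>t. V t * w t)"
      using primitive_on_indefinite_integral[OF aw, where c = 0] by (simp add: z_def[abs_def])
    have "primitive_on {a..b} (T w) (z w)"
      using primitive_on_indefinite_integral[where f = "z w" and a = a and b = b and c = 1]
        absolutely_integrable_continuous_real[OF cz[OF ok_w]] by (simp add: T_def[abs_def])
    then have pw: "primitive_on {a..b} w (z w)"
      by (rule primitive_on_cong) (use w_eq in auto)
    have "1 \<le> w x \<and> w x \<le> exp (\<sigma> * (b - a))" if x: "x \<in> {a..b}" for x
    proof -
      have "e x \<le> exp (\<sigma> * (b - a))" unfolding e_def using x \<sigma> by (simp add: mult_left_mono)
      then show ?thesis using T_bounds[OF ok_w x] w_eq[OF x] by linarith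
    qed
    then show ?thesis using that pw pz by blast
  next
    case False
    then show ?thesis using that[of "\<lambda>_. 0" "\<lambda>_. 0"] by (auto simp: primitive_on_def)
  qed
qed

section \<open>The Remez inequality for iterated Schroedinger operators\<close>

text \<open>In the derivative of w u' - w' u the two terms with V cancel and w u_1 = w^2 (u_1 / w)
  is left, so one application of d^2/dx^2 - V accounts for two steps of the chain.\<close>

lemma schroedinger_chain:
  fixes u u' :: "nat \<Rightarrow> real \<Rightarrow> real"
  assumes u: "\<And>j. primitive_on {a..b} (u j) (u' j)"
    and u': "\<And>j. primitive_on {a..b} (u' j) (\<lambda>x. V x * u j x + u (Suc j) x)"
    and w: "primitive_on {a..b} w w'" "primitive_on {a..b} w' (\<lambda>x. V x * w x)"
    and W: "\<And>x. x \<in> {a..b} \<Longrightarrow> 1 \<le> w x \<and> w x \<le> W" "1 \<le> W"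
  shows "derivative_chain a b (W\<^sup>2) n
    (\<lambda>i x. if even i then 1 / (w x)\<^sup>2 else (w x)\<^sup>2)
    (\<lambda>i x. if even i then u (i div 2) x / w x else u' (i div 2) x * w x - u (i div 2) x * w' x)"
    (is "derivative_chain _ _ _ _ ?g ?v")
proof
  have c: "continuous_on {a..b} (u j)" "continuous_on {a..b} (u' j)" "continuous_on {a..b} w" "continuous_on {a..b} w'" for j
    by (rule primitive_on_continuous[OF u order_refl] primitive_on_continuous[OF u' order_refl]
        primitive_on_continuous[OF w(1) order_refl] primitive_on_continuous[OF w(2) order_refl])+
  have pos: "x \<in> {a..b} \<Longrightarrow> 0 < w x" for x using W by force
  have d: "(u j has_real_derivative u' j x) (at x within {a..b})"
    "(w has_real_derivative w' x) (at x within {a..b})" if "x \<in> {a..b}" for j x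
    by (rule primitive_on_has_derivative[OF u c(2) that] primitive_on_has_derivative[OF w(1) c(4) that])+
  show "1 \<le> W\<^sup>2" using W(2) by simp
  fix i :: nat and x assume x: "x \<in> {a..b}"
  have sq: "1 \<le> (w x)\<^sup>2" "(w x)\<^sup>2 \<le> W\<^sup>2" using W(1)[OF x] by (auto intro: power_mono)
  moreover have "0 < (w x)\<^sup>2" "0 < W\<^sup>2" "1 \<le> W\<^sup>2" using sq by linarith+
  ultimately have "1 / W\<^sup>2 \<le> 1 / (w x)\<^sup>2" "1 / W\<^sup>2 \<le> 1" "1 / (w x)\<^sup>2 \<le> 1"
    by (simp_all add: frac_le)
  then show "1 / W\<^sup>2 \<le> ?g i x \<and> ?g i x \<le> W\<^sup>2"
    using sq by auto
  show "(?v i has_real_derivative ?g i x * ?v (Suc i) x) (at x within {a..b})"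
  proof (cases "even i")
    case True
    then obtain j where i: "i = 2 * j" by blast
    have "((\<lambda>x. u j x / w x) has_real_derivative 1 / (w x)\<^sup>2 * (u' j x * w x - u j x * w' x)) (at x within {a..b})"
      using pos[OF x] by (auto intro!: derivative_eq_intros d[OF x] simp: power2_eq_square)
    then show ?thesis by (simp add: i)
  next
    case False
    then obtain j where i: "i = Suc (2 * j)" by (auto elim: oddE)
    \<comment> \<open>Neither u' nor w' need be differentiable everywhere, so the cancellation is
      carried out for primitives. Its result is continuous, and only then is a classical derivative
      taken.\<close>
    have "primitive_on {a..b} (\<lambda>x. u' j x * w x - u j x * w' x)
      (\<lambda>x. ((V x * u j x + u (Suc j) x) * w x + u' j x * w' x) - (u' j x * w' x + u j x * (V x * w x)))"
      by (intro primitive_on_diff primitive_on_mult u u' w)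
    then have "primitive_on {a..b} (\<lambda>x. u' j x * w x - u j x * w' x) (\<lambda>x. u (Suc j) x * w x)"
      by (rule primitive_on_cong) (auto simp: algebra_simps)
    then have "((\<lambda>x. u' j x * w x - u j x * w' x) has_real_derivative u (Suc j) x * w x) (at x within {a..b})"
      by (rule primitive_on_has_derivative[OF _ continuous_on_mult[OF c(1) c(3)] x])
    moreover have "u (Suc j) x * w x = (w x)\<^sup>2 * (u (Suc j) x / w x)"
      using pos[OF x] by (simp add: power2_eq_square)
    ultimately show ?thesis by (simp add: i)
  qed
next
  have c: "continuous_on {a..b} (u j)" "continuous_on {a..b} (u' j)" "continuous_on {a..b} w" "continuous_on {a..b} w'" for j
    by (rule primitive_on_continuous[OF u order_refl] primitive_on_continuous[OF u' order_refl]
        primitive_on_continuous[OF w(1) order_refl] primitive_on_continuous[OF w(2) order_refl])+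
  have "\<forall>x\<in>{a..b}. w x \<noteq> 0" using W(1) by force
  then show "continuous_on {a..b} (?v n)"
    by (cases "even n")
       (simp_all add: continuous_on_divide[OF c(1) c(3)] continuous_on_diff[OF continuous_on_mult[OF c(2) c(3)] continuous_on_mult[OF c(1) c(4)]])
qed

text \<open>A chain of 2 k steps ends with u_k / w. As w >= 1, the bounds on u_0 and u_k pass to the
  chain, and the way back from u_0 / w costs a factor \<open>W\<close>. The estimate improves with
  the measure of \<open>E\<close>, so a lower bound \<delta> can replace that measure.\<close>

lemma schroedinger_remez:
  fixes u u' :: "nat \<Rightarrow> real \<Rightarrow> real"
  assumes V: "V \<in> borel_measurable lebesgue" "\<And>x. x \<in> {a..b} \<Longrightarrow> 0 \<le> V x \<and> V x \<le> \<sigma>\<^sup>2" "0 \<le> \<sigma>"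
    and u: "\<And>j. primitive_on {a..b} (u j) (u' j)"
      "\<And>j. primitive_on {a..b} (u' j) (\<lambda>x. V x * u j x + u (Suc j) x)"
    and E: "E \<in> sets lebesgue" "E \<subseteq> {a..b}" "\<And>x. x \<in> E \<Longrightarrow> \<bar>u 0 x\<bar> \<le> \<eta>"
      "0 < \<delta>" "\<delta> \<le> measure lebesgue E" "0 < \<eta>"
    and k: "0 < k" and M: "0 \<le> M" "1 \<le> \<Lambda>" "\<And>x. x \<in> {a..b} \<Longrightarrow> \<bar>u k x\<bar> \<le> M * \<Lambda> ^ (2 * k)"
    and W: "exp (\<sigma> * (b - a)) \<le> W" "1 \<le> W"
    and large: "8 * \<Lambda> * W\<^sup>2 * (b - a) \<le> 2 * real k" and x: "x \<in> {a..b}"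
  shows "\<bar>u 0 x\<bar> \<le> W * ((2 * \<eta> * (1 + 8 * (2 * real k) ^ 3 * W\<^sup>2 / \<delta>) ^ (2 * k) + M / 4 ^ (2 * k)) * exp k)"
proof -
  obtain w w' where w: "primitive_on {a..b} w w'" "primitive_on {a..b} w' (\<lambda>x. V x * w x)"
    and w1: "\<And>x. x \<in> {a..b} \<Longrightarrow> 1 \<le> w x \<and> w x \<le> exp (\<sigma> * (b - a))"
    using exists_positive_solution[OF V] by blast
  have wW: "1 \<le> w x \<and> w x \<le> W" if "x \<in> {a..b}" for x using w1[OF that] W by auto
  define v where "v i x = (if even i then u (i div 2) x / w x else u' (i div 2) x * w x - u (i div 2) x * w' x)" for i x
  interpret derivative_chain a b "W\<^sup>2" "2 * k" "\<lambda>i x. if even i then 1 / (w x)\<^sup>2 else (w x)\<^sup>2" v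
    unfolding v_def by (rule schroedinger_chain[where V = V]) (fact u w wW W(2))+
  have le: "\<bar>v (2 * j) x\<bar> \<le> \<bar>u j x\<bar>" if "x \<in> {a..b}" for j x
    proof -
    have "\<bar>u j x\<bar> * 1 \<le> \<bar>u j x\<bar> * w x" using wW[OF that] by (intro mult_left_mono) auto
    then show ?thesis using wW[OF that] by (simp add: v_def divide_le_eq)
  qed
  have "\<bar>v 0 x\<bar> \<le> (2 * \<eta> * (1 + 8 * real (2 * k) ^ 3 * W\<^sup>2 / measure lebesgue E) ^ (2 * k) + M / 4 ^ (2 * k)) * exp (real (2 * k) / 2)"
  proof (rule remez_inequality[OF E(1,2)])
    show "\<bar>v 0 x\<bar> \<le> \<eta>" if "x \<in> E" for x
      using le[of x 0] E(2,3) that by force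
    show "\<bar>v (2 * k) x\<bar> \<le> M * \<Lambda> ^ (2 * k)" if "x \<in> {a..b}" for x
      using le[OF that, of k] M(3)[OF that] by linarith
    show "0 < measure lebesgue E" using E(4,5) by linarith
    show "8 * \<Lambda> * W\<^sup>2 * (b - a) \<le> real (2 * k)" using large by simp
    show "0 < 2 * k" using k by simp
  qed (fact E(6) M(1) M(2) x)+
  also have "\<dots> \<le> (2 * \<eta> * (1 + 8 * real (2 * k) ^ 3 * W\<^sup>2 / \<delta>) ^ (2 * k) + M / 4 ^ (2 * k)) * exp (real (2 * k) / 2)"
  proof -
    have "8 * real (2 * k) ^ 3 * W\<^sup>2 / measure lebesgue E \<le> 8 * real (2 * k) ^ 3 * W\<^sup>2 / \<delta>"
      using E(4,5) by (intro divide_left_mono mult_nonneg_nonneg) auto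
    then have "(1 + 8 * real (2 * k) ^ 3 * W\<^sup>2 / measure lebesgue E) ^ (2 * k)
        \<le> (1 + 8 * real (2 * k) ^ 3 * W\<^sup>2 / \<delta>) ^ (2 * k)"
      by (intro power_mono add_left_mono) auto
    then show ?thesis
      using E(6) by (intro mult_right_mono add_right_mono mult_left_mono) auto
  qed
  finally have v0: "\<bar>v 0 x\<bar> \<le> (2 * \<eta> * (1 + 8 * (2 * real k) ^ 3 * W\<^sup>2 / \<delta>) ^ (2 * k) + M / 4 ^ (2 * k)) * exp k" by simp
  have "\<bar>u 0 x\<bar> = w x * \<bar>v 0 x\<bar>" using wW[OF x] by (simp add: v_def abs_mult)
  also have "\<dots> \<le> W * \<bar>v 0 x\<bar>" using wW[OF x] by (intro mult_right_mono) auto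
  also have "\<dots> \<le> W * ((2 * \<eta> * (1 + 8 * (2 * real k) ^ 3 * W\<^sup>2 / \<delta>) ^ (2 * k) + M / 4 ^ (2 * k)) * exp k)"
    using v0 W by (intro mult_left_mono) auto
  finally show ?thesis .
qed

section \<open>Energy estimates\<close>

lemma integral_le_lebesgue_integral:
  fixes f :: "real \<Rightarrow> real"
  assumes "integrable lebesgue f" "\<And>x. 0 \<le> f x"
  shows "integral {a..b} f \<le> (LINT x|lebesgue. f x)"
proof -
  have "f integrable_on UNIV" by (rule integrable_on_lebesgue[OF assms(1)])
  then have "integral {a..b} f \<le> integral UNIV f"
    by (intro integral_subset_le) (use assms(2) in \<open>auto intro: integrable_on_subinterval\<close>)
  then show ?thesis using integral_lebesgue[OF assms(1)] by simp
qed

lemma integrable_imp_absolutely_integrable_on: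
  fixes f :: "real \<Rightarrow> real"
  shows "integrable lebesgue f \<Longrightarrow> f absolutely_integrable_on {a..b}"
  unfolding set_integrable_def by (rule integrable_mult_indicator) auto

lemma tendsto_integral_symmetric_intervals:
  fixes f :: "real \<Rightarrow> real"
  assumes f: "integrable lebesgue f"
  shows "((\<lambda>t. integral {-t..t} f) \<longlongrightarrow> (LINT x|lebesgue. f x)) at_top"
proof -
  have "((\<lambda>t. LINT x|lebesgue. indicator {-t..t} x *\<^sub>R f x) \<longlongrightarrow> (LINT x|lebesgue. f x)) at_top"
  proof (rule integral_dominated_convergence_at_top)
    show "f \<in> borel_measurable lebesgue" using f by auto
    show "(\<lambda>x. indicator {-t..t} x *\<^sub>R f x) \<in> borel_measurable lebesgue" for t
      using f by (intro borel_measurable_scaleR borel_measurable_indicator) auto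
    show "integrable lebesgue (\<lambda>x. \<bar>f x\<bar>)" using f by simp
    show "AE x in lebesgue. ((\<lambda>t. indicator {-t..t} x *\<^sub>R f x) \<longlongrightarrow> f x) at_top"
    proof (rule AE_I2, rule tendsto_eventually)
      fix x :: real
      show "\<forall>\<^sub>F t in at_top. indicator {-t..t} x *\<^sub>R f x = f x"
        using eventually_ge_at_top[of "\<bar>x\<bar>"] by eventually_elim (auto simp: indicator_def)
    qed
    show "\<forall>\<^sub>F t in at_top. AE x in lebesgue. norm (indicator {-t..t} x *\<^sub>R f x) \<le> \<bar>f x\<bar>"
      by (intro always_eventually allI AE_I2) (auto simp: indicator_def)
  qed
  moreover have "(LINT x|lebesgue. indicator {-t..t} x *\<^sub>R f x) = integral {-t..t} f" for t
    using set_lebesgue_integral_eq_integral(2)[OF integrable_imp_absolutely_integrable_on[OF f], of "-t" t]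
    by (simp add: set_lebesgue_integral_def)
  ultimately show ?thesis by simp
qed

lemma primitive_on_UNIV_DERIV:
  assumes "primitive_on UNIV F f" "continuous_on UNIV f"
  shows "(F has_real_derivative f x) (at x)"
proof -
  have "(F has_real_derivative f x) (at x within {x - 1..x + 1})"
    by (rule primitive_on_has_derivative[OF primitive_on_subset[OF assms(1)] continuous_on_subset[OF assms(2)]]) auto
  moreover have "at x within {x - 1..x + 1} = at x" by (rule at_within_interior) auto
  ultimately show ?thesis by simp
qed

text \<open>Multiplying the equation by u and integrating leaves the boundary term u u', whose decay
  is not known. If the energy exceeded the right-hand side, this term would stay above a positive
  constant; being half the derivative of u(x)^2 + u(-x)^2, it would contradict square
  integrability.\<close>

lemma energy_inequality:
  fixes u u' g V :: "real \<Rightarrow> real"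
  assumes u: "primitive_on UNIV u u'" and u': "primitive_on UNIV u' (\<lambda>x. V x * u x - g x)"
    and V: "\<And>x. 0 \<le> V x"
    and L2: "integrable lebesgue (\<lambda>x. (u x)\<^sup>2)" and ug: "integrable lebesgue (\<lambda>x. u x * g x)"
  shows "integral {-X..X} (\<lambda>x. (u' x)\<^sup>2 + V x * (u x)\<^sup>2) \<le> (LINT x|lebesgue. u x * g x)"
proof (rule ccontr)
  define h where "h x = (u' x)\<^sup>2 + V x * (u x)\<^sup>2" for x
  define G where "G = (LINT x|lebesgue. u x * g x)"
  define A where "A = integral {-X..X} h"
  \<comment> \<open>Half of the excess. The other half is given away to the convergence of the
    integrals of u g over growing intervals.\<close>
  define c where "c = (A - G) / 2"
  assume "\<not> integral {-X..X} (\<lambda>x. (u' x)\<^sup>2 + V x * (u x)\<^sup>2) \<le> (LINT x|lebesgue. u x * g x)"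
  then have c: "0 < c" by (simp add: c_def A_def G_def h_def[abs_def])
  define P where "P x = u x * u' x" for x
  have "primitive_on UNIV P (\<lambda>x. u' x * u' x + u x * (V x * u x - g x))"
    unfolding P_def by (intro primitive_on_mult u u')
  then have P: "primitive_on UNIV P (\<lambda>x. h x - u x * g x)"
    by (rule primitive_on_cong) (auto simp: h_def power2_eq_square algebra_simps)
  have aug: "(\<lambda>x. u x * g x) absolutely_integrable_on {x..y}" for x y
    by (rule integrable_imp_absolutely_integrable_on[OF ug])
  have "(\<lambda>x. (h x - u x * g x) + u x * g x) absolutely_integrable_on {x..y}" for x y
    by (intro set_integral_add aug primitive_on_absolutely_integrable[OF P]) auto
  then have ih: "h integrable_on {x..y}" for x y
    using set_lebesgue_integral_eq_integral(1) by (auto simp: h_def[abs_def])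
  have iug: "(\<lambda>x. u x * g x) integrable_on {x..y}" for x y
    using aug set_lebesgue_integral_eq_integral(1) by blast
  have "\<forall>\<^sub>F t in at_top. integral {-t..t} (\<lambda>x. u x * g x) < G + c"
    using order_tendstoD(2)[OF tendsto_integral_symmetric_intervals[OF ug], of "G + c"] c by (simp add: G_def)
  then obtain T0 where T0: "\<And>t. T0 \<le> t \<Longrightarrow> integral {-t..t} (\<lambda>x. u x * g x) < G + c"
    by (auto simp: eventually_at_top_linorder)
  define T where "T = max 0 (max T0 X)"
  have T: "0 \<le> T" "T0 \<le> T" "X \<le> T" by (auto simp: T_def)
  have P_lower: "c \<le> P t - P (- t)" if t: "T \<le> t" for t
  proof -
    have "P t - P (- t) = integral {-t..t} (\<lambda>x. h x - u x * g x)"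
      using primitive_on_integral[OF P, of "-t" t] t T by simp
    also have "\<dots> = integral {-t..t} h - integral {-t..t} (\<lambda>x. u x * g x)"
      by (rule Henstock_Kurzweil_Integration.integral_diff[OF ih iug])
    also have "\<dots> \<ge> A - (G + c)"
    proof -
      have "A \<le> integral {-t..t} h" unfolding A_def
        by (rule integral_subset_le[OF _ ih ih]) (use t T V in \<open>auto simp: h_def\<close>)
      then show ?thesis using T0[of t] t T by linarith
    qed
    finally show ?thesis by (simp add: c_def field_simps)
  qed
  define F where "F x = (u x)\<^sup>2 + (u (- x))\<^sup>2" for x
  have cont: "continuous_on UNIV u" "continuous_on UNIV u'"
    using u u' by (auto intro: primitive_on_UNIV_continuous)
  have du: "(u has_real_derivative u' x) (at x)" for x
    by (rule primitive_on_UNIV_DERIV[OF u cont(2)])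
  have dum: "((\<lambda>x. u (- x)) has_real_derivative - u' (- x)) (at x)" for x
    using DERIV_chain'[of uminus "-1" x UNIV u "u' (-x)"] du[of "-x"] DERIV_minus[OF DERIV_ident, of x UNIV] by auto
  have dF: "(F has_real_derivative 2 * (P x - P (- x))) (at x)" for x
    unfolding F_def P_def by (auto intro!: derivative_eq_intros du dum simp: algebra_simps)
  have F_lower: "2 * c \<le> F x" if "T + 1 \<le> x" for x
  proof -
    have "T < x" using that by simp
    then obtain z where z: "T < z" "z < x" "F x - F T = (x - T) * (2 * (P z - P (- z)))"
      using MVT2[of T x F "\<lambda>z. 2 * (P z - P (- z))"] dF by blast
    have "1 * (2 * c) \<le> (x - T) * (2 * (P z - P (- z)))"
      using P_lower[of z] z that c by (intro mult_mono) auto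
    moreover have "0 \<le> F T" by (simp add: F_def)
    ultimately show ?thesis using z(3) by linarith
  qed
  define B where "B = (LINT x|lebesgue. (u x)\<^sup>2)"
  \<comment> \<open>With this \<open>Y\<close> the lower bound for the integral of \<open>F\<close>
    over {T + 1..Y} is 2 B + 2 c, while u(x)^2 and u(-x)^2 contribute at most B each.\<close>
  define Y where "Y = T + 2 + B / c"
  have B0: "0 \<le> B" by (simp add: B_def)
  have Y: "T + 1 \<le> Y" using B0 c by (simp add: Y_def)
  have iq: "(\<lambda>x. (u x)\<^sup>2) integrable_on {x..y}" "(\<lambda>x. (u (- x))\<^sup>2) integrable_on {x..y}" for x y
    using cont(1) by (auto intro!: integrable_continuous_real continuous_intros continuous_on_subset[OF cont(1)]
        continuous_on_compose2[OF cont(1)])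
  have "2 * c * (Y - (T + 1)) = integral {T + 1..Y} (\<lambda>x. 2 * c)" using Y by simp
  also have "\<dots> \<le> integral {T + 1..Y} F"
    by (rule integral_le) (use F_lower iq in \<open>auto simp: F_def[abs_def] intro!: integrable_add\<close>)
  also have "\<dots> = integral {T + 1..Y} (\<lambda>x. (u x)\<^sup>2) + integral {T + 1..Y} (\<lambda>x. (u (- x))\<^sup>2)"
    unfolding F_def by (rule integral_add[OF iq])
  also have "integral {T + 1..Y} (\<lambda>x. (u (- x))\<^sup>2) = integral {- Y..- (T + 1)} (\<lambda>x. (u x)\<^sup>2)"
    using Henstock_Kurzweil_Integration.integral_reflect_real[of Y "T + 1" "\<lambda>x. (u (- x))\<^sup>2"] by simp
  also have "integral {T + 1..Y} (\<lambda>x. (u x)\<^sup>2) + integral {- Y..- (T + 1)} (\<lambda>x. (u x)\<^sup>2) \<le> B + B"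
    unfolding B_def by (intro add_mono integral_le_lebesgue_integral L2) auto
  finally have "c * (1 + B / c) \<le> B" by (simp add: Y_def)
  then show False using c by (simp add: distrib_left)
qed

text \<open>A one-dimensional Sobolev inequality: u^2 varies by at most the integral of 2 |u u'| <=
  u^2 + u'^2, and averaging over the second point in an interval of length one removes its
  value.\<close>

lemma pointwise_le_local_norms:
  fixes u u' :: "real \<Rightarrow> real"
  assumes u: "primitive_on UNIV u u'" and c': "continuous_on UNIV u'"
  shows "(u x)\<^sup>2 \<le> 2 * integral {x..x + 1} (\<lambda>t. (u t)\<^sup>2) + integral {x..x + 1} (\<lambda>t. (u' t)\<^sup>2)"
proof -
  have c: "continuous_on UNIV u" by (rule primitive_on_UNIV_continuous[OF u])
  have i: "(\<lambda>t. (u t)\<^sup>2) integrable_on {a..b}" "(\<lambda>t. (u' t)\<^sup>2) integrable_on {a..b}" for a b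
    by (auto intro!: integrable_continuous_real continuous_intros continuous_on_subset[OF c] continuous_on_subset[OF c'])
  define N where "N = integral {x..x + 1} (\<lambda>t. (u t)\<^sup>2) + integral {x..x + 1} (\<lambda>t. (u' t)\<^sup>2)"
  have q: "primitive_on UNIV (\<lambda>t. u t * u t) (\<lambda>t. u' t * u t + u t * u' t)"
    by (intro primitive_on_mult u)
  have "(u x)\<^sup>2 \<le> (u y)\<^sup>2 + N" if y: "y \<in> {x..x + 1}" for y
  proof -
    have "(u x)\<^sup>2 - (u y)\<^sup>2 = integral {x..y} (\<lambda>t. - (u' t * u t + u t * u' t))"
      using primitive_on_integral[OF q, of x y] y by (simp add: power2_eq_square)
    also have "\<dots> \<le> integral {x..y} (\<lambda>t. (u t)\<^sup>2 + (u' t)\<^sup>2)"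
    proof (rule integral_le)
      show "(\<lambda>t. - (u' t * u t + u t * u' t)) integrable_on {x..y}"
        using primitive_on_integrable[OF q, of x y] by (intro integrable_neg) auto
      show "(\<lambda>t. (u t)\<^sup>2 + (u' t)\<^sup>2) integrable_on {x..y}" by (intro integrable_add i)
      fix t
      have "0 \<le> (u t + u' t)\<^sup>2" by simp
      then show "- (u' t * u t + u t * u' t) \<le> (u t)\<^sup>2 + (u' t)\<^sup>2"
        by (simp add: power2_eq_square algebra_simps)
    qed
    also have "\<dots> \<le> integral {x..x + 1} (\<lambda>t. (u t)\<^sup>2 + (u' t)\<^sup>2)"
      by (rule integral_subset_le) (use y i in \<open>auto intro!: integrable_add\<close>)
    also have "\<dots> = N" unfolding N_def by (rule integral_add[OF i])
    finally show ?thesis by simp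
  qed
  then have "integral {x..x + 1} (\<lambda>y. (u x)\<^sup>2) \<le> integral {x..x + 1} (\<lambda>y. (u y)\<^sup>2 + N)"
    by (intro integral_le) (auto intro!: integrable_add i)
  also have "\<dots> = integral {x..x + 1} (\<lambda>y. (u y)\<^sup>2) + integral {x..x + 1} (\<lambda>y. N)"
    by (rule integral_add[OF i(1) integrable_const_ivl])
  finally show ?thesis by (simp add: N_def)
qed

text \<open>Outside {-X..X} one has q <= V q / c. The estimate is made on {-Y..Y} and Y sent to
  infinity, because V q is controlled on bounded intervals.\<close>

lemma lebesgue_integral_tail_le:
  fixes q V :: "real \<Rightarrow> real"
  assumes q: "integrable lebesgue q" "\<And>x. 0 \<le> q x"
    and V: "\<And>x. 0 \<le> V x" "\<And>x. X < \<bar>x\<bar> \<Longrightarrow> c \<le> V x" "0 < c" "0 \<le> X"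
    and Vq: "\<And>Y. (\<lambda>x. V x * q x) integrable_on {-Y..Y}" "\<And>Y. integral {-Y..Y} (\<lambda>x. V x * q x) \<le> B"
  shows "(LINT x|lebesgue. q x) \<le> integral {-X..X} q + B / c"
proof (rule tendsto_upperbound[OF tendsto_integral_symmetric_intervals[OF q(1)]])
  show "\<forall>\<^sub>F Y in at_top. integral {-Y..Y} q \<le> integral {-X..X} q + B / c"
    using eventually_ge_at_top[of X]
  proof eventually_elim
    fix Y assume Y: "X \<le> Y"
    have iq: "q integrable_on {a..b}" for a b
      using integrable_imp_absolutely_integrable_on[OF q(1)] set_lebesgue_integral_eq_integral(1) by blast
    have ir: "(\<lambda>x. if x \<in> {-X..X} then q x else 0) integrable_on {-Y..Y}"
      using iq[of "max (-X) (-Y)" "min X Y"] by (subst integrable_restrict_Int) (simp add: min.commute)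
    have iV: "(\<lambda>x. V x * q x / c) integrable_on {-Y..Y}"
      using integrable_on_mult_right[OF Vq(1), of "1 / c" Y] by simp
    have "integral {-Y..Y} q \<le> integral {-Y..Y} (\<lambda>x. (if x \<in> {-X..X} then q x else 0) + V x * q x / c)"
    proof (rule integral_le[OF iq integrable_add[OF ir iV]])
      fix x
      show "q x \<le> (if x \<in> {-X..X} then q x else 0) + V x * q x / c"
      proof (cases "x \<in> {-X..X}")
        case True
        then show ?thesis using V q(2)[of x] by simp
      next
        case False
        then have "c \<le> V x" by (intro V(2)) auto
        then have "c * q x \<le> V x * q x" using q(2) by (intro mult_right_mono)
        then have "q x \<le> V x * q x / c" using V(3) by (simp add: field_simps)
        then show ?thesis unfolding if_not_P[OF False] by simp
      qed
    qed
    also have "\<dots> = integral {-Y..Y} (\<lambda>x. if x \<in> {-X..X} then q x else 0) + integral {-Y..Y} (\<lambda>x. V x * q x / c)"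
      by (rule integral_add[OF ir iV])
    also have "integral {-Y..Y} (\<lambda>x. if x \<in> {-X..X} then q x else 0) = integral {-X..X} q"
      using Y by (subst Henstock_Kurzweil_Integration.integral_restrict_Int) (simp add: min.absorb1)
    also have "integral {-Y..Y} (\<lambda>x. V x * q x / c) \<le> B / c"
      using Vq(2)[of Y] V(3) by (simp add: divide_right_mono)
    finally show "integral {-Y..Y} q \<le> integral {-X..X} q + B / c" by simp
  qed
qed simp

section \<open>Smooth compactly supported functions\<close>

lemma power_div_fact_le_exp:
  fixes x :: real
  assumes "0 \<le> x"
  shows "x ^ n / fact n \<le> exp x"
proof -
  have "(\<lambda>k. x ^ k /\<^sub>R fact k) sums exp x" by (rule exp_converges)
  then have "(\<Sum>k\<in>{n}. x ^ k /\<^sub>R fact k) \<le> exp x"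
    by (metis (no_types, lifting) assms divideR_right fact_gt_zero finite.emptyI finite.insertI
        scaleR_nonneg_nonneg sum_le_suminf sums_iff zero_le_power inverse_nonnegative_iff_nonnegative less_imp_le)
  then show ?thesis by (simp add: divide_inverse mult.commute)
qed

text \<open>The flat function exp (-1 / x), extended by zero. The divisors x^k make the family
  closed under differentiation up to linear combinations.\<close>

definition flat_exp :: "nat \<Rightarrow> real \<Rightarrow> real" where
  "flat_exp k x = (if 0 < x then exp (- 1 / x) / x ^ k else 0)"

text \<open>Comparing exp (1 / x) with the term of order k + 2 of its series leaves x^2 after
  division by x^k, which is enough for a vanishing derivative at the origin.\<close>

lemma flat_exp_le: "\<bar>flat_exp k x\<bar> \<le> fact (k + 2) * x\<^sup>2"
proof (cases "0 < x")
  case True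
  have "(1 / x) ^ (k + 2) / fact (k + 2) \<le> exp (1 / x)"
    using True by (intro power_div_fact_le_exp) auto
  moreover have "(0::real) < fact (k + 2)" by (rule fact_gt_zero)
  ultimately have "1 \<le> exp (1 / x) * (x ^ (k + 2) * fact (k + 2))"
    using True by (simp add: divide_le_eq power_one_over del: fact_Suc power_Suc add_2_eq_Suc')
  also have "\<dots> = exp (1 / x) * x ^ k * (fact (k + 2) * x\<^sup>2)"
    by (simp add: power_add del: fact_Suc add_2_eq_Suc')
  finally have "exp (- 1 / x) / x ^ k \<le> fact (k + 2) * x\<^sup>2"
    using True by (simp add: exp_minus inverse_eq_divide divide_le_eq mult_ac del: fact_Suc add_2_eq_Suc')
  then show ?thesis using True by (simp add: flat_exp_def)
qed (simp add: flat_exp_def)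

lemma flat_exp_has_derivative:
  "(flat_exp k has_real_derivative flat_exp (k + 2) x - real k * flat_exp (k + 1) x) (at x)"
proof -
  consider "0 < x" | "x = 0" | "x < 0" by linarith
  then show ?thesis
  proof cases
    case 1
    have "((\<lambda>x. exp (- 1 / x) / x ^ k) has_real_derivative
        (exp (- 1 / x) / x ^ (k + 2) - real k * (exp (- 1 / x) / x ^ (k + 1)))) (at x)"
    proof -
      have "((\<lambda>x. exp (- 1 / x) / x ^ k) has_real_derivative
        (exp (- 1 / x) * (1 / x\<^sup>2) * x ^ k - exp (- 1 / x) * (real k * x ^ (k - 1))) / (x ^ k * x ^ k)) (at x)"
        using 1 by (auto intro!: derivative_eq_intros simp: power2_eq_square field_simps)
      moreover have "(exp (- 1 / x) * (1 / x\<^sup>2) * x ^ k - exp (- 1 / x) * (real k * x ^ (k - 1))) / (x ^ k * x ^ k)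
        = exp (- 1 / x) / x ^ (k + 2) - real k * (exp (- 1 / x) / x ^ (k + 1))"
        using 1 by (cases k) (auto simp: field_simps power2_eq_square)
      ultimately show ?thesis by simp
    qed
    then have "(flat_exp k has_real_derivative
        (exp (- 1 / x) / x ^ (k + 2) - real k * (exp (- 1 / x) / x ^ (k + 1)))) (at x)"
      by (rule has_field_derivative_transform_within_open[where S = "{0<..}"])
         (use 1 in \<open>auto simp: flat_exp_def\<close>)
    then show ?thesis using 1 by (simp add: flat_exp_def)
  next
    case 2
    have "((\<lambda>y. flat_exp k y / y) \<longlongrightarrow> 0) (at 0)"
    proof (rule Lim_null_comparison)
      show "\<forall>\<^sub>F y in at 0. norm (flat_exp k y / y) \<le> fact (k + 2) * \<bar>y\<bar>"
      proof (rule always_eventually, rule allI)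
        fix y :: real
        show "norm (flat_exp k y / y) \<le> fact (k + 2) * \<bar>y\<bar>"
          using flat_exp_le[of k y]
          by (cases "y = 0") (simp_all add: abs_divide divide_le_eq power2_eq_square mult.assoc)
      qed
      show "((\<lambda>y. fact (k + 2) * \<bar>y\<bar>) \<longlongrightarrow> (0::real)) (at 0)"
      proof -
        have "((\<lambda>y. fact (k + 2) * \<bar>y\<bar>) \<longlongrightarrow> fact (k + 2) * \<bar>0::real\<bar>) (at 0)" by (intro tendsto_intros)
        then show ?thesis by simp
      qed
    qed
    then show ?thesis using 2 by (simp add: DERIV_def flat_exp_def)
  next
    case 3
    have "(flat_exp k has_real_derivative 0) (at x)"
      by (rule has_field_derivative_transform_within_open[where S = "{..<0}" and f = "\<lambda>_. 0"])
         (use 3 in \<open>auto simp: flat_exp_def\<close>)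
    then show ?thesis using 3 by (simp add: flat_exp_def)
  qed
qed

text \<open>Supported in {a..b}. The scale c steepens both flanks: for j = k = 0 and growing c these
  functions tend to the indicator of the open interval.\<close>

definition bump :: "nat \<Rightarrow> nat \<Rightarrow> real \<Rightarrow> real \<Rightarrow> real \<Rightarrow> real \<Rightarrow> real" where
  "bump j k c a b x = flat_exp j (c * (x - a)) * flat_exp k (c * (b - x))"

text \<open>A supply of test functions that derivatives do not leave, so that one induction deals
  with derivatives of all orders.\<close>

inductive_set bump_span :: "(real \<Rightarrow> real) set" where
  bump: "0 < c \<Longrightarrow> bump j k c a b \<in> bump_span"
| add: "f \<in> bump_span \<Longrightarrow> g \<in> bump_span \<Longrightarrow> (\<lambda>x. f x + g x) \<in> bump_span"
| scale: "f \<in> bump_span \<Longrightarrow> (\<lambda>x. r * f x) \<in> bump_span"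

lemma bump_span_derivative:
  "f \<in> bump_span \<Longrightarrow> \<exists>f'\<in>bump_span. \<forall>x. (f has_real_derivative f' x) (at x)"
proof (induction rule: bump_span.induct)
  case (bump c j k a b)
  define f' where "f' x = (c * bump (j + 2) k c a b x + (- c * real j) * bump (j + 1) k c a b x) +
     ((- c) * bump j (k + 2) c a b x + (c * real k) * bump j (k + 1) c a b x)" for x
  have "f' \<in> bump_span" unfolding f'_def
    by (intro bump_span.add bump_span.scale bump_span.bump bump)
  moreover have "(bump j k c a b has_real_derivative f' x) (at x)" for x
  proof -
    have 1: "((\<lambda>x. flat_exp j (c * (x - a))) has_real_derivative
        (flat_exp (j + 2) (c * (x - a)) - real j * flat_exp (j + 1) (c * (x - a))) * c) (at x)"
      by (rule DERIV_chain2[OF flat_exp_has_derivative]) (auto intro!: derivative_eq_intros)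
    have 2: "((\<lambda>x. flat_exp k (c * (b - x))) has_real_derivative
        (flat_exp (k + 2) (c * (b - x)) - real k * flat_exp (k + 1) (c * (b - x))) * (- c)) (at x)"
      by (rule DERIV_chain2[OF flat_exp_has_derivative]) (auto intro!: derivative_eq_intros)
    show ?thesis unfolding bump_def[abs_def] f'_def
      by (rule DERIV_cong[OF DERIV_mult[OF 1 2]]) (simp add: algebra_simps)
  qed
  ultimately show ?case by blast
next
  case (add f g)
  then obtain f' g' where "f' \<in> bump_span" "g' \<in> bump_span"
    "\<forall>x. (f has_real_derivative f' x) (at x)" "\<forall>x. (g has_real_derivative g' x) (at x)" by blast
  then show ?case
    by (intro bexI[of _ "\<lambda>x. f' x + g' x"] allI DERIV_add bump_span.add) auto
next
  case (scale f r)
  then obtain f' where "f' \<in> bump_span" "\<forall>x. (f has_real_derivative f' x) (at x)" by blast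
  then show ?case
    by (intro bexI[of _ "\<lambda>x. r * f' x"] allI DERIV_cmult bump_span.scale) auto
qed

lemma bump_span_support:
  "f \<in> bump_span \<Longrightarrow> \<exists>r>0. \<forall>x. r \<le> \<bar>x\<bar> \<longrightarrow> f x = 0"
proof (induction rule: bump_span.induct)
  case (bump c j k a b)
  have "bump j k c a b x = 0" if "\<bar>a\<bar> + \<bar>b\<bar> + 1 \<le> \<bar>x\<bar>" for x
    using that bump by (auto simp: bump_def flat_exp_def zero_less_mult_iff)
  then show ?case by (intro exI[of _ "\<bar>a\<bar> + \<bar>b\<bar> + 1"]) auto
next
  case (add f g)
  then obtain r s where "0 < r" "\<forall>x. r \<le> \<bar>x\<bar> \<longrightarrow> f x = 0" "\<forall>x. s \<le> \<bar>x\<bar> \<longrightarrow> g x = 0" by blast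
  then show ?case by (intro exI[of _ "max r s"]) auto
qed auto

lemma bump_span_continuous: "f \<in> bump_span \<Longrightarrow> continuous_on S f"
  using bump_span_derivative by (meson DERIV_isCont continuous_at_imp_continuous_on)

text \<open>Every iterated derivative stays in \<open>S\<close>, hence is continuous with compact
  support, and remains bounded after multiplication by a power of x. The lemma is about a class
  because the induction moves from a function to its derivative.\<close>

lemma schwartz_of_compact_support:
  fixes S :: "(real \<Rightarrow> real) set"
  assumes S: "\<And>f. f \<in> S \<Longrightarrow> \<exists>f'\<in>S. \<forall>x. (f has_real_derivative f' x) (at x)"
    and supp: "\<And>f. f \<in> S \<Longrightarrow> \<exists>r>0. \<forall>x. r \<le> \<bar>x\<bar> \<longrightarrow> f x = 0"
    and u: "u \<in> S"
  shows "(\<lambda>x. complex_of_real (u x)) \<in> schwartz"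
proof -
  have vd: "vector_derivative (\<lambda>x. complex_of_real (f x)) (at x) = of_real d"
    if "(f has_real_derivative d) (at x)" for f :: "real \<Rightarrow> real" and d x
    using that by (intro vector_derivative_at has_vector_derivative_of_real)
      (simp add: has_real_derivative_iff_has_vector_derivative)
  have ex: "\<exists>f\<in>S. nth_deriv n (\<lambda>x. complex_of_real (u x)) = (\<lambda>x. of_real (f x))" for n
  proof (induction n)
    case 0
    then show ?case using u by (auto simp: nth_deriv_def)
  next
    case (Suc n)
    then obtain f where f: "f \<in> S" "nth_deriv n (\<lambda>x. complex_of_real (u x)) = (\<lambda>x. of_real (f x))" by blast
    obtain f' where f': "f' \<in> S" "\<And>x. (f has_real_derivative f' x) (at x)" using S[OF f(1)] by blast
    have "nth_deriv (Suc n) (\<lambda>x. complex_of_real (u x)) = (\<lambda>x. of_real (f' x))"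
    proof
      fix x show "nth_deriv (Suc n) (\<lambda>x. complex_of_real (u x)) x = of_real (f' x)"
        using f(2) vd[OF f'(2)] by (simp add: nth_deriv_def)
    qed
    then show ?case using f' by blast
  qed
  show ?thesis unfolding schwartz_def
  proof (intro CollectI conjI allI)
    fix n :: nat and x :: real
    obtain f where f: "f \<in> S" "nth_deriv n (\<lambda>x. complex_of_real (u x)) = (\<lambda>x. of_real (f x))" using ex by blast
    obtain f' where "(f has_real_derivative f' x) (at x)" using S[OF f(1)] by blast
    then have "((\<lambda>x. complex_of_real (f x)) has_vector_derivative of_real (f' x)) (at x)"
      by (intro has_vector_derivative_of_real) (simp add: has_real_derivative_iff_has_vector_derivative)
    then show "nth_deriv n (\<lambda>x. complex_of_real (u x)) differentiable at x"
      unfolding f(2) by (auto simp: has_vector_derivative_def differentiable_def)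
  next
    fix m n :: nat
    obtain f where f: "f \<in> S" "nth_deriv n (\<lambda>x. complex_of_real (u x)) = (\<lambda>x. of_real (f x))" using ex by blast
    obtain f' where f': "\<And>x. (f has_real_derivative f' x) (at x)" using S[OF f(1)] by blast
    obtain r where r: "0 < r" "\<And>x. r \<le> \<bar>x\<bar> \<Longrightarrow> f x = 0" using supp[OF f(1)] by blast
    have c: "continuous_on {-r..r} (\<lambda>x. complex_of_real (x ^ m) * of_real (f x))"
      using f' by (intro continuous_intros continuous_at_imp_continuous_on ballI) (auto intro: DERIV_isCont)
    have "range (\<lambda>x. complex_of_real (x ^ m) * of_real (f x)) \<subseteq>
        insert 0 ((\<lambda>x. complex_of_real (x ^ m) * of_real (f x)) ` {-r..r})"
    proof
      fix z assume "z \<in> range (\<lambda>x. complex_of_real (x ^ m) * of_real (f x))"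
      then obtain x where x: "z = complex_of_real (x ^ m) * of_real (f x)" by blast
      show "z \<in> insert 0 ((\<lambda>x. complex_of_real (x ^ m) * of_real (f x)) ` {-r..r})"
        using r(2)[of x] x by (cases "r \<le> \<bar>x\<bar>") (simp, intro insertI2 image_eqI[of _ _ x], auto)
    qed
    moreover have "bounded (insert 0 ((\<lambda>x. complex_of_real (x ^ m) * of_real (f x)) ` {-r..r}))"
      using compact_continuous_image[OF c] by (auto intro: compact_imp_bounded)
    ultimately show "bounded (range (\<lambda>x. complex_of_real (x ^ m) * nth_deriv n (\<lambda>x. complex_of_real (u x)) x))"
      unfolding f(2) by (rule bounded_subset[rotated])
  qed
qed

lemma nth_deriv_2_of_real:
  assumes "\<And>x. (u has_real_derivative u' x) (at x)" "\<And>x. (u' has_real_derivative u'' x) (at x)"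
  shows "nth_deriv 2 (\<lambda>x. complex_of_real (u x)) x = of_real (u'' x)"
proof -
  have vd: "(\<lambda>x. vector_derivative (\<lambda>x. complex_of_real (f x)) (at x)) = (\<lambda>x. of_real (f' x))"
    if "\<And>x. (f has_real_derivative f' x) (at x)" for f f' :: "real \<Rightarrow> real"
  proof
    fix x show "vector_derivative (\<lambda>x. complex_of_real (f x)) (at x) = of_real (f' x)"
      using that[of x] by (intro vector_derivative_at has_vector_derivative_of_real)
        (simp add: has_real_derivative_iff_has_vector_derivative)
  qed
  show ?thesis using vd[OF assms(1)] vd[OF assms(2)]
    by (simp add: nth_deriv_def numeral_2_eq_2 fun_eq_iff)
qed

section \<open>The lemma of du Bois-Reymond\<close>

text \<open>As all integrals of p over intervals vanish, each term of a Riemann sum of p is its own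
  error in Henstock's lemma. That lemma bounds the sum of the moduli of the errors, so the modulus
  of p has integral zero.\<close>

lemma AE_zero_of_interval_integrals:
  fixes p :: "real \<Rightarrow> real"
  assumes p: "\<And>r. p absolutely_integrable_on {-r..r}"
    and 0: "\<And>a b. a \<le> b \<Longrightarrow> integral {a..b} p = 0"
  shows "AE x in lebesgue. p x = 0"
proof -
  have hi: "((\<lambda>x. \<bar>p x\<bar>) has_integral 0) {-r..r}" for r
    unfolding has_integral[where y = "0::real" and a = "-r" and b = r, folded cbox_interval, simplified cbox_interval]
  proof (intro allI impI)
    fix e :: real assume "0 < e"
    have "p integrable_on cbox (-r) r"
      using set_lebesgue_integral_eq_integral(1)[OF p] by (simp add: cbox_interval)
    from Henstock_lemma[OF this \<open>0 < e\<close>] obtain \<gamma> where \<gamma>: "gauge \<gamma>"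
      "\<And>D. D tagged_partial_division_of cbox (-r) r \<Longrightarrow> \<gamma> fine D \<Longrightarrow>
         (\<Sum>(x, k)\<in>D. norm (measure lborel k *\<^sub>R p x - integral k p)) < e" by blast
    have "norm ((\<Sum>(x, k)\<in>D. measure lborel k *\<^sub>R \<bar>p x\<bar>) - 0) < e"
      if D: "D tagged_division_of {-r..r}" "\<gamma> fine D" for D
    proof -
      have "(\<Sum>(x, k)\<in>D. measure lborel k *\<^sub>R \<bar>p x\<bar>) = (\<Sum>(x, k)\<in>D. norm (measure lborel k *\<^sub>R p x - integral k p))"
      proof (rule sum.cong[OF refl], clarify)
        fix x k assume "(x, k) \<in> D"
        then obtain a b where k: "k = {a..b}" "x \<in> k"
          using tagged_division_ofD(2,4)[OF D(1)] by (metis box_real(2))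
        then have "integral k p = 0" using 0[of a b] by auto
        then show "measure lborel k *\<^sub>R \<bar>p x\<bar> = norm (measure lborel k *\<^sub>R p x - integral k p)"
          by (simp add: abs_mult)
      qed
      moreover have "0 \<le> (\<Sum>(x, k)\<in>D. measure lborel k *\<^sub>R \<bar>p x\<bar>)" by (intro sum_nonneg) auto
      moreover have "D tagged_partial_division_of cbox (-r) r"
        using D(1) by (simp add: tagged_division_of_def cbox_interval)
      ultimately show ?thesis using \<gamma>(2)[OF _ D(2)] by simp
    qed
    then show "\<exists>\<gamma>. gauge \<gamma> \<and> (\<forall>D. D tagged_division_of {-r..r} \<and> \<gamma> fine D \<longrightarrow>
        norm ((\<Sum>(x, k)\<in>D. measure lborel k *\<^sub>R \<bar>p x\<bar>) - 0) < e)"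
      using \<gamma>(1) by blast
  qed
  have "AE x in lebesgue. \<forall>n::nat. indicator {-real n..real n} x * \<bar>p x\<bar> = 0"
  proof (rule AE_all_countable[THEN iffD2], rule allI)
    fix n :: nat
    have ai: "(\<lambda>x. \<bar>p x\<bar>) absolutely_integrable_on {-real n..real n}" by (intro set_integrable_abs p)
    have "(LINT x|lebesgue. indicator {-real n..real n} x * \<bar>p x\<bar>) = 0"
      using set_lebesgue_integral_eq_integral(2)[OF ai] integral_unique[OF hi[of n]]
      by (simp add: set_lebesgue_integral_def)
    then show "AE x in lebesgue. indicator {-real n..real n} x * \<bar>p x\<bar> = 0"
      using ai by (subst (asm) integral_nonneg_eq_0_iff_AE) (auto simp: set_integrable_def)
  qed
  then show ?thesis
  proof eventually_elim
    fix x :: real assume *: "\<forall>n::nat. indicator {-real n..real n} x * \<bar>p x\<bar> = 0"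
    obtain n :: nat where "\<bar>x\<bar> \<le> n" using real_arch_simple by blast
    then have "x \<in> {-real n..real n}" by auto
    then show "p x = 0" using *[rule_format, of n] by simp
  qed
qed

lemma compact_support_product:
  fixes f g :: "real \<Rightarrow> real"
  assumes "continuous_on {-R..R} f" "\<And>x. R \<le> \<bar>x\<bar> \<Longrightarrow> f x = 0" "g absolutely_integrable_on {-R..R}"
  shows "integrable lebesgue (\<lambda>x. f x * g x)"
    "(LINT x|lebesgue. f x * g x) = integral {-R..R} (\<lambda>x. f x * g x)"
proof -
  have ai: "(\<lambda>x. f x * g x) absolutely_integrable_on {-R..R}"
    by (rule absolutely_integrable_continuous_mult(1)[OF assms(3,1)])
  have eq: "indicator {-R..R} x *\<^sub>R (f x * g x) = f x * g x" for x
    using assms(2)[of x] by (cases "R \<le> \<bar>x\<bar>") (auto simp: indicator_def)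
  show "integrable lebesgue (\<lambda>x. f x * g x)"
    using ai unfolding set_integrable_def eq .
  show "(LINT x|lebesgue. f x * g x) = integral {-R..R} (\<lambda>x. f x * g x)"
    using set_lebesgue_integral_eq_integral(2)[OF ai] unfolding set_lebesgue_integral_def eq .
qed

lemma primitive_on_UNIV_of_derivative:
  assumes "\<And>x. (F has_real_derivative f x) (at x)" "continuous_on UNIV f"
  shows "primitive_on UNIV F f"
proof -
  have "primitive_on {a..b} F f" for a b
    by (rule primitive_on_of_derivative[OF has_field_derivative_at_within[OF assms(1)] continuous_on_subset[OF assms(2)]]) auto
  then show ?thesis by (auto simp: primitive_on_def)
qed

text \<open>\<open>r\<close> is integrated twice from the left end of its support. The vanishing of
  the moments of order 0 and 1 is exactly what makes u' and u return to zero at the right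
  end.\<close>

lemma exists_test_function:
  assumes r: "r \<in> bump_span" and m: "(LINT x|lebesgue. r x) = 0" "(LINT x|lebesgue. r x * x) = 0"
  obtains u u' R where "\<And>x. (u has_real_derivative u' x) (at x)" "\<And>x. (u' has_real_derivative r x) (at x)"
    "(\<lambda>x. complex_of_real (u x)) \<in> schwartz" "0 < R"
    "\<And>x. R \<le> \<bar>x\<bar> \<Longrightarrow> u x = 0 \<and> u' x = 0 \<and> r x = 0"
proof -
  obtain R where R: "0 < R" "\<And>x. R \<le> \<bar>x\<bar> \<Longrightarrow> r x = 0" using bump_span_support[OF r] by blast
  note cr = bump_span_continuous[OF r]
  have ai: "f absolutely_integrable_on {a..b}" if "continuous_on UNIV f" for f :: "real \<Rightarrow> real" and a b
    using that by (intro absolutely_integrable_continuous_real) (auto intro: continuous_on_subset)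
  obtain P where P: "primitive_on UNIV P r"
    using primitive_on_UNIV_exists[of r] ai[OF cr] by blast
  define u' where "u' x = P x - P (- R)" for x
  have u': "primitive_on UNIV u' r"
    using P by (auto simp: primitive_on_def u'_def)
  have cu': "continuous_on UNIV u'" by (rule primitive_on_UNIV_continuous[OF u'])
  obtain Q where Q: "primitive_on UNIV Q u'"
    using primitive_on_UNIV_exists[of u'] ai[OF cu'] by blast
  define u where "u x = Q x - Q (- R)" for x
  have u: "primitive_on UNIV u u'"
    using Q by (auto simp: primitive_on_def u_def)
  have du: "(u has_real_derivative u' x) (at x)" for x by (rule primitive_on_UNIV_DERIV[OF u cu'])
  have du': "(u' has_real_derivative r x) (at x)" for x by (rule primitive_on_UNIV_DERIV[OF u' cr])
  have const: "F y = F x" if F: "primitive_on UNIV F f" and "x \<le> y" "\<And>t. t \<in> {x..y} \<Longrightarrow> f t = 0" for F f x y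
  proof -
    have "integral {x..y} f = integral {x..y} (\<lambda>_. 0)" by (rule integral_cong) (rule that(3))
    then show ?thesis using primitive_on_integral[OF F that(2)] by simp
  qed
  have base: "u' (- R) = 0" "u (- R) = 0" by (simp_all add: u'_def u_def)
  have "u' R - u' (- R) = integral {-R..R} r" using primitive_on_integral[OF u', of "-R" R] R(1) by simp
  also have "\<dots> = 0"
    using compact_support_product(2)[of R r "\<lambda>_. 1"] R(2) m(1) ai[of "\<lambda>_. 1"] bump_span_continuous[OF r] by simp
  finally have u'R: "u' R = 0" using base by simp
  \<comment> \<open>Integrating the derivative of x u' relates the first moment of \<open>r\<close>
    to the integral of u', which is u(R).\<close>
  have xu': "primitive_on UNIV (\<lambda>x. x * u' x) (\<lambda>x. 1 * u' x + x * r x)"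
    by (intro primitive_on_mult u' primitive_on_UNIV_of_derivative) auto
  have "0 = integral {-R..R} (\<lambda>x. 1 * u' x + x * r x)"
    using primitive_on_integral[OF xu', of "-R" R] R(1) u'R base by simp
  also have "\<dots> = integral {-R..R} u' + integral {-R..R} (\<lambda>x. x * r x)"
    using cu' cr by (subst integral_add) (auto intro!: integrable_continuous_real continuous_intros intro: continuous_on_subset)
  also have "integral {-R..R} (\<lambda>x. x * r x) = 0"
    using compact_support_product(2)[of R r "\<lambda>x. x"] R(2) m(2) ai[of "\<lambda>x. x"] bump_span_continuous[OF r]
    by (simp add: mult.commute)
  also have "integral {-R..R} u' = u R - u (- R)" using primitive_on_integral[OF u, of "-R" R] R(1) by simp
  finally have uR: "u R = 0" using base by simp
  have supp': "u' x = 0" if x: "R \<le> \<bar>x\<bar>" for x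
  proof (cases "0 \<le> x")
    case True
    then have "u' x = u' R" using x R by (intro const[OF u']) auto
    then show ?thesis using u'R by simp
  next
    case False
    then have "u' (- R) = u' x" using x R by (intro const[OF u']) auto
    then show ?thesis using base by simp
  qed
  have supp: "u x = 0" if x: "R \<le> \<bar>x\<bar>" for x
  proof (cases "0 \<le> x")
    case True
    then have "u x = u R" using x R(1) supp' by (intro const[OF u]) auto
    then show ?thesis using uR by simp
  next
    case False
    then have "u (- R) = u x" using x R(1) supp' by (intro const[OF u]) auto
    then show ?thesis using base by simp
  qed
  have "(\<lambda>x. complex_of_real (u x)) \<in> schwartz"
  \<comment> \<open>u and u' need not lie in \<open>bump_span\<close>, but the second derivative r
    does, so adding the two keeps the class closed under differentiation.\<close>
  proof (rule schwartz_of_compact_support[where S = "bump_span \<union> {u, u'}"])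
    show "\<exists>f'\<in>bump_span \<union> {u, u'}. \<forall>x. (f has_real_derivative f' x) (at x)" if "f \<in> bump_span \<union> {u, u'}" for f
      using that bump_span_derivative[of f] du du' r by blast
    show "\<exists>r>0. \<forall>x. r \<le> \<bar>x\<bar> \<longrightarrow> f x = 0" if "f \<in> bump_span \<union> {u, u'}" for f
      using that bump_span_support[of f] supp supp' R(1) by blast
  qed simp
  then show thesis using that[OF du du' _ R(1)] supp supp' R(2) by blast
qed

lemma bump_pos: "0 < c \<Longrightarrow> a < x \<Longrightarrow> x < b \<Longrightarrow> 0 < bump j k c a b x"
  by (simp add: bump_def flat_exp_def)

lemma bump_zero: "0 < c \<Longrightarrow> x \<le> a \<or> b \<le> x \<Longrightarrow> bump j k c a b x = 0"
  by (auto simp: bump_def flat_exp_def zero_less_mult_iff)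

lemma bump_nonneg: "0 < c \<Longrightarrow> 0 \<le> bump j k c a b x"
  by (simp add: bump_def flat_exp_def)

lemma continuous_lebesgue_integral_pos:
  fixes f :: "real \<Rightarrow> real"
  assumes "integrable lebesgue f" "\<And>x. 0 \<le> f x" "a < b" "\<And>x. a < x \<Longrightarrow> x < b \<Longrightarrow> 0 < f x"
  shows "0 < (LINT x|lebesgue. f x)"
proof (rule ccontr)
  assume "\<not> ?thesis"
  moreover have "0 \<le> (LINT x|lebesgue. f x)" using assms(2) by simp
  ultimately have "(LINT x|lebesgue. f x) = 0" by simp
  then have "AE x in lebesgue. f x = 0"
    using integral_nonneg_eq_0_iff_AE[OF assms(1)] assms(2) by simp
  then have "AE x in lebesgue. x \<notin> {a<..<b}"
    by eventually_elim (use assms(4) in force)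
  then have "{a<..<b} \<in> null_sets lebesgue"
    by (subst (asm) AE_iff_null_sets[symmetric]) auto
  then have "measure lebesgue {a<..<b} = 0" by (rule measure_eq_0_null_sets)
  then show False using assms(3) by simp
qed

text \<open>Once a second primitive of w is subtracted from f, the rest is orthogonal to all second
  derivatives of test functions, among them every \<open>r\<close> in \<open>bump_span\<close> with
  vanishing moments of order 0 and 1. Such a rest is affine up to a null set; the affine function is
  found by means of two fixed bumps.\<close>

lemma du_Bois_Reymond:
  fixes f w :: "real \<Rightarrow> real"
  assumes f: "\<And>r. f absolutely_integrable_on {-r..r}" and w: "\<And>r. w absolutely_integrable_on {-r..r}"
    and weak: "\<And>u u' u'' R. \<lbrakk>\<And>x. (u has_real_derivative u' x) (at x); \<And>x. (u' has_real_derivative u'' x) (at x);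
        continuous_on UNIV u''; (\<lambda>x. complex_of_real (u x)) \<in> schwartz; 0 < R; \<And>x. R \<le> \<bar>x\<bar> \<Longrightarrow> u x = 0 \<and> u' x = 0 \<and> u'' x = 0\<rbrakk>
       \<Longrightarrow> (LINT x|lebesgue. u'' x * f x) = (LINT x|lebesgue. u x * w x)"
  obtains F F' where "primitive_on UNIV F F'" "primitive_on UNIV F' w" "AE x in lebesgue. f x = F x"
proof -
  obtain W1 where W1: "primitive_on UNIV W1 w" using primitive_on_UNIV_exists[OF w] by blast
  have cW1: "continuous_on UNIV W1" by (rule primitive_on_UNIV_continuous[OF W1])
  have ai: "f absolutely_integrable_on {a..b}" if "continuous_on UNIV f" for f :: "real \<Rightarrow> real" and a b
    using that by (intro absolutely_integrable_continuous_real) (auto intro: continuous_on_subset)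
  obtain W2 where W2: "primitive_on UNIV W2 W1" using primitive_on_UNIV_exists[of W1] ai[OF cW1] by blast
  have cW2: "continuous_on UNIV W2" by (rule primitive_on_UNIV_continuous[OF W2])
  define g where "g x = f x - W2 x" for x
  have g: "g absolutely_integrable_on {-r..r}" for r
    unfolding g_def by (intro set_integral_diff f ai cW2)
  have prod: "integrable lebesgue (\<lambda>x. h x * p x)" if hp: "h \<in> bump_span" "\<And>r. p absolutely_integrable_on {-r..r}" for h p
  proof -
    obtain R where "\<And>x. R \<le> \<bar>x\<bar> \<Longrightarrow> h x = 0" using bump_span_support[OF hp(1)] by blast
    then show ?thesis by (rule compact_support_product(1)[OF bump_span_continuous[OF hp(1)] _ hp(2)])
  qed
  have orth: "(LINT x|lebesgue. r x * g x) = 0"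
    if r: "r \<in> bump_span" "(LINT x|lebesgue. r x) = 0" "(LINT x|lebesgue. r x * x) = 0" for r
  proof -
    obtain u u' R where u: "\<And>x. (u has_real_derivative u' x) (at x)" "\<And>x. (u' has_real_derivative r x) (at x)"
      "(\<lambda>x. complex_of_real (u x)) \<in> schwartz" "0 < R"
      "\<And>x. R \<le> \<bar>x\<bar> \<Longrightarrow> u x = 0 \<and> u' x = 0 \<and> r x = 0"
      using exists_test_function[OF r] by blast
    have cr: "continuous_on S r" for S by (rule bump_span_continuous[OF r(1)])
    have c: "continuous_on S u" "continuous_on S u'" for S
      using u(1,2) by (meson DERIV_isCont continuous_at_imp_continuous_on)+
    have pu: "primitive_on UNIV u u'" "primitive_on UNIV u' r"
      using u(1,2) c cr by (auto intro!: primitive_on_UNIV_of_derivative)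
    have uR: "u R = 0" "u (-R) = 0" "u' R = 0" "u' (-R) = 0" using u(4,5) by auto
    have i: "(\<lambda>x. u' x * W1 x) integrable_on {-R..R}" "(\<lambda>x. u x * w x) integrable_on {-R..R}"
      "(\<lambda>x. r x * W2 x) integrable_on {-R..R}"
      by (intro set_lebesgue_integral_eq_integral(1) absolutely_integrable_continuous_mult(1) c cr w ai[OF cW1] ai[OF cW2])+
    \<comment> \<open>Two integrations by parts, without boundary terms because u and u' vanish at
      both ends, move both derivatives from u to \<open>W2\<close>.\<close>
    have "integral {-R..R} (\<lambda>x. u' x * W1 x + u x * w x) = 0"
      using primitive_on_integral[OF primitive_on_mult[OF pu(1) W1], of "-R" R] u(4) uR by simp
    then have 1: "integral {-R..R} (\<lambda>x. u x * w x) = - integral {-R..R} (\<lambda>x. u' x * W1 x)"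
      using integral_add[OF i(1,2)] by simp
    have "integral {-R..R} (\<lambda>x. r x * W2 x + u' x * W1 x) = 0"
      using primitive_on_integral[OF primitive_on_mult[OF pu(2) W2], of "-R" R] u(4) uR by simp
    then have 2: "integral {-R..R} (\<lambda>x. r x * W2 x) = - integral {-R..R} (\<lambda>x. u' x * W1 x)"
      using integral_add[OF i(3,1)] by simp
    have "(LINT x|lebesgue. r x * f x) = (LINT x|lebesgue. u x * w x)"
      by (rule weak[OF u(1,2) cr u(3,4,5)])
    also have "\<dots> = integral {-R..R} (\<lambda>x. u x * w x)"
      by (rule compact_support_product(2)) (use u(5) c w in auto)
    also have "\<dots> = integral {-R..R} (\<lambda>x. r x * W2 x)" using 1 2 by simp
    also have "\<dots> = (LINT x|lebesgue. r x * W2 x)"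
      by (rule compact_support_product(2)[symmetric]) (use u(5) cr ai[OF cW2] in auto)
    finally show ?thesis
      using prod[OF r(1) f] prod[OF r(1) ai[OF cW2]] by (simp add: g_def right_diff_distrib)
  qed
  define m0 m1 where "m0 h = (LINT x|lebesgue. h x)" and "m1 h = (LINT x|lebesgue. h x * x)" for h :: "real \<Rightarrow> real"
  \<comment> \<open>The supports {0..1} and {1..2} place the centres of mass on different sides of
    1, so that the determinant \<Delta> of their moments is positive.\<close>
  define k0 k1 where "k0 = bump 0 0 1 0 1" and "k1 = bump 0 0 1 1 2"
  have k: "k0 \<in> bump_span" "k1 \<in> bump_span" by (auto simp: k0_def k1_def intro: bump_span.bump)
  have int: "integrable lebesgue h" "integrable lebesgue (\<lambda>x. h x * x)" if "h \<in> bump_span" for h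
    using prod[OF that, of "\<lambda>_. 1"] prod[OF that, of "\<lambda>x. x"] ai[of "\<lambda>_. 1"] ai[of "\<lambda>x. x"] by auto
  have pos: "0 < m0 k0" "0 < m0 k1"
    unfolding m0_def
    by (rule continuous_lebesgue_integral_pos[OF int(1)[OF k(1)], of 0 1], auto simp: k0_def bump_nonneg bump_pos)
       (rule continuous_lebesgue_integral_pos[OF int(1)[OF k(2)], of 1 2], auto simp: k1_def bump_nonneg bump_pos)
  have "0 < (LINT x|lebesgue. k0 x - k0 x * x)"
  proof (rule continuous_lebesgue_integral_pos[of _ 0 1])
    fix x
    have "k0 x - k0 x * x = k0 x * (1 - x)" by (simp add: algebra_simps)
    then show "0 \<le> k0 x - k0 x * x" "0 < x \<Longrightarrow> x < 1 \<Longrightarrow> 0 < k0 x - k0 x * x"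
      using bump_nonneg[of 1 0 0 0 1 x] bump_zero[of 1 x 0 1] bump_pos[of 1 0 x 1 0 0]
      by (cases "x \<le> 1"; force simp: k0_def)+
  qed (use int[OF k(1)] in auto)
  then have m1k0: "m1 k0 < m0 k0" using int[OF k(1)] by (simp add: m0_def m1_def)
  have m1k1: "m0 k1 \<le> m1 k1" unfolding m0_def m1_def
  proof (rule integral_mono)
    fix x
    show "k1 x \<le> k1 x * x"
      using bump_nonneg[of 1 0 0 1 2 x] bump_zero[of 1 x 1 2] mult_left_mono[of 1 x "k1 x"]
      by (cases "1 \<le> x") (auto simp: k1_def)
  qed (use int[OF k(2)] in auto)
  define \<Delta> where "\<Delta> = m0 k0 * m1 k1 - m1 k0 * m0 k1"
  have "m1 k0 * m0 k1 < m0 k0 * m0 k1" using m1k0 pos by simp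
  also have "\<dots> \<le> m0 k0 * m1 k1" using m1k1 pos by simp
  finally have \<Delta>: "0 < \<Delta>" by (simp add: \<Delta>_def)
  define g0 g1 where "g0 = (LINT x|lebesgue. k0 x * g x)" and "g1 = (LINT x|lebesgue. k1 x * g x)"
  \<comment> \<open>Cramer's rule: with these \<open>A\<close> and \<open>B\<close> the remainder
    \<open>p\<close> is orthogonal to \<open>k0\<close> and \<open>k1\<close>.\<close>
  define A where "A = (g0 * m1 k1 - g1 * m1 k0) / \<Delta>"
  define B where "B = (g1 * m0 k0 - g0 * m0 k1) / \<Delta>"
  define p where "p x = g x - (A + B * x)" for x
  have p: "p absolutely_integrable_on {-r..r}" for r
    unfolding p_def by (intro set_integral_diff g ai continuous_intros)
  have p_orth: "(LINT x|lebesgue. h x * p x) = 0" if h: "h \<in> bump_span" for h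
  proof -
    \<comment> \<open>Cramer's rule again, for the combination of \<open>k0\<close> and
      \<open>k1\<close> that has the same two moments as \<open>h\<close>.\<close>
    define c0 where "c0 = (m0 h * m1 k1 - m1 h * m0 k1) / \<Delta>"
    define c1 where "c1 = (m1 h * m0 k0 - m0 h * m1 k0) / \<Delta>"
    define r where "r x = h x + ((- c0) * k0 x + (- c1) * k1 x)" for x
    have r: "r \<in> bump_span" unfolding r_def by (intro bump_span.add bump_span.scale h k)
    have "m0 r = m0 h - c0 * m0 k0 - c1 * m0 k1"
      using int[OF h] int[OF k(1)] int[OF k(2)] by (simp add: m0_def r_def)
    also have "\<dots> = 0" using \<Delta> by (simp add: c0_def c1_def field_simps) (simp add: \<Delta>_def algebra_simps)
    finally have r0: "(LINT x|lebesgue. r x) = 0" by (simp add: m0_def)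
    have rx: "r x * y = h x * y - c0 * (k0 x * y) - c1 * (k1 x * y)" for x y by (simp add: r_def algebra_simps)
    have "m1 r = m1 h - c0 * m1 k0 - c1 * m1 k1"
      using int[OF h] int[OF k(1)] int[OF k(2)] unfolding m1_def rx by simp
    also have "\<dots> = 0" using \<Delta> by (simp add: c0_def c1_def field_simps) (simp add: \<Delta>_def algebra_simps)
    finally have r1: "(LINT x|lebesgue. r x * x) = 0" by (simp add: m1_def)
    have "0 = (LINT x|lebesgue. h x * g x) - c0 * g0 - c1 * g1"
      using orth[OF r r0 r1] prod[OF h g] prod[OF k(1) g] prod[OF k(2) g]
      unfolding rx g0_def g1_def by simp
    moreover have "c0 * g0 + c1 * g1 = A * m0 h + B * m1 h"
      by (simp add: c0_def c1_def A_def B_def add_divide_distrib[symmetric] algebra_simps)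
    moreover have "(LINT x|lebesgue. h x * p x) = (LINT x|lebesgue. h x * g x) - (A * m0 h + B * m1 h)"
    proof -
      have "(LINT x|lebesgue. h x * p x) = (LINT x|lebesgue. h x * g x - (A * h x + B * (h x * x)))"
        by (simp add: p_def algebra_simps)
      then show ?thesis using prod[OF h g] int[OF h] by (simp add: m0_def m1_def)
    qed
    ultimately show ?thesis by simp
  qed
  have "integral {a..b} p = 0" if ab: "a \<le> b" for a b
  proof -
    \<comment> \<open>These bumps are bounded by 1 and tend to the indicator of the open interval,
      which carries the orthogonality over to interval integrals.\<close>
    define h where "h n = bump 0 0 (real (Suc n)) a b" for n
    have h: "h n \<in> bump_span" for n unfolding h_def by (rule bump_span.bump) simp
    have pab: "p absolutely_integrable_on {a..b}"
      by (rule set_integrable_subset[OF p[of "max \<bar>a\<bar> \<bar>b\<bar>"]]) auto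
    have hp: "(\<lambda>x. h n x * p x) absolutely_integrable_on {a..b}" for n
      by (intro absolutely_integrable_continuous_mult pab bump_span_continuous h)
    have "integral {a..b} (\<lambda>x. h n x * p x) = 0" for n
    proof -
      have eq: "indicator {a..b} x *\<^sub>R (h n x * p x) = h n x * p x" for x
        using bump_zero[of "real (Suc n)" x a b] by (cases "x \<le> a \<or> b \<le> x") (auto simp: h_def)
      then show ?thesis
        using set_lebesgue_integral_eq_integral(2)[OF hp[of n]] p_orth[OF h[of n]]
        unfolding set_lebesgue_integral_def eq by simp
    qed
    moreover have "(\<lambda>n. integral {a..b} (\<lambda>x. h n x * p x)) \<longlonglongrightarrow> integral {a..b} (\<lambda>x. if x \<in> {a<..<b} then p x else 0)"
    proof (rule dominated_convergence(2))
      show "(\<lambda>x. h n x * p x) integrable_on {a..b}" for n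
        using hp set_lebesgue_integral_eq_integral(1) by blast
      show "(\<lambda>x. \<bar>p x\<bar>) integrable_on {a..b}"
        using set_integrable_abs[OF pab] set_lebesgue_integral_eq_integral(1) by blast
      fix x assume x: "x \<in> {a..b}"
      have "0 \<le> flat_exp 0 y \<and> flat_exp 0 y \<le> 1" for y by (auto simp: flat_exp_def)
      then have h1: "\<bar>h n x\<bar> \<le> 1" for n
        by (simp add: h_def bump_def abs_mult mult_le_one)
      show "norm (h n x * p x) \<le> \<bar>p x\<bar>" for n
        using mult_right_mono[OF h1, of "\<bar>p x\<bar>"] by (simp add: abs_mult)
      show "(\<lambda>n. h n x * p x) \<longlonglongrightarrow> (if x \<in> {a<..<b} then p x else 0)"
      proof (cases "x \<in> {a<..<b}")
        case True
        have "(\<lambda>n. exp (- (1 / real (Suc n)) * (1 / (x - a))) * exp (- (1 / real (Suc n)) * (1 / (b - x))) * p x)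
            \<longlonglongrightarrow> exp (- 0 * (1 / (x - a))) * exp (- 0 * (1 / (b - x))) * p x"
          by (intro tendsto_intros LIMSEQ_Suc[OF lim_1_over_n])
        moreover have "h n x = exp (- (1 / real (Suc n)) * (1 / (x - a))) * exp (- (1 / real (Suc n)) * (1 / (b - x)))" for n
          using True by (simp add: h_def bump_def flat_exp_def)
        ultimately show ?thesis using True by simp
      next
        case False
        then have "h n x = 0" for n
          using bump_zero[of "real (Suc n)" x a b] by (auto simp: h_def)
        then show ?thesis unfolding if_not_P[OF False] by simp
      qed
    qed
    ultimately have "integral {a..b} (\<lambda>x. if x \<in> {a<..<b} then p x else 0) = 0"
      by (simp add: LIMSEQ_const_iff)
    moreover have "integral {a..b} p = integral {a..b} (\<lambda>x. if x \<in> {a<..<b} then p x else 0)"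
      by (rule integral_spike[of "{a, b}"]) auto
    ultimately show ?thesis by simp
  qed
  then have "AE x in lebesgue. p x = 0" by (rule AE_zero_of_interval_integrals[OF p])
  then have "AE x in lebesgue. f x = W2 x + (A + B * x)"
    by eventually_elim (simp add: p_def g_def)
  moreover have "primitive_on UNIV (\<lambda>x. A + B * x) (\<lambda>x. B)"
    by (rule primitive_on_UNIV_of_derivative) (auto intro!: derivative_eq_intros)
  then have "primitive_on UNIV (\<lambda>x. W2 x + (A + B * x)) (\<lambda>x. W1 x + B)"
    by (rule primitive_on_add[OF W2])
  moreover have "primitive_on UNIV (\<lambda>x. W1 x + B) w"
    using W1 by (auto simp: primitive_on_def)
  ultimately show thesis using that by blast
qed

section \<open>Regularity of eigenfunctions\<close>

lemma L2_mult_integrable: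
  assumes "f \<in> L2" "g \<in> L2"
  shows "integrable lebesgue (\<lambda>x. f x * cnj (g x))"
proof (rule Bochner_Integration.integrable_bound)
  show "integrable lebesgue (\<lambda>x. (cmod (f x))\<^sup>2 + (cmod (g x))\<^sup>2)"
    using assms by (auto simp: L2_def)
  show "(\<lambda>x. f x * cnj (g x)) \<in> borel_measurable lebesgue"
    using assms by (intro borel_measurable_times borel_measurable_continuous_on[of cnj])
      (auto simp: L2_def intro: continuous_intros)
  show "AE x in lebesgue. norm (f x * cnj (g x)) \<le> norm ((cmod (f x))\<^sup>2 + (cmod (g x))\<^sup>2)"
  proof (rule AE_I2)
    fix x
    have "0 \<le> (cmod (f x) - cmod (g x))\<^sup>2" by simp
    then have "2 * (cmod (f x) * cmod (g x)) \<le> (cmod (f x))\<^sup>2 + (cmod (g x))\<^sup>2"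
      by (simp add: power2_diff)
    moreover have "0 \<le> cmod (f x) * cmod (g x)" by simp
    ultimately have "cmod (f x) * cmod (g x) \<le> (cmod (f x))\<^sup>2 + (cmod (g x))\<^sup>2" by linarith
    then show "norm (f x * cnj (g x)) \<le> norm ((cmod (f x))\<^sup>2 + (cmod (g x))\<^sup>2)"
      by (simp add: norm_mult)
  qed
qed

lemma L2_Re_absolutely_integrable:
  assumes "f \<in> L2"
  shows "(\<lambda>x. Re (f x)) absolutely_integrable_on {a..b}"
proof (rule measurable_bounded_by_integrable_imp_absolutely_integrable)
  show "(\<lambda>x. Re (f x)) \<in> borel_measurable (lebesgue_on {a..b})"
    using assms by (auto simp: L2_def intro!: measurable_restrict_space1)
  have "(\<lambda>x. (cmod (f x))\<^sup>2) absolutely_integrable_on {a..b}"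
    using assms by (intro integrable_imp_absolutely_integrable_on) (auto simp: L2_def)
  then show "(\<lambda>x. 1 + (cmod (f x))\<^sup>2) integrable_on {a..b}"
    by (intro integrable_add set_lebesgue_integral_eq_integral(1)) auto
  fix x assume "x \<in> {a..b}"
  have "0 \<le> (cmod (f x) - 1)\<^sup>2" by simp
  then have "2 * cmod (f x) \<le> 1 + (cmod (f x))\<^sup>2" by (simp add: power2_diff)
  moreover have "\<bar>Re (f x)\<bar> \<le> cmod (f x)" by (rule abs_Re_le_cmod)
  ultimately show "norm (Re (f x)) \<le> 1 + (cmod (f x))\<^sup>2" using norm_ge_zero[of "f x"] by simp
qed auto

text \<open>As H equals its adjoint, pairing the eigenfunction with H u for a test function u gives
  the eigenvalue equation in weak form. Since V and m are real, real test functions isolate the real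
  part.\<close>

lemma eigenfunction_Re_regular:
  assumes H: "is_schrodinger_operator V H" and \<phi>: "(\<phi>, \<lambda>x. of_real m * \<phi> x) \<in> H"
    and V: "V \<in> borel_measurable lebesgue" "\<And>r. \<exists>M. \<forall>x\<in>{-r..r}. \<bar>V x\<bar> \<le> M"
  shows "\<exists>F F'. primitive_on UNIV F F' \<and> primitive_on UNIV F' (\<lambda>x. (V x - m) * F x) \<and>
    (AE x in lebesgue. Re (\<phi> x) = F x)"
proof -
  have sa: "H \<subseteq> L2 \<times> L2" "L2_adjoint H = H"
    using H by (auto simp: is_schrodinger_operator_def self_adjoint_def L2_operator_def)
  have L2: "\<phi> \<in> L2" "(\<lambda>x. of_real m * \<phi> x) \<in> L2" using sa(1) \<phi> by auto
  define f where "f x = Re (\<phi> x)" for x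
  have f: "f absolutely_integrable_on {-r..r}" for r
    unfolding f_def by (rule L2_Re_absolutely_integrable[OF L2(1)])
  have Vf: "(\<lambda>x. V x * f x) absolutely_integrable_on {-r..r}" for r
  proof (rule absolutely_integrable_bounded_measurable_product_real)
    show "V \<in> borel_measurable (lebesgue_on {-r..r})" using V(1) by (auto intro: measurable_restrict_space1)
    show "bounded (V ` {-r..r})" using V(2)[of r] by (auto simp: bounded_iff)
  qed (use f in auto)
  have w: "(\<lambda>x. (V x - m) * f x) absolutely_integrable_on {-r..r}" for r
  proof -
    have "(\<lambda>x. V x * f x - m * f x) absolutely_integrable_on {-r..r}"
      using f by (intro set_integral_diff Vf) auto
    then show ?thesis by (simp add: left_diff_distrib)
  qed
  have "(LINT x|lebesgue. u'' x * f x) = (LINT x|lebesgue. u x * ((V x - m) * f x))"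
    if u: "\<And>x. (u has_real_derivative u' x) (at x)" "\<And>x. (u' has_real_derivative u'' x) (at x)"
        "continuous_on UNIV u''" "(\<lambda>x. complex_of_real (u x)) \<in> schwartz" "0 < R"
        "\<And>x. R \<le> \<bar>x\<bar> \<Longrightarrow> u x = 0 \<and> u' x = 0 \<and> u'' x = 0" for u u' u'' R
  proof -
    define r where "r x = - u'' x + V x * u x" for x
    have "(\<lambda>x. complex_of_real (u x), \<lambda>x. - nth_deriv 2 (\<lambda>x. complex_of_real (u x)) x + of_real (V x) * of_real (u x)) \<in> H"
      using H u(4) unfolding is_schrodinger_operator_def by blast
    then have uH: "(\<lambda>x. complex_of_real (u x), \<lambda>x. complex_of_real (r x)) \<in> H"
      by (simp add: nth_deriv_2_of_real[OF u(1,2)] r_def)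
    have uL2: "(\<lambda>x. complex_of_real (u x)) \<in> L2" "(\<lambda>x. complex_of_real (r x)) \<in> L2" using sa(1) uH by auto
    have "(\<phi>, \<lambda>x. of_real m * \<phi> x) \<in> L2_adjoint H" using \<phi> sa(2) by simp
    then have eq: "L2_inner (\<lambda>x. complex_of_real (r x)) \<phi> = L2_inner (\<lambda>x. complex_of_real (u x)) (\<lambda>x. of_real m * \<phi> x)"
      using uH by (auto simp: L2_adjoint_def)
    have c: "continuous_on S u" "continuous_on S u''" for S
      using u(1) continuous_on_subset[OF u(3)] by (meson DERIV_isCont continuous_at_imp_continuous_on subset_UNIV)+
    have i: "integrable lebesgue (\<lambda>x. u'' x * f x)" "integrable lebesgue (\<lambda>x. u x * (V x * f x))" "integrable lebesgue (\<lambda>x. u x * f x)"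
      using u(6) by (auto intro!: compact_support_product(1)[of R] c f Vf)
    have "Re (L2_inner (\<lambda>x. complex_of_real (r x)) \<phi>) = (LINT x|lebesgue. Re (of_real (r x) * cnj (\<phi> x)))"
      unfolding L2_inner_def by (rule integral_Re[symmetric]) (rule L2_mult_integrable[OF uL2(2) L2(1)])
    also have "\<dots> = (LINT x|lebesgue. u x * (V x * f x) - u'' x * f x)"
      by (simp add: f_def r_def algebra_simps)
    also have "\<dots> = (LINT x|lebesgue. u x * (V x * f x)) - (LINT x|lebesgue. u'' x * f x)"
      using i by simp
    finally have 1: "Re (L2_inner (\<lambda>x. complex_of_real (r x)) \<phi>) = \<dots>" .
    have "Re (L2_inner (\<lambda>x. complex_of_real (u x)) (\<lambda>x. of_real m * \<phi> x))
        = (LINT x|lebesgue. Re (of_real (u x) * cnj (of_real m * \<phi> x)))"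
      unfolding L2_inner_def by (rule integral_Re[symmetric]) (rule L2_mult_integrable[OF uL2(1) L2(2)])
    also have "\<dots> = (LINT x|lebesgue. m * (u x * f x))"
      by (simp add: f_def algebra_simps)
    finally have 2: "Re (L2_inner (\<lambda>x. complex_of_real (u x)) (\<lambda>x. of_real m * \<phi> x)) = m * (LINT x|lebesgue. u x * f x)" by simp
    have "(LINT x|lebesgue. u x * ((V x - m) * f x)) = (LINT x|lebesgue. u x * (V x * f x) - m * (u x * f x))"
      by (simp add: algebra_simps)
    also have "\<dots> = (LINT x|lebesgue. u x * (V x * f x)) - m * (LINT x|lebesgue. u x * f x)"
      using i by simp
    finally show ?thesis using 1 2 eq by simp
  qed
  then obtain F F' where F: "primitive_on UNIV F F'" "primitive_on UNIV F' (\<lambda>x. (V x - m) * f x)"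
    "AE x in lebesgue. f x = F x"
    using du_Bois_Reymond[OF f w] by blast
  have "primitive_on UNIV F' (\<lambda>x. (V x - m) * F x)"
    by (rule primitive_on_cong_AE[OF F(2)]) (use F(3) in \<open>eventually_elim, simp\<close>)
  then show ?thesis using F by (auto simp: f_def)
qed

lemma eigenfunction_regular:
  assumes H: "is_schrodinger_operator V H" and \<phi>: "(\<phi>, \<lambda>x. of_real m * \<phi> x) \<in> H"
    and V: "V \<in> borel_measurable lebesgue" "\<And>r. \<exists>M. \<forall>x\<in>{-r..r}. \<bar>V x\<bar> \<le> M"
  shows "\<exists>p p' s s'. primitive_on UNIV p p' \<and> primitive_on UNIV p' (\<lambda>x. (V x - m) * p x) \<and>
    primitive_on UNIV s s' \<and> primitive_on UNIV s' (\<lambda>x. (V x - m) * s x) \<and>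
    (AE x in lebesgue. \<phi> x = Complex (p x) (s x))"
proof -
  obtain p p' where p: "primitive_on UNIV p p'" "primitive_on UNIV p' (\<lambda>x. (V x - m) * p x)"
    "AE x in lebesgue. Re (\<phi> x) = p x"
    using eigenfunction_Re_regular[OF H \<phi> V] by blast
  have "L2_operator H" using H by (auto simp: is_schrodinger_operator_def self_adjoint_def)
  \<comment> \<open>The imaginary part is the real part of -i \<phi>, which is in the domain by
    linearity. Closure of the graph is formulated for two summands, hence the one with coefficient
    0.\<close>
  then have "(\<lambda>x. - \<i> * \<phi> x + 0 * \<phi> x, \<lambda>x. - \<i> * (of_real m * \<phi> x) + 0 * (of_real m * \<phi> x)) \<in> H"
    using \<phi> unfolding L2_operator_def by blast
  then have "(\<lambda>x. - \<i> * \<phi> x, \<lambda>x. of_real m * (- \<i> * \<phi> x)) \<in> H"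
    by (simp add: mult.left_commute)
  from eigenfunction_Re_regular[OF H this V]
  obtain s s' where s: "primitive_on UNIV s s'" "primitive_on UNIV s' (\<lambda>x. (V x - m) * s x)"
    "AE x in lebesgue. Im (\<phi> x) = s x"
    by auto
  have "AE x in lebesgue. \<phi> x = Complex (p x) (s x)"
    using p(3) s(3) by eventually_elim (simp add: complex_eq_iff)
  then show ?thesis using p s by blast
qed

section \<open>Finite sums of square-integrable functions\<close>

lemma L2_cmult: "f \<in> L2 \<Longrightarrow> (\<lambda>x. c * f x) \<in> L2"
  by (auto simp: L2_def norm_mult power_mult_distrib)

lemma L2_add:
  assumes "f \<in> L2" "g \<in> L2"
  shows "(\<lambda>x. f x + g x) \<in> L2"
proof -
  have m: "f \<in> borel_measurable lebesgue" "g \<in> borel_measurable lebesgue" using assms by (auto simp: L2_def)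
  have "integrable lebesgue (\<lambda>x. (cmod (f x + g x))\<^sup>2)"
  proof (rule Bochner_Integration.integrable_bound)
    show "integrable lebesgue (\<lambda>x. 2 * (cmod (f x))\<^sup>2 + 2 * (cmod (g x))\<^sup>2)"
      using assms by (auto simp: L2_def)
    show "(\<lambda>x. (cmod (f x + g x))\<^sup>2) \<in> borel_measurable lebesgue"
      using m by simp
    show "AE x in lebesgue. norm ((cmod (f x + g x))\<^sup>2) \<le> norm (2 * (cmod (f x))\<^sup>2 + 2 * (cmod (g x))\<^sup>2)"
    proof (rule AE_I2)
      fix x
      have "(cmod (f x + g x))\<^sup>2 \<le> (cmod (f x) + cmod (g x))\<^sup>2"
        by (intro power_mono norm_triangle_ineq) auto
      also have "\<dots> \<le> 2 * (cmod (f x))\<^sup>2 + 2 * (cmod (g x))\<^sup>2"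
        using sum_squares_bound[of "cmod (f x)" "cmod (g x)"] by (simp add: power2_sum)
      finally show "norm ((cmod (f x + g x))\<^sup>2) \<le> norm (2 * (cmod (f x))\<^sup>2 + 2 * (cmod (g x))\<^sup>2)" by simp
    qed
  qed
  then show ?thesis using m by (simp add: L2_def)
qed

lemma L2_sum:
  assumes "\<And>k. k \<in> K \<Longrightarrow> f k \<in> L2"
  shows "(\<lambda>x. \<Sum>k\<in>K. f k x) \<in> L2"
  using assms
proof (induction K rule: infinite_finite_induct)
  case (insert k K)
  then show ?case using L2_add[of "f k" "\<lambda>x. \<Sum>k\<in>K. f k x"] by simp
qed (auto simp: L2_def)

lemma L2_inner_sums:
  assumes \<phi>: "orthonormal_basis \<phi>" and K: "finite K"
  shows "L2_inner (\<lambda>x. \<Sum>k\<in>K. a k * \<phi> k x) (\<lambda>x. \<Sum>k\<in>K. b k * \<phi> k x) = (\<Sum>k\<in>K. a k * cnj (b k))"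
proof -
  have L2: "\<phi> k \<in> L2" and on: "L2_inner (\<phi> j) (\<phi> k) = (if j = k then 1 else 0)" for j k
    using \<phi> by (auto simp: orthonormal_basis_def)
  have i: "integrable lebesgue (\<lambda>x. a j * cnj (b k) * (\<phi> j x * cnj (\<phi> k x)))" for j k
    by (intro integrable_mult_right L2_mult_integrable L2)
  have "L2_inner (\<lambda>x. \<Sum>k\<in>K. a k * \<phi> k x) (\<lambda>x. \<Sum>k\<in>K. b k * \<phi> k x)
      = (LINT x|lebesgue. (\<Sum>j\<in>K. \<Sum>k\<in>K. a j * cnj (b k) * (\<phi> j x * cnj (\<phi> k x))))"
    unfolding L2_inner_def by (simp add: sum_product mult_ac)
  also have "\<dots> = (\<Sum>j\<in>K. \<Sum>k\<in>K. a j * cnj (b k) * L2_inner (\<phi> j) (\<phi> k))"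
    using i by (simp add: L2_inner_def)
  also have "\<dots> = (\<Sum>k\<in>K. a k * cnj (b k))"
    using K by (simp add: on if_distrib[of "\<lambda>t. _ * t"] sum.delta cong: if_cong)
  finally show ?thesis .
qed

section \<open>Spectral functions\<close>

lemma continuous_imp_lebesgue_measurable:
  fixes f :: "real \<Rightarrow> real"
  shows "continuous_on UNIV f \<Longrightarrow> f \<in> borel_measurable lebesgue"
  by (intro measurable_completion) (simp add: borel_measurable_continuous_onI)

lemma integrable_mult_of_squares:
  fixes f g :: "real \<Rightarrow> real"
  assumes "f \<in> borel_measurable lebesgue" "g \<in> borel_measurable lebesgue"
    and "integrable lebesgue (\<lambda>x. (f x)\<^sup>2)" "integrable lebesgue (\<lambda>x. (g x)\<^sup>2)"
  shows "integrable lebesgue (\<lambda>x. f x * g x)"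
proof (rule Bochner_Integration.integrable_bound)
  show "integrable lebesgue (\<lambda>x. (f x)\<^sup>2 + (g x)\<^sup>2)" using assms by simp
  show "(\<lambda>x. f x * g x) \<in> borel_measurable lebesgue" using assms by simp
  show "AE x in lebesgue. norm (f x * g x) \<le> norm ((f x)\<^sup>2 + (g x)\<^sup>2)"
  proof (rule AE_I2)
    fix x
    have "2 * (\<bar>f x\<bar> * \<bar>g x\<bar>) \<le> (f x)\<^sup>2 + (g x)\<^sup>2"
      using sum_squares_bound[of "\<bar>f x\<bar>" "\<bar>g x\<bar>"] by simp
    moreover have "0 \<le> \<bar>f x\<bar> * \<bar>g x\<bar>" by simp
    ultimately have "\<bar>f x\<bar> * \<bar>g x\<bar> \<le> (f x)\<^sup>2 + (g x)\<^sup>2" by linarith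
    then show "norm (f x * g x) \<le> norm ((f x)\<^sup>2 + (g x)\<^sup>2)" by (simp add: abs_mult)
  qed
qed

text \<open>\<open>p k\<close> and \<open>s k\<close> are continuous representatives of the real and
  imaginary parts of the eigenfunctions. The differential equation is used for these, orthonormality
  for \<phi>.\<close>

locale real_eigenbasis =
  fixes V :: "real \<Rightarrow> real" and \<phi> :: "nat \<Rightarrow> real \<Rightarrow> complex" and \<mu> :: "nat \<Rightarrow> real"
    and p p' s s' :: "nat \<Rightarrow> real \<Rightarrow> real"
  assumes V: "\<And>x. 0 \<le> V x"
    and basis: "orthonormal_basis \<phi>"
    and p: "\<And>k. primitive_on UNIV (p k) (p' k)" "\<And>k. primitive_on UNIV (p' k) (\<lambda>x. (V x - (\<mu> k)\<^sup>2) * p k x)"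
    and s: "\<And>k. primitive_on UNIV (s k) (s' k)" "\<And>k. primitive_on UNIV (s' k) (\<lambda>x. (V x - (\<mu> k)\<^sup>2) * s k x)"
    and \<phi>: "\<And>k. AE x in lebesgue. \<phi> k x = Complex (p k x) (s k x)"
begin

text \<open>The continuous representative of the real part of \<open>B K b\<close>.\<close>

definition U :: "nat set \<Rightarrow> (nat \<Rightarrow> complex) \<Rightarrow> real \<Rightarrow> real" where
  "U K b x = (\<Sum>k\<in>K. Re (b k) * p k x - Im (b k) * s k x)"

definition U' :: "nat set \<Rightarrow> (nat \<Rightarrow> complex) \<Rightarrow> real \<Rightarrow> real" where
  "U' K b x = (\<Sum>k\<in>K. Re (b k) * p' k x - Im (b k) * s' k x)"

definition B :: "nat set \<Rightarrow> (nat \<Rightarrow> complex) \<Rightarrow> real \<Rightarrow> complex" where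
  "B K b x = (\<Sum>k\<in>K. b k * \<phi> k x)"

(* Multiplication by -i turns imaginary parts into real parts: U K (rot b) is the imaginary part of B K b. *)
definition rot :: "(nat \<Rightarrow> complex) \<Rightarrow> nat \<Rightarrow> complex" where
  "rot b k = - \<i> * b k"

text \<open>The coefficients after one application of the Schroedinger operator.\<close>

definition eig :: "(nat \<Rightarrow> complex) \<Rightarrow> nat \<Rightarrow> complex" where
  "eig b k = of_real ((\<mu> k)\<^sup>2) * b k"

lemma rot_eig: "rot (eig b) = eig (rot b)"
  by (simp add: rot_def eig_def fun_eq_iff)

lemma U_deriv: "primitive_on UNIV (U K b) (U' K b)"
  unfolding U_def U'_def by (intro primitive_on_sum primitive_on_diff primitive_on_cmult p s)

lemma U'_deriv: "primitive_on UNIV (U' K b) (\<lambda>x. V x * U K b x - U K (eig b) x)"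
proof (rule primitive_on_cong)
  show "primitive_on UNIV (U' K b) (\<lambda>x. \<Sum>k\<in>K. Re (b k) * ((V x - (\<mu> k)\<^sup>2) * p k x)
      - Im (b k) * ((V x - (\<mu> k)\<^sup>2) * s k x))"
    unfolding U'_def by (intro primitive_on_sum primitive_on_diff primitive_on_cmult p s)
  show "(\<Sum>k\<in>K. Re (b k) * ((V x - (\<mu> k)\<^sup>2) * p k x) - Im (b k) * ((V x - (\<mu> k)\<^sup>2) * s k x))
      = V x * U K b x - U K (eig b) x" for x
    unfolding U_def sum_distrib_left sum_subtractf[symmetric]
    by (rule sum.cong) (simp_all add: eig_def algebra_simps)
qed simp

lemmas U_continuous = primitive_on_UNIV_continuous[OF U_deriv]
lemmas U'_continuous = primitive_on_UNIV_continuous[OF U'_deriv]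

lemma U_uminus: "U K (\<lambda>k. - b k) x = - U K b x"
  unfolding U_def sum_negf[symmetric] by (rule sum.cong) auto

lemma B_AE: "AE x in lebesgue. B K b x = Complex (U K b x) (U K (rot b) x)"
proof -
  have "AE x in lebesgue. \<forall>k. \<phi> k x = Complex (p k x) (s k x)"
    using \<phi> by (simp add: AE_all_countable)
  then show ?thesis
    by eventually_elim (simp add: complex_eq_iff B_def U_def rot_def Re_sum Im_sum add.commute)
qed

lemma B_L2: "B K b \<in> L2"
  unfolding B_def by (intro L2_sum L2_cmult) (use basis in \<open>auto simp: orthonormal_basis_def\<close>)

lemma square_integrable: "integrable lebesgue (\<lambda>x. (U K b x)\<^sup>2)"
proof (rule Bochner_Integration.integrable_bound)
  show "integrable lebesgue (\<lambda>x. (cmod (B K b x))\<^sup>2)" using B_L2 by (auto simp: L2_def)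
  show "AE x in lebesgue. norm ((U K b x)\<^sup>2) \<le> norm ((cmod (B K b x))\<^sup>2)"
    using B_AE[of K b] by eventually_elim (simp add: cmod_power2)
  show "(\<lambda>x. (U K b x)\<^sup>2) \<in> borel_measurable lebesgue"
    by (intro continuous_imp_lebesgue_measurable continuous_intros U_continuous)
qed

lemma integrable_products: "integrable lebesgue (\<lambda>x. U K b x * U K c x)"
  by (intro integrable_mult_of_squares continuous_imp_lebesgue_measurable U_continuous square_integrable)

text \<open>The real part of the complex inner product. Real and imaginary parts are treated
  together because \<open>p k\<close> and \<open>s k\<close> need not be orthogonal families by
  themselves.\<close>

lemma inner_eq_sum:
  assumes "finite K"
  shows "(LINT x|lebesgue. U K b x * U K c x) + (LINT x|lebesgue. U K (rot b) x * U K (rot c) x)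
    = Re (\<Sum>k\<in>K. b k * cnj (c k))"
proof -
  have "Re (\<Sum>k\<in>K. b k * cnj (c k)) = Re (L2_inner (B K b) (B K c))"
    using L2_inner_sums[OF basis assms, of b c] by (simp add: B_def[abs_def])
  also have "\<dots> = (LINT x|lebesgue. Re (B K b x * cnj (B K c x)))"
    unfolding L2_inner_def by (rule integral_Re[symmetric]) (rule L2_mult_integrable[OF B_L2 B_L2])
  also have "\<dots> = (LINT x|lebesgue. U K b x * U K c x + U K (rot b) x * U K (rot c) x)"
  proof (rule integral_cong_AE)
    show "(\<lambda>x. Re (B K b x * cnj (B K c x))) \<in> borel_measurable lebesgue"
      using integrable_Re[OF L2_mult_integrable[OF B_L2 B_L2, of K b K c]] by auto
    show "(\<lambda>x. U K b x * U K c x + U K (rot b) x * U K (rot c) x) \<in> borel_measurable lebesgue"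
      by (intro continuous_imp_lebesgue_measurable continuous_intros U_continuous)
    show "AE x in lebesgue. Re (B K b x * cnj (B K c x)) = U K b x * U K c x + U K (rot b) x * U K (rot c) x"
      using B_AE[of K b] B_AE[of K c] by eventually_elim simp
  qed
  finally show ?thesis using integrable_products by simp
qed

lemma norm_eq_sum:
  assumes "finite K"
  shows "(LINT x|lebesgue. (U K b x)\<^sup>2) + (LINT x|lebesgue. (U K (rot b) x)\<^sup>2) = (\<Sum>k\<in>K. (cmod (b k))\<^sup>2)"
  using inner_eq_sum[OF assms, of b b]
  by (simp add: power2_eq_square[symmetric] Re_sum complex_norm_square[symmetric] flip: of_real_power)

lemma square_integrable_on:
  "(\<lambda>x. (U K b x)\<^sup>2) integrable_on {x..y}" "(\<lambda>x. (U' K b x)\<^sup>2) integrable_on {x..y}"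
  by (intro integrable_continuous_real continuous_intros
      continuous_on_subset[OF U_continuous] continuous_on_subset[OF U'_continuous] subset_UNIV)+

text \<open>V times \<open>U K b\<close> is the derivative of \<open>U' K b\<close> plus a
  continuous function, and integrability of that derivative is part of
  \<open>primitive_on\<close>.\<close>

lemma V_square_integrable_on: "(\<lambda>x. V x * (U K b x)\<^sup>2) integrable_on {x..y}"
proof -
  have c: "continuous_on {x..y} (U K b)" for b by (rule continuous_on_subset[OF U_continuous]) simp
  have "(\<lambda>x. (V x * U K b x - U K (eig b) x) * U K b x + U K (eig b) x * U K b x) absolutely_integrable_on {x..y}"
    by (intro set_integral_add absolutely_integrable_continuous_mult(2) primitive_on_absolutely_integrable[OF U'_deriv]
        absolutely_integrable_continuous_real continuous_on_mult c) simp
  then show ?thesis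
    by (intro set_lebesgue_integral_eq_integral(1)) (simp add: algebra_simps power2_eq_square)
qed

lemma energy_le:
  assumes K: "finite K" "\<And>k. k \<in> K \<Longrightarrow> \<bar>\<mu> k\<bar> \<le> \<Lambda>"
  shows "(integral {-X..X} (\<lambda>x. (U' K b x)\<^sup>2) + integral {-X..X} (\<lambda>x. V x * (U K b x)\<^sup>2)) +
      (integral {-X..X} (\<lambda>x. (U' K (rot b) x)\<^sup>2) + integral {-X..X} (\<lambda>x. V x * (U K (rot b) x)\<^sup>2))
    \<le> \<Lambda>\<^sup>2 * (\<Sum>k\<in>K. (cmod (b k))\<^sup>2)"
proof -
  have e: "integral {-X..X} (\<lambda>x. (U' K b x)\<^sup>2) + integral {-X..X} (\<lambda>x. V x * (U K b x)\<^sup>2)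
      \<le> (LINT x|lebesgue. U K b x * U K (eig b) x)" for b
    unfolding integral_add[OF square_integrable_on(2) V_square_integrable_on, symmetric]
    by (intro energy_inequality U_deriv U'_deriv V square_integrable integrable_products)
  have "(LINT x|lebesgue. U K b x * U K (eig b) x) + (LINT x|lebesgue. U K (rot b) x * U K (eig (rot b)) x)
      = Re (\<Sum>k\<in>K. b k * cnj (eig b k))"
    using inner_eq_sum[OF K(1), of b "eig b"] by (simp add: rot_eig)
  also have "\<dots> = (\<Sum>k\<in>K. (\<mu> k)\<^sup>2 * (cmod (b k))\<^sup>2)"
    unfolding Re_sum
  proof (rule sum.cong[OF refl])
    fix k
    have "b k * cnj (eig b k) = of_real ((\<mu> k)\<^sup>2) * (b k * cnj (b k))" by (simp add: eig_def mult_ac)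
    also have "\<dots> = of_real ((\<mu> k)\<^sup>2 * (cmod (b k))\<^sup>2)" unfolding complex_norm_square[symmetric] by simp
    finally show "Re (b k * cnj (eig b k)) = (\<mu> k)\<^sup>2 * (cmod (b k))\<^sup>2" by (simp only: Re_complex_of_real)
  qed
  also have "\<dots> \<le> (\<Sum>k\<in>K. \<Lambda>\<^sup>2 * (cmod (b k))\<^sup>2)"
  proof (intro sum_mono mult_right_mono)
    fix k assume "k \<in> K"
    then have "\<bar>\<mu> k\<bar> \<le> \<bar>\<Lambda>\<bar>" using K(2)[of k] by linarith
    then show "(\<mu> k)\<^sup>2 \<le> \<Lambda>\<^sup>2" by (simp add: abs_le_square_iff)
  qed auto
  finally show ?thesis using e[of b] e[of "rot b"] by (simp add: sum_distrib_left)
qed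

lemma energy_bounds:
  assumes K: "finite K" "\<And>k. k \<in> K \<Longrightarrow> \<bar>\<mu> k\<bar> \<le> \<Lambda>"
  shows "integral {-X..X} (\<lambda>x. V x * (U K b x)\<^sup>2) + integral {-X..X} (\<lambda>x. V x * (U K (rot b) x)\<^sup>2)
      \<le> \<Lambda>\<^sup>2 * (\<Sum>k\<in>K. (cmod (b k))\<^sup>2)"
    and "integral {-X..X} (\<lambda>x. (U' K b x)\<^sup>2) + integral {-X..X} (\<lambda>x. (U' K (rot b) x)\<^sup>2)
      \<le> \<Lambda>\<^sup>2 * (\<Sum>k\<in>K. (cmod (b k))\<^sup>2)"
proof -
  have "0 \<le> integral {-X..X} (\<lambda>x. (U' K b x)\<^sup>2)" "0 \<le> integral {-X..X} (\<lambda>x. V x * (U K b x)\<^sup>2)" for b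
    using V by (auto intro!: integral_nonneg square_integrable_on V_square_integrable_on)
  note n = this[of b] this[of "rot b"]
  show "integral {-X..X} (\<lambda>x. V x * (U K b x)\<^sup>2) + integral {-X..X} (\<lambda>x. V x * (U K (rot b) x)\<^sup>2)
      \<le> \<Lambda>\<^sup>2 * (\<Sum>k\<in>K. (cmod (b k))\<^sup>2)"
    "integral {-X..X} (\<lambda>x. (U' K b x)\<^sup>2) + integral {-X..X} (\<lambda>x. (U' K (rot b) x)\<^sup>2)
      \<le> \<Lambda>\<^sup>2 * (\<Sum>k\<in>K. (cmod (b k))\<^sup>2)"
    using energy_le[OF K, of X b] n by linarith+
qed

text \<open>The local Sobolev inequality, with the total norm for U and the energy for U'. A factor
  3 would result; 4 is preferred because it is a square.\<close>

lemma sup_bound: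
  assumes K: "finite K" "\<And>k. k \<in> K \<Longrightarrow> \<bar>\<mu> k\<bar> \<le> \<Lambda>" and \<Lambda>: "1 \<le> \<Lambda>"
  shows "(U K b x)\<^sup>2 + (U K (rot b) x)\<^sup>2 \<le> 4 * \<Lambda>\<^sup>2 * (\<Sum>k\<in>K. (cmod (b k))\<^sup>2)"
proof -
  define N where "N = (\<Sum>k\<in>K. (cmod (b k))\<^sup>2)"
  have N: "0 \<le> N" by (auto simp: N_def intro: sum_nonneg)
  define X where "X = \<bar>x\<bar> + 1"
  have 1: "(U K b x)\<^sup>2 \<le> 2 * (LINT x|lebesgue. (U K b x)\<^sup>2) + integral {-X..X} (\<lambda>t. (U' K b t)\<^sup>2)" for b
  proof -
    have "integral {x..x + 1} (\<lambda>t. (U K b t)\<^sup>2) \<le> (LINT x|lebesgue. (U K b x)\<^sup>2)"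
      by (intro integral_le_lebesgue_integral square_integrable) auto
    moreover have "integral {x..x + 1} (\<lambda>t. (U' K b t)\<^sup>2) \<le> integral {-X..X} (\<lambda>t. (U' K b t)\<^sup>2)"
      by (intro integral_subset_le square_integrable_on) (auto simp: X_def)
    ultimately show ?thesis using pointwise_le_local_norms[OF U_deriv U'_continuous, of K b x] by linarith
  qed
  have "(U K b x)\<^sup>2 + (U K (rot b) x)\<^sup>2 \<le> 2 * N + \<Lambda>\<^sup>2 * N"
    using 1[of b] 1[of "rot b"] norm_eq_sum[OF K(1), of b] energy_bounds(2)[OF K, of X b]
    unfolding N_def by linarith
  also have "1 * N \<le> \<Lambda>\<^sup>2 * N" using \<Lambda> N by (intro mult_right_mono) auto
  then have "2 * N + \<Lambda>\<^sup>2 * N \<le> 4 * \<Lambda>\<^sup>2 * N" using N by linarith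
  finally show ?thesis by (simp add: N_def)
qed

lemma spectral_data:
  assumes f: "f \<in> L2_span \<phi> {k. \<mu> k \<le> l}" and l: "l \<le> \<Lambda>" "1 \<le> \<Lambda>" and \<mu>: "\<And>k. 0 \<le> \<mu> k"
  obtains u u' v v' :: "nat \<Rightarrow> real \<Rightarrow> real" where
    "\<And>j. primitive_on UNIV (u j) (u' j)" "\<And>j. primitive_on UNIV (u' j) (\<lambda>x. V x * u j x + u (Suc j) x)"
    "\<And>j. primitive_on UNIV (v j) (v' j)" "\<And>j. primitive_on UNIV (v' j) (\<lambda>x. V x * v j x + v (Suc j) x)"
    "AE x in lebesgue. f x = Complex (u 0 x) (v 0 x)"
    "integrable lebesgue (\<lambda>x. (u 0 x)\<^sup>2 + (v 0 x)\<^sup>2)"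
    "(LINT x|lebesgue. (u 0 x)\<^sup>2 + (v 0 x)\<^sup>2) = (L2_norm_on UNIV f)\<^sup>2"
    "\<And>j x. \<bar>u j x\<bar> \<le> 2 * \<Lambda> * L2_norm_on UNIV f * \<Lambda> ^ (2 * j)"
    "\<And>j x. \<bar>v j x\<bar> \<le> 2 * \<Lambda> * L2_norm_on UNIV f * \<Lambda> ^ (2 * j)"
    "\<And>X. (\<lambda>x. V x * ((u 0 x)\<^sup>2 + (v 0 x)\<^sup>2)) integrable_on {-X..X}"
    "\<And>X. integral {-X..X} (\<lambda>x. V x * ((u 0 x)\<^sup>2 + (v 0 x)\<^sup>2)) \<le> \<Lambda>\<^sup>2 * (L2_norm_on UNIV f)\<^sup>2"
proof -
  obtain K a where K: "finite K" "K \<subseteq> {k. \<mu> k \<le> l}" and fa: "AE x in lebesgue. f x = B K a x" and fL2: "f \<in> L2"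
    using f by (auto simp: L2_span_def B_def)
  have K\<Lambda>: "\<bar>\<mu> k\<bar> \<le> \<Lambda>" if "k \<in> K" for k using that K(2) l \<mu>[of k] by auto
  \<comment> \<open>As u'' = V u - U (eig b), each application of d^2/dx^2 - V multiplies the k-th
    coefficient by minus the square of \<open>\<mu> k\<close>.\<close>
  define b where "b j k = of_real (- (\<mu> k)\<^sup>2) ^ j * a k" for j k
  have b0: "b 0 = a" and bS: "b (Suc j) = (\<lambda>k. - eig (b j) k)" for j
    by (auto simp: b_def eig_def mult.assoc)
  define N where "N = L2_norm_on UNIV f"
  have AE: "AE x in lebesgue. f x = Complex (U K a x) (U K (rot a) x)"
    using fa B_AE[of K a] by eventually_elim simp
  have int: "integrable lebesgue (\<lambda>x. (U K a x)\<^sup>2 + (U K (rot a) x)\<^sup>2)" using square_integrable by simp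
  have N0: "0 \<le> N" by (auto simp: N_def L2_norm_on_def set_lebesgue_integral_def)
  have N: "(LINT x|lebesgue. (U K a x)\<^sup>2 + (U K (rot a) x)\<^sup>2) = N\<^sup>2"
  proof -
    have "(LINT x|lebesgue. (cmod (f x))\<^sup>2) = (LINT x|lebesgue. (U K a x)\<^sup>2 + (U K (rot a) x)\<^sup>2)"
    proof (rule integral_cong_AE)
      show "(\<lambda>x. (cmod (f x))\<^sup>2) \<in> borel_measurable lebesgue" using fL2 by (auto simp: L2_def)
      show "AE x in lebesgue. (cmod (f x))\<^sup>2 = (U K a x)\<^sup>2 + (U K (rot a) x)\<^sup>2"
        using AE by eventually_elim (simp add: cmod_power2)
    qed (use int in auto)
    then show ?thesis by (simp add: N_def L2_norm_on_def set_lebesgue_integral_def)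
  qed
  have Na: "N\<^sup>2 = (\<Sum>k\<in>K. (cmod (a k))\<^sup>2)"
    using N norm_eq_sum[OF K(1), of a] square_integrable by simp
  have sup: "\<bar>U K (b j) x\<bar> \<le> 2 * \<Lambda> * N * \<Lambda> ^ (2 * j)" "\<bar>U K (rot (b j)) x\<bar> \<le> 2 * \<Lambda> * N * \<Lambda> ^ (2 * j)" for j x
  proof -
    have "(\<Sum>k\<in>K. (cmod (b j k))\<^sup>2) \<le> (\<Sum>k\<in>K. (\<Lambda> ^ (2 * j) * cmod (a k))\<^sup>2)"
    proof (intro sum_mono power_mono)
      fix k assume k: "k \<in> K"
      have "cmod (b j k) = \<bar>\<mu> k\<bar> ^ (2 * j) * cmod (a k)"
        by (simp add: b_def norm_mult norm_power power_mult)
      also have "\<dots> \<le> \<Lambda> ^ (2 * j) * cmod (a k)"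
        using K\<Lambda>[OF k] by (intro mult_right_mono power_mono) auto
      finally show "cmod (b j k) \<le> \<Lambda> ^ (2 * j) * cmod (a k)" .
    qed auto
    also have "\<dots> = (\<Lambda> ^ (2 * j))\<^sup>2 * N\<^sup>2" by (simp add: Na sum_distrib_left power_mult_distrib)
    finally have "4 * \<Lambda>\<^sup>2 * (\<Sum>k\<in>K. (cmod (b j k))\<^sup>2) \<le> 4 * \<Lambda>\<^sup>2 * ((\<Lambda> ^ (2 * j))\<^sup>2 * N\<^sup>2)"
      by (intro mult_left_mono) auto
    also have "\<dots> = (2 * \<Lambda> * N * \<Lambda> ^ (2 * j))\<^sup>2" by (simp add: power_mult_distrib mult_ac)
    finally have "(U K (b j) x)\<^sup>2 \<le> (2 * \<Lambda> * N * \<Lambda> ^ (2 * j))\<^sup>2" "(U K (rot (b j)) x)\<^sup>2 \<le> (2 * \<Lambda> * N * \<Lambda> ^ (2 * j))\<^sup>2"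
      using sup_bound[OF K(1) K\<Lambda> l(2), of "b j" x] zero_le_power2[of "U K (b j) x"]
        zero_le_power2[of "U K (rot (b j)) x"] by linarith+
    moreover have "0 \<le> 2 * \<Lambda> * N * \<Lambda> ^ (2 * j)" using N0 l by simp
    ultimately show "\<bar>U K (b j) x\<bar> \<le> 2 * \<Lambda> * N * \<Lambda> ^ (2 * j)" "\<bar>U K (rot (b j)) x\<bar> \<le> 2 * \<Lambda> * N * \<Lambda> ^ (2 * j)"
      by (simp_all only: abs_le_square_iff[symmetric] abs_of_nonneg)
  qed
  have iV: "(\<lambda>x. V x * ((U K a x)\<^sup>2 + (U K (rot a) x)\<^sup>2)) integrable_on {-X..X}" for X
    unfolding distrib_left by (intro integrable_add V_square_integrable_on)
  have e: "integral {-X..X} (\<lambda>x. V x * ((U K a x)\<^sup>2 + (U K (rot a) x)\<^sup>2)) \<le> \<Lambda>\<^sup>2 * N\<^sup>2" for X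
    unfolding Na distrib_left integral_add[OF V_square_integrable_on V_square_integrable_on]
    by (rule energy_bounds(1)[OF K(1) K\<Lambda>])
  have U: "primitive_on UNIV (U' K (b j)) (\<lambda>x. V x * U K (b j) x + U K (b (Suc j)) x)" for j
    using U'_deriv[of K "b j"] by (simp add: bS U_uminus)
  have "rot (b (Suc j)) = (\<lambda>k. - eig (rot (b j)) k)" for j
    by (auto simp: bS rot_def eig_def)
  then have S: "primitive_on UNIV (U' K (rot (b j))) (\<lambda>x. V x * U K (rot (b j)) x + U K (rot (b (Suc j))) x)" for j
    using U'_deriv[of K "rot (b j)"] by (simp add: U_uminus)
  show thesis
    by (rule that[of "\<lambda>j. U K (b j)" "\<lambda>j. U' K (b j)" "\<lambda>j. U K (rot (b j))" "\<lambda>j. U' K (rot (b j))"];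
        (unfold b0 N_def[symmetric])?; (fact U_deriv U S AE int N sup iV e))
qed

end

lemma spectral_subspace_data:
  fixes V :: "real \<Rightarrow> real"
  assumes H: "is_schrodinger_operator V H" and E: "is_eigenbasis H \<phi> \<mu>"
    and V: "V \<in> borel_measurable lebesgue" "\<And>r. \<exists>M. \<forall>x\<in>{-r..r}. \<bar>V x\<bar> \<le> M" "\<And>x. 0 \<le> V x"
    and f: "f \<in> spectral_subspace \<phi> \<mu> l" and l: "l \<le> \<Lambda>" "1 \<le> \<Lambda>"
  obtains u u' v v' :: "nat \<Rightarrow> real \<Rightarrow> real" where
    "\<And>j. primitive_on UNIV (u j) (u' j)" "\<And>j. primitive_on UNIV (u' j) (\<lambda>x. V x * u j x + u (Suc j) x)"
    "\<And>j. primitive_on UNIV (v j) (v' j)" "\<And>j. primitive_on UNIV (v' j) (\<lambda>x. V x * v j x + v (Suc j) x)"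
    "AE x in lebesgue. f x = Complex (u 0 x) (v 0 x)"
    "integrable lebesgue (\<lambda>x. (u 0 x)\<^sup>2 + (v 0 x)\<^sup>2)"
    "(LINT x|lebesgue. (u 0 x)\<^sup>2 + (v 0 x)\<^sup>2) = (L2_norm_on UNIV f)\<^sup>2"
    "\<And>j x. \<bar>u j x\<bar> \<le> 2 * \<Lambda> * L2_norm_on UNIV f * \<Lambda> ^ (2 * j)"
    "\<And>j x. \<bar>v j x\<bar> \<le> 2 * \<Lambda> * L2_norm_on UNIV f * \<Lambda> ^ (2 * j)"
    "\<And>X. (\<lambda>x. V x * ((u 0 x)\<^sup>2 + (v 0 x)\<^sup>2)) integrable_on {-X..X}"
    "\<And>X. integral {-X..X} (\<lambda>x. V x * ((u 0 x)\<^sup>2 + (v 0 x)\<^sup>2)) \<le> \<Lambda>\<^sup>2 * (L2_norm_on UNIV f)\<^sup>2"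
proof -
  define Q where "Q k p p' s s' \<longleftrightarrow> primitive_on UNIV p p' \<and> primitive_on UNIV p' (\<lambda>x. (V x - (\<mu> k)\<^sup>2) * p x) \<and>
    primitive_on UNIV s s' \<and> primitive_on UNIV s' (\<lambda>x. (V x - (\<mu> k)\<^sup>2) * s x) \<and>
    (AE x in lebesgue. \<phi> k x = Complex (p x) (s x))" for k p p' s s'
  have "\<exists>p p' s s'. Q k p p' s s'" for k
  proof -
    have "(\<phi> k, \<lambda>x. of_real ((\<mu> k)\<^sup>2) * \<phi> k x) \<in> H" using E by (auto simp: is_eigenbasis_def)
    from eigenfunction_regular[OF H this V(1,2)] show ?thesis by (simp only: Q_def)
  qed
  then obtain p p' s s' where Q: "\<And>k. Q k (p k) (p' k) (s k) (s' k)" by metis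
  note ps = Q[unfolded Q_def]
  interpret real_eigenbasis V \<phi> \<mu> p p' s s'
    by unfold_locales (use ps V(3) E in \<open>simp_all add: is_eigenbasis_def\<close>)
  have \<mu>: "0 \<le> \<mu> k" for k
    using E incseqD[of \<mu> 0 k] by (auto simp: is_eigenbasis_def)
  have "f \<in> L2_span \<phi> {k. \<mu> k \<le> l}" using f by (simp add: spectral_subspace_def)
  then show thesis by (rule spectral_data[OF _ l \<mu>]) (fact that)
qed

section \<open>The spectral inequality with explicit parameters\<close>

text \<open>Chebyshev's inequality: q exceeds the threshold on a part of \<Omega> of measure at most
  \<delta> / 2, so half of the guaranteed measure remains.\<close>

lemma exists_large_sublevel_subset:
  fixes q :: "real \<Rightarrow> real"
  assumes q: "integrable lebesgue q" "\<And>x. 0 \<le> q x" and \<Omega>: "\<Omega> \<in> sets lebesgue"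
    and \<delta>: "0 < \<delta>" "\<delta> \<le> measure lebesgue (\<Omega> \<inter> {a..b})"
    and A: "(LINT x|lebesgue. indicator \<Omega> x * q x) \<le> A\<^sup>2" "0 < A"
  obtains E where "E \<in> sets lebesgue" "E \<subseteq> {a..b}" "\<delta> / 2 \<le> measure lebesgue E"
    "\<And>x. x \<in> E \<Longrightarrow> q x \<le> 2 * A\<^sup>2 / \<delta>"
proof -
  define c where "c = 2 * A\<^sup>2 / \<delta>"
  have c: "0 < c" using \<delta> A by (simp add: c_def)
  have qm: "q \<in> borel_measurable lebesgue" using q by auto
  define G where "G = {x. q x \<le> c}"
  have G: "G \<in> sets lebesgue"
    using borel_measurable_le[OF qm borel_measurable_const[of c]] by (simp add: G_def)
  define I where "I = \<Omega> \<inter> {a..b}"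
  have I: "I \<in> lmeasurable"
    unfolding I_def
    by (rule bounded_set_imp_lmeasurable[OF bounded_subset[OF bounded_closed_interval Int_lower2]])
      (intro sets.Int \<Omega>, simp)
  have IG: "I \<inter> G \<in> lmeasurable" "I - G \<in> lmeasurable"
    by (rule fmeasurable_Int_fmeasurable[OF I G], rule fmeasurable_Diff[OF I G])
  have "c * measure lebesgue (I - G) = (LINT x|lebesgue. c * indicator (I - G) x)"
    using IG(2) by simp
  also have "\<dots> \<le> (LINT x|lebesgue. indicator \<Omega> x * q x)"
  proof (rule integral_mono)
    show "integrable lebesgue (\<lambda>x. c * indicator (I - G) x)"
      using IG(2) by (intro integrable_mult_right) (auto simp: fmeasurable_def)
    show "integrable lebesgue (\<lambda>x. indicator \<Omega> x * q x)"
      using integrable_mult_indicator[OF \<Omega> q(1)] by simp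
    fix x show "c * indicator (I - G) x \<le> indicator \<Omega> x * q x"
      using q(2)[of x] by (auto simp: indicator_def I_def G_def)
  qed
  also have "\<dots> \<le> c * (\<delta> / 2)" using A \<delta> by (simp add: c_def)
  finally have small: "measure lebesgue (I - G) \<le> \<delta> / 2" using c by simp
  have "I = (I \<inter> G) \<union> (I - G)" by auto
  then have "measure lebesgue I \<le> measure lebesgue (I \<inter> G) + measure lebesgue (I - G)"
    using measure_Un_le[OF fmeasurableD[OF IG(1)] fmeasurableD[OF IG(2)]] by simp
  then have "\<delta> / 2 \<le> measure lebesgue (I \<inter> G)" using \<delta>(2) small by (simp add: I_def)
  show thesis
  proof (rule that[of "I \<inter> G"])
    show "I \<inter> G \<in> sets lebesgue" by (rule fmeasurableD[OF IG(1)])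
    show "I \<inter> G \<subseteq> {a..b}" by (auto simp: I_def)
    show "\<delta> / 2 \<le> measure lebesgue (I \<inter> G)" by fact
    show "q x \<le> 2 * A\<^sup>2 / \<delta>" if "x \<in> I \<inter> G" for x using that by (simp add: G_def c_def)
  qed
qed

text \<open>The factor 12 sqrt X comes from the passage from pointwise values on {-X..X} to the norm
  and from absorbing half of the norm; sqrt (2 / \<delta>) from Chebyshev's threshold; 16 instead of
  8 because only the measure \<delta> / 2 remains below that threshold.\<close>

definition observation_cost :: "real \<Rightarrow> real \<Rightarrow> real \<Rightarrow> nat \<Rightarrow> real" where
  "observation_cost X W \<delta> k =
    12 * sqrt X * W * sqrt (2 / \<delta>) * (1 + 16 * (2 * real k) ^ 3 * W\<^sup>2 / \<delta>) ^ (2 * k) * exp (real k)"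

text \<open>The Remez bound is used only at the point x to which an interval belongs, with constants
  common to all intervals. The norm over {-X..X} then follows from a supremum, without a covering
  argument.\<close>

lemma spectral_inequality_of_parameters:
  fixes V :: "real \<Rightarrow> real"
  assumes H: "is_schrodinger_operator V H" and E: "is_eigenbasis H \<phi> \<mu>"
    and V: "V \<in> borel_measurable lebesgue" "\<And>r. \<exists>M. \<forall>x\<in>{-r..r}. \<bar>V x\<bar> \<le> M" "\<And>x. 0 \<le> V x"
    and f: "f \<in> spectral_subspace \<phi> \<mu> l" and l: "l \<le> \<Lambda>" "1 \<le> \<Lambda>" and \<Omega>: "\<Omega> \<in> sets lebesgue"
    and X: "0 < X" "\<And>x. X < \<bar>x\<bar> \<Longrightarrow> 2 * \<Lambda>\<^sup>2 \<le> V x"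
    and W: "1 \<le> W" and \<delta>: "0 < \<delta>"
    and I: "\<And>x. \<bar>x\<bar> \<le> X \<Longrightarrow> \<exists>a b \<sigma>. x \<in> {a..b} \<and> b - a \<le> r \<and> 0 \<le> \<sigma> \<and> (\<forall>y\<in>{a..b}. V y \<le> \<sigma>\<^sup>2) \<and>
      exp (\<sigma> * (b - a)) \<le> W \<and> \<delta> \<le> measure lebesgue (\<Omega> \<inter> {a..b})"
    and k: "0 < k" "4 * \<Lambda> * W\<^sup>2 * r \<le> real k" "12 * sqrt X * W * \<Lambda> \<le> exp (real k)"
  shows "L2_norm_on UNIV f \<le> observation_cost X W \<delta> k * L2_norm_on \<Omega> f"
proof (rule spectral_subspace_data[OF H E V f l])
  fix u u' v v' :: "nat \<Rightarrow> real \<Rightarrow> real"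
  assume u: "\<And>j. primitive_on UNIV (u j) (u' j)" "\<And>j. primitive_on UNIV (u' j) (\<lambda>x. V x * u j x + u (Suc j) x)"
    and v: "\<And>j. primitive_on UNIV (v j) (v' j)" "\<And>j. primitive_on UNIV (v' j) (\<lambda>x. V x * v j x + v (Suc j) x)"
    and f_eq: "AE x in lebesgue. f x = Complex (u 0 x) (v 0 x)"
    and int: "integrable lebesgue (\<lambda>x. (u 0 x)\<^sup>2 + (v 0 x)\<^sup>2)"
    and N_f: "(LINT x|lebesgue. (u 0 x)\<^sup>2 + (v 0 x)\<^sup>2) = (L2_norm_on UNIV f)\<^sup>2"
    and sup_f: "\<And>j x. \<bar>u j x\<bar> \<le> 2 * \<Lambda> * L2_norm_on UNIV f * \<Lambda> ^ (2 * j)"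
      "\<And>j x. \<bar>v j x\<bar> \<le> 2 * \<Lambda> * L2_norm_on UNIV f * \<Lambda> ^ (2 * j)"
    and tail_f: "\<And>X. (\<lambda>x. V x * ((u 0 x)\<^sup>2 + (v 0 x)\<^sup>2)) integrable_on {-X..X}"
      "\<And>X. integral {-X..X} (\<lambda>x. V x * ((u 0 x)\<^sup>2 + (v 0 x)\<^sup>2)) \<le> \<Lambda>\<^sup>2 * (L2_norm_on UNIV f)\<^sup>2"
  define N where "N = L2_norm_on UNIV f"
  note N = N_f[folded N_def] and sup = sup_f[folded N_def] and tail = tail_f[folded N_def]
  define q where "q x = (u 0 x)\<^sup>2 + (v 0 x)\<^sup>2" for x
  have N0: "0 \<le> N" by (auto simp: N_def L2_norm_on_def set_lebesgue_integral_def)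
  have cont: "continuous_on UNIV (u 0)" "continuous_on UNIV (v 0)"
    using primitive_on_UNIV_continuous[OF u(1)] primitive_on_UNIV_continuous[OF v(1)] by auto
  have iq: "q integrable_on {a..b}" for a b
    unfolding q_def by (auto intro!: integrable_continuous_real continuous_intros continuous_on_subset[OF cont(1)] continuous_on_subset[OF cont(2)])
  \<comment> \<open>The factor 2 in the lower bound \<open>2 * \<Lambda>\<^sup>2\<close> for V
    leaves at most half of \<open>N\<^sup>2\<close> for the tail.\<close>
  have half: "N\<^sup>2 \<le> 2 * integral {-X..X} q"
  proof -
    have "N\<^sup>2 \<le> integral {-X..X} q + (\<Lambda>\<^sup>2 * N\<^sup>2) / (2 * \<Lambda>\<^sup>2)"
      unfolding N[symmetric] q_def
      by (rule lebesgue_integral_tail_le[OF int _ V(3)]) (use X l tail N in auto)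
    also have "(\<Lambda>\<^sup>2 * N\<^sup>2) / (2 * \<Lambda>\<^sup>2) = N\<^sup>2 / 2" using l by simp
    finally show ?thesis by simp
  qed
  have m\<Omega>: "(LINT x|lebesgue. indicator \<Omega> x * q x) = (L2_norm_on \<Omega> f)\<^sup>2" and n\<Omega>: "0 \<le> L2_norm_on \<Omega> f"
  proof -
    have f_meas: "f \<in> borel_measurable lebesgue"
      using f by (auto simp: spectral_subspace_def L2_span_def L2_def)
    have "(LINT x|lebesgue. indicator \<Omega> x *\<^sub>R (cmod (f x))\<^sup>2) = (LINT x|lebesgue. indicator \<Omega> x * q x)"
    proof (rule integral_cong_AE)
      show "(\<lambda>x. indicator \<Omega> x *\<^sub>R (cmod (f x))\<^sup>2) \<in> borel_measurable lebesgue"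
        using f_meas \<Omega> by (intro borel_measurable_scaleR borel_measurable_indicator borel_measurable_power
            measurable_compose[OF _ borel_measurable_norm])
      show "(\<lambda>x. indicator \<Omega> x * q x) \<in> borel_measurable lebesgue"
        using int \<Omega> unfolding q_def by (intro borel_measurable_times borel_measurable_indicator) auto
      show "AE x in lebesgue. indicator \<Omega> x *\<^sub>R (cmod (f x))\<^sup>2 = indicator \<Omega> x * q x"
        using f_eq by eventually_elim (simp add: q_def cmod_power2)
    qed
    moreover have "0 \<le> (LINT x|lebesgue. indicator \<Omega> x * q x)" by (intro integral_nonneg_AE AE_I2) (simp add: q_def)
    ultimately show "(LINT x|lebesgue. indicator \<Omega> x * q x) = (L2_norm_on \<Omega> f)\<^sup>2" "0 \<le> L2_norm_on \<Omega> f"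
      by (simp_all add: L2_norm_on_def set_lebesgue_integral_def)
  qed
  define Q where "Q = (1 + 16 * (2 * real k) ^ 3 * W\<^sup>2 / \<delta>) ^ (2 * k)"
  have Q: "0 \<le> Q" using \<delta> by (simp add: Q_def)
  (* With A strictly larger than the norm on Omega, the threshold eta is positive even if f vanishes there. *)
  have main: "N \<le> 12 * sqrt X * W * sqrt (2 / \<delta>) * Q * exp k * A" if A: "L2_norm_on \<Omega> f < A" for A
  proof -
    have A0: "0 < A" using A n\<Omega> by linarith
    have A2: "(LINT x|lebesgue. indicator \<Omega> x * q x) \<le> A\<^sup>2"
      unfolding m\<Omega> using A n\<Omega> by (intro power_mono) auto
    \<comment> \<open>Its square is the threshold of \<open>exists_large_sublevel_subset\<close>, so
      it bounds both u_0 and v_0 on the sublevel set.\<close>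
    define \<eta> where "\<eta> = A * sqrt (2 / \<delta>)"
    have \<eta>: "0 < \<eta>" "\<eta>\<^sup>2 = 2 * A\<^sup>2 / \<delta>" using A0 \<delta> by (auto simp: \<eta>_def power_mult_distrib)
    define S where "S = W * ((2 * \<eta> * Q + (2 * \<Lambda> * N) / 4 ^ (2 * k)) * exp k)"
    have S0: "0 \<le> S" using W \<eta> Q l N0 by (simp add: S_def)
    have pt: "\<bar>u 0 x\<bar> \<le> S \<and> \<bar>v 0 x\<bar> \<le> S" if x: "\<bar>x\<bar> \<le> X" for x
    proof -
      obtain a b \<sigma> where ab: "x \<in> {a..b}" "b - a \<le> r" "0 \<le> \<sigma>" "\<forall>y\<in>{a..b}. V y \<le> \<sigma>\<^sup>2"
        "exp (\<sigma> * (b - a)) \<le> W" "\<delta> \<le> measure lebesgue (\<Omega> \<inter> {a..b})" using I[OF x] by blast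
      obtain D where D: "D \<in> sets lebesgue" "D \<subseteq> {a..b}" "\<delta> / 2 \<le> measure lebesgue D"
        "\<And>x. x \<in> D \<Longrightarrow> q x \<le> 2 * A\<^sup>2 / \<delta>"
        by (rule exists_large_sublevel_subset[OF _ _ \<Omega> \<delta> ab(6) A2 A0]) (use int in \<open>auto simp: q_def[abs_def]\<close>)
      have D\<eta>: "\<bar>u 0 y\<bar> \<le> \<eta> \<and> \<bar>v 0 y\<bar> \<le> \<eta>" if "y \<in> D" for y
      proof -
        have "(u 0 y)\<^sup>2 + (v 0 y)\<^sup>2 \<le> \<eta>\<^sup>2" using D(4)[OF that] by (simp add: \<eta>(2) q_def)
        then have "(u 0 y)\<^sup>2 \<le> \<eta>\<^sup>2" "(v 0 y)\<^sup>2 \<le> \<eta>\<^sup>2"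
          using zero_le_power2[of "u 0 y"] zero_le_power2[of "v 0 y"] by linarith+
        then show ?thesis using \<eta>(1) by (simp only: abs_le_square_iff[symmetric] abs_of_pos)
      qed
      have Vb: "0 \<le> V y \<and> V y \<le> \<sigma>\<^sup>2" if "y \<in> {a..b}" for y using ab(4) V(3) that by blast
      have d2: "0 < \<delta> / 2" using \<delta> by simp
      have M0: "0 \<le> 2 * \<Lambda> * N" using l N0 by simp
      have big: "8 * \<Lambda> * W\<^sup>2 * (b - a) \<le> 2 * real k"
      proof -
        have "4 * \<Lambda> * W\<^sup>2 * (b - a) \<le> 4 * \<Lambda> * W\<^sup>2 * r" using ab(2) l by (intro mult_left_mono) auto
        then show ?thesis using k(2) by linarith
      qed
      have Q': "(1 + 8 * (2 * real k) ^ 3 * W\<^sup>2 / (\<delta> / 2)) ^ (2 * k) = Q" by (simp add: Q_def mult_ac)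
      have "\<bar>u 0 x\<bar> \<le> S"
        unfolding S_def Q'[symmetric]
        by (rule schroedinger_remez[OF V(1) Vb ab(3) primitive_on_subset[OF u(1)] primitive_on_subset[OF u(2)]
            D(1,2) _ d2 D(3) \<eta>(1) k(1) M0 l(2) sup(1) ab(5) W big ab(1)])
          (use D\<eta> in auto)
      moreover have "\<bar>v 0 x\<bar> \<le> S"
        unfolding S_def Q'[symmetric]
        by (rule schroedinger_remez[OF V(1) Vb ab(3) primitive_on_subset[OF v(1)] primitive_on_subset[OF v(2)]
            D(1,2) _ d2 D(3) \<eta>(1) k(1) M0 l(2) sup(2) ab(5) W big ab(1)])
          (use D\<eta> in auto)
      ultimately show ?thesis by simp
    qed
    have "integral {-X..X} q \<le> integral {-X..X} (\<lambda>x. 2 * S\<^sup>2)"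
    proof (rule integral_le[OF iq])
      fix x assume "x \<in> {-X..X}"
      then have "\<bar>u 0 x\<bar> \<le> S" "\<bar>v 0 x\<bar> \<le> S" using pt[of x] by auto
      then have "(u 0 x)\<^sup>2 \<le> S\<^sup>2" "(v 0 x)\<^sup>2 \<le> S\<^sup>2" by (simp_all add: abs_le_square_iff[symmetric])
      then show "q x \<le> 2 * S\<^sup>2" by (simp add: q_def)
    qed auto
    also have "\<dots> = 4 * X * S\<^sup>2" using X by simp
    finally have "N\<^sup>2 \<le> 8 * X * S\<^sup>2" using half by simp
    \<comment> \<open>9 in place of 8 makes the coefficient of X a square.\<close>
    also have "\<dots> \<le> 9 * X * S\<^sup>2" using X by (intro mult_right_mono) auto
    also have "\<dots> = (3 * sqrt X * S)\<^sup>2" using X by (simp add: power_mult_distrib)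
    finally have "N \<le> 3 * sqrt X * S"
      by (rule power2_le_imp_le) (use X S0 in auto)
    also have "\<dots> = 6 * sqrt X * W * \<eta> * Q * exp k + 6 * sqrt X * W * \<Lambda> * (exp k / 4 ^ (2 * k)) * N"
      by (simp add: S_def algebra_simps)
    also have "6 * sqrt X * W * \<Lambda> * (exp k / 4 ^ (2 * k)) * N \<le> N / 2"
    proof -
      \<comment> \<open>As e <= 4, the factor e^k / 4^(2 k) is at most e^(-k). By the third
        assumption on \<open>k\<close> the error term is then at most N / 2 and can be absorbed on
        the left.\<close>
      have "exp k * exp k \<le> 4 ^ (2 * k)"
      proof -
        have "exp (real k) * exp (real k) = (exp 1 * exp 1) ^ k"
          by (simp add: exp_of_nat_mult[symmetric] power_mult_distrib)
        also have "\<dots> \<le> (4 * 4) ^ k"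
          using exp_le by (intro power_mono mult_mono) auto
        finally show ?thesis by (simp add: power_mult)
      qed
      then have "exp k / 4 ^ (2 * k) \<le> 1 / exp k" by (simp add: field_simps)
      then have "6 * sqrt X * W * \<Lambda> * (exp k / 4 ^ (2 * k)) \<le> 6 * sqrt X * W * \<Lambda> * (1 / exp k)"
        using X W l by (intro mult_left_mono) auto
      also have "\<dots> \<le> 1 / 2" using k(3) by (simp add: field_simps)
      finally have "6 * sqrt X * W * \<Lambda> * (exp k / 4 ^ (2 * k)) * N \<le> 1 / 2 * N"
        by (rule mult_right_mono[OF _ N0])
      then show ?thesis by simp
    qed
    finally have "N \<le> 12 * sqrt X * W * \<eta> * Q * exp k" by simp
    then show ?thesis by (simp add: \<eta>_def mult_ac)
  qed
  define T where "T = 12 * sqrt X * W * sqrt (2 / \<delta>) * Q * exp k"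
  have T0: "0 \<le> T" using X W Q \<delta> by (simp add: T_def)
  have "N \<le> T * L2_norm_on \<Omega> f"
  proof (rule field_le_epsilon)
    fix e :: real assume e: "0 < e"
    have "0 < e / (T + 1)" using e T0 by (intro divide_pos_pos) auto
    then have "N \<le> T * (L2_norm_on \<Omega> f + e / (T + 1))"
      unfolding T_def by (intro main) simp
    also have "\<dots> \<le> T * L2_norm_on \<Omega> f + e"
      using e T0 by (simp add: distrib_left divide_le_eq mult_left_mono)
    finally show "N \<le> T * L2_norm_on \<Omega> f + e" .
  qed
  then show ?thesis by (simp add: N_def T_def Q_def observation_cost_def)
qed

section \<open>Observation intervals\<close>

lemma jbracket_ge_1: "1 \<le> jbracket x"
  by (simp add: jbracket_def)

lemma abs_le_jbracket: "\<bar>x\<bar> \<le> jbracket x"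
  unfolding jbracket_def by (rule real_le_rsqrt) simp

lemma jbracket_le: "jbracket x \<le> 1 + \<bar>x\<bar>"
  unfolding jbracket_def by (rule real_le_lsqrt) (simp_all add: power2_sum)

lemma jbracket_mono: "\<bar>x\<bar> \<le> \<bar>y\<bar> \<Longrightarrow> jbracket x \<le> jbracket y"
  by (simp add: jbracket_def abs_le_square_iff)

lemma jbracket_shift:
  assumes "\<bar>y - x\<bar> \<le> L"
  shows "jbracket y \<le> (2 + L) * jbracket x"
proof -
  have "0 \<le> L" using assms by linarith
  have "jbracket y \<le> 1 + \<bar>x\<bar> + L" using jbracket_le[of y] assms by linarith
  also have "\<dots> \<le> jbracket x + jbracket x + L * jbracket x"
    using jbracket_ge_1[of x] abs_le_jbracket[of x] mult_left_mono[OF jbracket_ge_1[of x] \<open>0 \<le> L\<close>] by linarith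
  finally show ?thesis by (simp add: algebra_simps)
qed

lemma potential_le_square:
  assumes "V y \<le> c * jbracket y powr \<beta>" "jbracket y \<le> B" "0 < c" "0 \<le> \<beta>"
  shows "V y \<le> (sqrt c * B powr (\<beta> / 2))\<^sup>2"
proof -
  have B: "1 \<le> B" using assms(2) jbracket_ge_1[of y] by linarith
  have "jbracket y powr \<beta> \<le> B powr \<beta>"
    using assms jbracket_ge_1[of y] by (intro powr_mono2) auto
  then have "V y \<le> c * B powr \<beta>"
    using assms(1,3) mult_left_mono[of "jbracket y powr \<beta>" "B powr \<beta>" c] by linarith
  also have "\<dots> = (sqrt c * B powr (\<beta> / 2))\<^sup>2"
    using assms(3) B by (simp add: power_mult_distrib powr_power)
  finally show ?thesis .
qed

text \<open>With the bracket of the scale at least 1, two bounds hold: \<rho> >= <x>^(-\<beta> / 2),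
  which serves the measure, and \<rho> <x>^(\<beta> / 2) <= R log log <x>, which serves the
  exponent. The second turns exp (\<sigma> (b - a)) into a power of log <x>; this is what the double
  logarithm achieves.\<close>

lemma far_interval:
  fixes V :: "real \<Rightarrow> real"
  assumes "0 < R" "0 < \<beta>" "0 < L" "0 < \<gamma>" "\<gamma> < 1" "0 < c"
    and V: "\<And>x. V x \<le> c * jbracket x powr \<beta>"
    and dens: "\<And>x. 0 < loglog_scale \<beta> R x \<Longrightarrow>
      \<gamma> powr (jbracket x powr \<tau>) * measure lebesgue (Ivl (L * loglog_scale \<beta> R x) x)
        \<le> measure lebesgue (\<Omega> \<inter> Ivl (L * loglog_scale \<beta> R x) x)"
    and far: "1 \<le> R * ln (ln (jbracket x)) - inverse R"
  shows "\<exists>a b \<sigma>. x \<in> {a..b} \<and> b - a \<le> 2 * L \<and> 0 \<le> \<sigma> \<and> (\<forall>y\<in>{a..b}. V y \<le> \<sigma>\<^sup>2) \<and>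
    exp (\<sigma> * (b - a)) \<le> ln (jbracket x) powr (2 * L * R * sqrt c * (2 + L) powr (\<beta> / 2)) \<and>
    \<gamma> powr (jbracket x powr \<tau>) * (2 * L * jbracket x powr (- \<beta> / 2)) \<le> measure lebesgue (\<Omega> \<inter> {a..b})"
proof -
  define j where "j = jbracket x"
  define \<rho> where "\<rho> = loglog_scale \<beta> R x"
  have j1: "1 \<le> j" by (simp add: j_def jbracket_ge_1)
  have jp: "0 < j powr (\<beta> / 2)" "1 \<le> j powr (\<beta> / 2)"
    using j1 assms(2) by (auto simp: ge_one_powr_ge_zero)
  have RR: "R * ln (ln j) \<ge> 1 + inverse R" using far by (simp add: j_def)
  then have lnln: "0 < ln (ln j)"
    using assms(1) by (smt (verit) inverse_positive_iff_positive zero_less_mult_pos)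
  have lnj: "0 < ln j"
  proof (rule ccontr)
    assume "\<not> 0 < ln j"
    then have "ln j = 0" using j1 by (smt (verit) ln_ge_zero)
    then show False using lnln by simp
  qed
  have \<rho>_eq: "\<rho> = min ((R * ln (ln j) - inverse R) * (1 / j powr (\<beta> / 2))) 1"
    by (simp add: \<rho>_def loglog_scale_def j_def)
  have \<rho>_lower: "1 / j powr (\<beta> / 2) \<le> \<rho>"
    using far jp mult_right_mono[of 1 "R * ln (ln j) - inverse R" "1 / j powr (\<beta> / 2)"]
    unfolding \<rho>_eq j_def[symmetric] by auto
  have \<rho>_pos: "0 < \<rho>" using \<rho>_lower jp(1) by (smt (verit) divide_pos_pos)
  have \<rho>1: "\<rho> \<le> 1" by (simp add: \<rho>_eq)
  have \<rho>_upper: "\<rho> * j powr (\<beta> / 2) \<le> R * ln (ln j)"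
  proof -
    have "\<rho> \<le> (R * ln (ln j) - inverse R) * (1 / j powr (\<beta> / 2))" by (simp add: \<rho>_eq)
    then have "\<rho> * j powr (\<beta> / 2) \<le> R * ln (ln j) - inverse R" using jp(1) by (simp add: field_simps)
    then show ?thesis using assms(1) by (smt (verit) inverse_positive_iff_positive)
  qed
  \<comment> \<open>\<open>(2 + L) * j\<close> bounds the bracket at all points within distance
    \<open>L\<close> of x.\<close>
  define \<sigma> where "\<sigma> = sqrt c * ((2 + L) * j) powr (\<beta> / 2)"
  have Ivl_eq: "Ivl (L * \<rho>) x = {x - L * \<rho>..x + L * \<rho>}" by (simp add: Ivl_def)
  have L\<rho>: "0 < L * \<rho>" "L * \<rho> \<le> L" using assms(3) \<rho>_pos \<rho>1 by auto
  have "x \<in> {x - L * \<rho>..x + L * \<rho>}" using L\<rho> by auto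
  moreover have "x + L * \<rho> - (x - L * \<rho>) \<le> 2 * L" using L\<rho> by auto
  moreover have "0 \<le> \<sigma>" using assms(6) by (simp add: \<sigma>_def)
  moreover have "\<forall>y\<in>{x - L * \<rho>..x + L * \<rho>}. V y \<le> \<sigma>\<^sup>2"
  proof
    fix y assume y: "y \<in> {x - L * \<rho>..x + L * \<rho>}"
    have "\<bar>y - x\<bar> \<le> L" using y L\<rho> unfolding abs_le_iff atLeastAtMost_iff by linarith
    then have "jbracket y \<le> (2 + L) * j" unfolding j_def by (rule jbracket_shift)
    then show "V y \<le> \<sigma>\<^sup>2" unfolding \<sigma>_def
      using assms(2,6) by (intro potential_le_square[where V = V, OF V]) auto
  qed
  moreover have "exp (\<sigma> * (x + L * \<rho> - (x - L * \<rho>))) \<le> ln j powr (2 * L * R * sqrt c * (2 + L) powr (\<beta> / 2))"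
  proof -
    have "\<sigma> * (x + L * \<rho> - (x - L * \<rho>)) = 2 * L * sqrt c * (2 + L) powr (\<beta> / 2) * (\<rho> * j powr (\<beta> / 2))"
      using j1 assms(3) by (simp add: \<sigma>_def powr_mult)
    also have "\<dots> \<le> 2 * L * sqrt c * (2 + L) powr (\<beta> / 2) * (R * ln (ln j))"
      using assms(3,6) by (intro mult_left_mono[OF \<rho>_upper]) auto
    finally show ?thesis using lnj by (simp add: powr_def mult_ac)
  qed
  moreover have "\<gamma> powr (j powr \<tau>) * (2 * L * j powr (- \<beta> / 2)) \<le> measure lebesgue (\<Omega> \<inter> {x - L * \<rho>..x + L * \<rho>})"
  proof -
    have "2 * L * j powr (- \<beta> / 2) \<le> 2 * (L * \<rho>)"
      using mult_left_mono[OF \<rho>_lower, of "2 * L"] assms(3) j1 by (simp add: powr_minus_divide mult_ac)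
    then have "\<gamma> powr (j powr \<tau>) * (2 * L * j powr (- \<beta> / 2)) \<le> \<gamma> powr (j powr \<tau>) * (2 * (L * \<rho>))"
      by (intro mult_left_mono) auto
    also have "\<dots> = \<gamma> powr (j powr \<tau>) * measure lebesgue (Ivl (L * \<rho>) x)"
      using L\<rho> by (simp add: Ivl_eq)
    also have "\<dots> \<le> measure lebesgue (\<Omega> \<inter> Ivl (L * \<rho>) x)"
      using dens[of x] \<rho>_pos by (simp add: \<rho>_def j_def)
    finally show ?thesis by (simp add: Ivl_eq)
  qed
  ultimately show ?thesis unfolding j_def by blast
qed

text \<open>Where the bracket of the scale is below 1, possibly not even positive, all points share
  one fixed interval. It contains the observation interval of a single far point \<open>s\<close>,
  from which the measure of \<Omega> is taken.\<close>

lemma near_interval: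
  fixes V :: "real \<Rightarrow> real"
  assumes "0 < R" "0 < \<beta>" "0 < L" "0 < \<gamma>" "0 < c" and \<Omega>: "\<Omega> \<in> sets lebesgue"
    and V: "\<And>x. V x \<le> c * jbracket x powr \<beta>"
    and dens: "\<And>x. 0 < loglog_scale \<beta> R x \<Longrightarrow>
      \<gamma> powr (jbracket x powr \<tau>) * measure lebesgue (Ivl (L * loglog_scale \<beta> R x) x)
        \<le> measure lebesgue (\<Omega> \<inter> Ivl (L * loglog_scale \<beta> R x) x)"
  obtains a b \<sigma> \<delta> where "0 \<le> \<sigma>" "0 < \<delta>" "a \<le> b" "\<forall>y\<in>{a..b}. V y \<le> \<sigma>\<^sup>2"
    "\<delta> \<le> measure lebesgue (\<Omega> \<inter> {a..b})"
    "\<forall>x. \<not> 1 \<le> R * ln (ln (jbracket x)) - inverse R \<longrightarrow> x \<in> {a..b}"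
proof -
  (* R log log s - 1/R = 1, so R log log <x> - 1/R < 1 forces |x| < s. *)
  define s where "s = exp (exp ((1 + inverse R) / R))"
  have s: "0 < s" by (simp add: s_def)
  have far: "1 \<le> R * ln (ln (jbracket x)) - inverse R" if x: "s \<le> \<bar>x\<bar>" for x
  proof -
    have "s \<le> jbracket x" using x abs_le_jbracket[of x] by linarith
    then have "ln s \<le> ln (jbracket x)" using s by (subst ln_le_cancel_iff) auto
    then have 1: "exp ((1 + inverse R) / R) \<le> ln (jbracket x)" by (simp add: s_def)
    then have "0 < ln (jbracket x)" using exp_gt_zero less_le_trans by blast
    then have "(1 + inverse R) / R \<le> ln (ln (jbracket x))" using 1 by (subst ln_ge_iff)
    then show ?thesis using assms(1) by (simp add: field_simps)
  qed
  define \<rho> where "\<rho> = loglog_scale \<beta> R s"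
  have \<rho>: "0 < \<rho>" "\<rho> \<le> 1"
  proof -
    have "0 < R * ln (ln (jbracket s)) - inverse R" using far[of s] s by simp
    moreover have "0 < 1 / jbracket s powr (\<beta> / 2)" using jbracket_ge_1[of s] by simp
    ultimately show "0 < \<rho>" "\<rho> \<le> 1" by (simp_all add: \<rho>_def loglog_scale_def)
  qed
  define \<delta> where "\<delta> = \<gamma> powr (jbracket s powr \<tau>) * measure lebesgue (Ivl (L * \<rho>) s)"
  define \<sigma> where "\<sigma> = sqrt c * jbracket (s + L) powr (\<beta> / 2)"
  have L\<rho>: "0 < L * \<rho>" "L * \<rho> \<le> L" using assms(3) \<rho> by auto
  show thesis
  proof (rule that[of \<sigma> \<delta> "- s - L" "s + L"])
    show "0 \<le> \<sigma>" using assms(5) by (simp add: \<sigma>_def)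
    show "0 < \<delta>" using assms(4) L\<rho> by (simp add: \<delta>_def Ivl_def)
    show "- s - L \<le> s + L" using s assms(3) by simp
    show "\<forall>y\<in>{- s - L..s + L}. V y \<le> \<sigma>\<^sup>2"
    proof
      fix y assume "y \<in> {- s - L..s + L}"
      then show "V y \<le> \<sigma>\<^sup>2" unfolding \<sigma>_def
        by (intro potential_le_square[where V = V, OF V]) (use assms in \<open>auto intro: jbracket_mono\<close>)
    qed
    show "\<forall>x. \<not> 1 \<le> R * ln (ln (jbracket x)) - inverse R \<longrightarrow> x \<in> {- s - L..s + L}"
    proof (intro allI impI)
      fix x assume "\<not> 1 \<le> R * ln (ln (jbracket x)) - inverse R"
      then show "x \<in> {- s - L..s + L}" using far[of x] assms(3) by (cases "s \<le> \<bar>x\<bar>") auto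
    qed
    have "\<delta> \<le> measure lebesgue (\<Omega> \<inter> Ivl (L * \<rho>) s)"
      using dens[of s] \<rho>(1) by (simp add: \<delta>_def \<rho>_def)
    also have "\<dots> \<le> measure lebesgue (\<Omega> \<inter> {- s - L..s + L})"
    proof (rule measure_mono_fmeasurable)
      show "\<Omega> \<inter> Ivl (L * \<rho>) s \<subseteq> \<Omega> \<inter> {- s - L..s + L}" using L\<rho> s by (auto simp: Ivl_def)
      show "\<Omega> \<inter> Ivl (L * \<rho>) s \<in> sets lebesgue" using \<Omega> by (auto simp: Ivl_def)
      show "\<Omega> \<inter> {- s - L..s + L} \<in> lmeasurable"
        by (rule bounded_set_imp_lmeasurable[OF bounded_subset[OF bounded_closed_interval Int_lower2]])
           (intro sets.Int \<Omega>, simp)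
    qed
    finally show "\<delta> \<le> measure lebesgue (\<Omega> \<inter> {- s - L..s + L})" .
  qed
qed

section \<open>Growth of the parameters\<close>

text \<open>Up to constants the logarithm of the cost is k ln Q. In ln Q the main term is -ln
  \<delta>, which contains J^\<tau>, of the order \<Lambda>^(2 \<tau> / \<beta>1); the rest is
  logarithmic in \<Lambda>.\<close>

lemma parameter_growth:
  fixes \<beta>1 \<beta>2 \<tau> \<epsilon> D B W1 c \<gamma> r :: real
  assumes pos: "0 < \<beta>1" "0 < \<beta>2" "0 \<le> \<tau>" "0 < \<epsilon>" "0 \<le> D" "0 < B" "1 \<le> W1" "0 < c" "c \<le> 1" "0 < \<gamma>" "\<gamma> < 1" "0 \<le> r"
  shows "\<exists>C>0. \<forall>\<Lambda> X J \<delta>. 1 \<le> \<Lambda> \<longrightarrow> X = B * \<Lambda> powr (2 / \<beta>1) \<longrightarrow> J = (1 + B) * \<Lambda> powr (2 / \<beta>1) \<longrightarrow>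
    \<delta> = c * \<gamma> powr (J powr \<tau>) * J powr (- \<beta>2 / 2) \<longrightarrow>
    (\<exists>W k. 1 \<le> W \<and> 0 < k \<and> W1 \<le> W \<and> ln J powr D \<le> W \<and> 4 * \<Lambda> * W\<^sup>2 * r \<le> real k \<and>
      12 * sqrt X * W * \<Lambda> \<le> exp (real k) \<and>
      observation_cost X W \<delta> k \<le> exp (C * \<Lambda> powr ((4 * \<tau> + \<epsilon>) / \<beta>1 + 1)))"
proof -
  (* The exponent epsilon/beta1 is spent in three equal parts: two on k, which must exceed Lambda W^2 with
     W of the order Lambda^e, and one on the logarithms in ln Q. *)
  define e where "e = \<epsilon> / (3 * \<beta>1)"
  \<comment> \<open>\<open>ln J\<close> is at most a multiple of \<Lambda>^s, hence
    \<open>ln J powr D\<close> at most a multiple of \<Lambda>^e, whatever the size of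
    \<open>D\<close>. The summand 1 covers D = 0.\<close>
  define s where "s = e / (D + 1)"
  have e: "0 < e" using pos by (simp add: e_def)
  have s: "0 < s" "s * D \<le> e"
    using pos e by (simp_all add: s_def divide_le_eq)
  define a0 where "a0 = ln (1 + B) + 2 / \<beta>1 / s"
  have a0: "0 < a0" using pos s by (simp add: a0_def add_pos_pos)
  define CW where "CW = W1 + a0 powr D"
  have CW: "1 \<le> CW" using pos by (simp add: CW_def add_increasing2)
  define A where "A = 12 * sqrt B * CW"
  have A: "0 < A" using pos CW by (simp add: A_def)
  \<comment> \<open>The first summand serves the condition with \<open>r\<close>; the others
    dominate the logarithm of \<open>12 * sqrt X * W * \<Lambda>\<close> by means of ln \<Lambda> <=
    \<Lambda>.\<close>
  define Ck where "Ck = 4 * CW\<^sup>2 * r + \<bar>ln A\<bar> + 1 / \<beta>1 + e + 1"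
  have Ck: "1 \<le> Ck" using pos e by (simp add: Ck_def add_nonneg_nonneg)
  \<comment> \<open>One summand for each term of ln 129 + 3 ln k + 2 ln W - ln \<delta>, all of
    which are bounded by multiples of the same power \<open>P\<close>.\<close>
  define CQ where "CQ = ln 129 + 3 * (ln (Ck + 1) + (1 + 2 * e) / e) + 2 * (ln CW + 1) +
    (- ln c + (1 + B) powr \<tau> * (- ln \<gamma>) + \<beta>2 / 2 * (ln (1 + B) + 2 / \<beta>1 / e))"
  have lns: "0 \<le> - ln c" "0 \<le> - ln \<gamma>" using pos by auto
  have CQ: "0 \<le> CQ"
    unfolding CQ_def using pos CW Ck e
    by (intro add_nonneg_nonneg mult_nonneg_nonneg divide_nonneg_nonneg lns) auto
  define C where "C = (2 + 3 * CQ) * (Ck + 1)"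
  have C: "0 < C" using CQ Ck by (simp add: C_def)
  show ?thesis
  proof (rule exI[of _ C], rule conjI[OF C], intro allI impI)
    fix \<Lambda> X J \<delta> :: real
    assume \<Lambda>: "1 \<le> \<Lambda>" and X_def: "X = B * \<Lambda> powr (2 / \<beta>1)" and J_def: "J = (1 + B) * \<Lambda> powr (2 / \<beta>1)"
      and \<delta>_def: "\<delta> = c * \<gamma> powr (J powr \<tau>) * J powr (- \<beta>2 / 2)"
    have p1: "1 \<le> \<Lambda> powr t" if "0 \<le> t" for t using \<Lambda> that by (simp add: ge_one_powr_ge_zero)
    have ln\<Lambda>: "0 \<le> ln \<Lambda>" "ln \<Lambda> \<le> \<Lambda>" "\<And>t. 0 < t \<Longrightarrow> ln \<Lambda> \<le> \<Lambda> powr t / t"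
      using \<Lambda> ln_powr_bound[OF \<Lambda>] ln_bound[of \<Lambda>] by auto
    have J1: "1 \<le> J" unfolding J_def
      using pos p1[of "2 / \<beta>1"] mult_mono[of 1 "1 + B" 1 "\<Lambda> powr (2 / \<beta>1)"] by simp
    have lnJ: "ln J = ln (1 + B) + 2 / \<beta>1 * ln \<Lambda>"
      using pos \<Lambda> by (simp add: J_def ln_mult_pos ln_powr)
    have lnJ_bound: "ln J \<le> (ln (1 + B) + 2 / \<beta>1 / t) * \<Lambda> powr t" if t: "0 < t" for t
    proof -
      have "ln (1 + B) * 1 \<le> ln (1 + B) * \<Lambda> powr t" using pos p1[of t] t by (intro mult_left_mono) auto
      moreover have "2 / \<beta>1 * ln \<Lambda> \<le> 2 / \<beta>1 * (\<Lambda> powr t / t)"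
        using pos ln\<Lambda>(3)[OF t] by (intro mult_left_mono) auto
      ultimately show ?thesis by (simp add: lnJ distrib_right)
    qed
    have lnJ0: "0 \<le> ln J" using J1 by simp
    define W where "W = CW * \<Lambda> powr e"
    have W_CW: "CW \<le> W" using CW p1[of e] e mult_left_mono[of 1 "\<Lambda> powr e" CW] by (simp add: W_def)
    have W1: "1 \<le> W" "W1 \<le> W" using W_CW CW by (auto simp: CW_def intro: order_trans[rotated])
    have lnJD: "ln J powr D \<le> W"
    proof -
      have "ln J powr D \<le> (a0 * \<Lambda> powr s) powr D"
        using lnJ0 lnJ_bound[OF s(1)] pos by (intro powr_mono2) (auto simp: a0_def)
      also have "\<dots> = a0 powr D * \<Lambda> powr (s * D)"
        using a0 \<Lambda> by (simp add: powr_mult powr_powr)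
      also have "\<dots> \<le> CW * \<Lambda> powr e"
        using s \<Lambda> pos CW by (intro mult_mono powr_mono) (auto simp: CW_def)
      finally show ?thesis by (simp add: W_def)
    qed
    define k where "k = nat \<lceil>Ck * \<Lambda> powr (1 + 2 * e)\<rceil>"
    have big: "\<Lambda> \<le> \<Lambda> powr (1 + 2 * e)" using \<Lambda> e powr_mono[of 1 "1 + 2 * e" \<Lambda>] by simp
    have k_lower: "Ck * \<Lambda> powr (1 + 2 * e) \<le> real k" unfolding k_def by linarith
    have kC: "Ck * \<Lambda> \<le> real k" using k_lower mult_left_mono[OF big, of Ck] Ck by linarith
    have k1: "1 \<le> real k" using kC Ck \<Lambda> mult_mono[of 1 Ck 1 \<Lambda>] by linarith
    have k_upper: "real k \<le> (Ck + 1) * \<Lambda> powr (1 + 2 * e)"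
    proof -
      have "0 \<le> Ck * \<Lambda> powr (1 + 2 * e)" using Ck by simp
      then have "real k \<le> Ck * \<Lambda> powr (1 + 2 * e) + 1" unfolding k_def by linarith
      also have "\<dots> \<le> (Ck + 1) * \<Lambda> powr (1 + 2 * e)" using p1[of "1 + 2 * e"] e by (simp add: distrib_right)
      finally show ?thesis .
    qed
    have k_r: "4 * \<Lambda> * W\<^sup>2 * r \<le> real k"
    proof -
      have "4 * \<Lambda> * W\<^sup>2 * r = 4 * CW\<^sup>2 * r * \<Lambda> powr (1 + 2 * e)"
        using \<Lambda> by (simp add: W_def power_mult_distrib powr_power powr_add mult_ac)
      also have "\<dots> \<le> Ck * \<Lambda> powr (1 + 2 * e)"
        using pos e by (intro mult_right_mono) (auto simp: Ck_def)
      finally show ?thesis using k_lower by linarith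
    qed
    have k_exp: "12 * sqrt X * W * \<Lambda> \<le> exp (real k)"
    proof -
      have "sqrt X = sqrt B * \<Lambda> powr (1 / \<beta>1)"
        using \<Lambda> by (simp add: X_def real_sqrt_mult powr_half_sqrt[symmetric] powr_powr)
      then have "12 * sqrt X * W * \<Lambda> = A * \<Lambda> powr (1 / \<beta>1 + e + 1)"
        using \<Lambda> by (simp add: A_def W_def powr_add mult_ac)
      also have "\<dots> = exp (ln A + (1 / \<beta>1 + e + 1) * ln \<Lambda>)"
        using A \<Lambda> by (simp add: exp_add powr_def)
      also have "\<dots> \<le> exp (real k)"
      proof -
        have "ln A \<le> \<bar>ln A\<bar> * \<Lambda>"
          using \<Lambda> mult_left_mono[OF \<Lambda>, of "\<bar>ln A\<bar>"] by (smt (verit) mult_cancel_left1)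
        moreover have "(1 / \<beta>1 + e + 1) * ln \<Lambda> \<le> (1 / \<beta>1 + e + 1) * \<Lambda>"
          using pos e ln\<Lambda>(2) by (intro mult_left_mono) auto
        moreover have "(\<bar>ln A\<bar> + (1 / \<beta>1 + e + 1)) * \<Lambda> \<le> Ck * \<Lambda>"
          using pos \<Lambda> by (intro mult_right_mono) (auto simp: Ck_def)
        ultimately have "ln A + (1 / \<beta>1 + e + 1) * ln \<Lambda> \<le> Ck * \<Lambda>" by (simp add: distrib_right)
        then show ?thesis using kC by simp
      qed
      finally show ?thesis .
    qed
    have \<delta>0: "0 < \<delta>" using pos J1 by (simp add: \<delta>_def)
    have ln\<delta>: "- ln \<delta> = - ln c + J powr \<tau> * (- ln \<gamma>) + \<beta>2 / 2 * ln J"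
      using pos J1 by (simp add: \<delta>_def ln_mult_pos ln_powr)
    have "0 \<le> - ln \<delta>" unfolding ln\<delta> using pos lnJ0 by (intro add_nonneg_nonneg mult_nonneg_nonneg lns) auto
    then have \<delta>1: "\<delta> \<le> 1" using \<delta>0 by simp
    \<comment> \<open>2 \<tau> / \<beta>1 is the exponent of \<Lambda> in J^\<tau>; the additional e
      lets \<open>P\<close> dominate ln \<Lambda> as well.\<close>
    define P where "P = \<Lambda> powr (2 * \<tau> / \<beta>1 + e)"
    have P1: "1 \<le> P" unfolding P_def using pos e by (intro p1) auto
    have eP: "\<Lambda> powr e \<le> P" unfolding P_def using \<Lambda> pos by (intro powr_mono) auto
    have toP: "x \<le> x * P" if "0 \<le> x" for x using P1 that mult_left_mono[of 1 P x] by simp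
    have ln\<Lambda>P: "ln \<Lambda> \<le> P / e" using ln\<Lambda>(3)[OF e] eP e divide_right_mono[of "\<Lambda> powr e" P e] by linarith
    have 1: "ln (real k) \<le> (ln (Ck + 1) + (1 + 2 * e) / e) * P"
    proof -
      have "ln (real k) \<le> ln ((Ck + 1) * \<Lambda> powr (1 + 2 * e))"
        using k_upper k1 by (subst ln_le_cancel_iff) auto
      also have "\<dots> = ln (Ck + 1) + (1 + 2 * e) * ln \<Lambda>"
        using Ck \<Lambda> by (simp add: ln_mult_pos ln_powr)
      also have "\<dots> \<le> ln (Ck + 1) * P + (1 + 2 * e) * (P / e)"
        using Ck e by (intro add_mono toP mult_left_mono ln\<Lambda>P) auto
      finally show ?thesis by (simp add: distrib_right)
    qed
    have 2: "ln W \<le> (ln CW + 1) * P"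
    proof -
      have "ln W = ln CW + e * ln \<Lambda>" using CW \<Lambda> by (simp add: W_def ln_mult_pos ln_powr)
      also have "\<dots> \<le> ln CW * P + e * (P / e)"
        using CW e by (intro add_mono toP mult_left_mono ln\<Lambda>P) auto
      finally show ?thesis using e by (simp add: distrib_right)
    qed
    have 3: "- ln \<delta> \<le> (- ln c + (1 + B) powr \<tau> * (- ln \<gamma>) + \<beta>2 / 2 * (ln (1 + B) + 2 / \<beta>1 / e)) * P"
    proof -
      have "J powr \<tau> = (1 + B) powr \<tau> * \<Lambda> powr (2 * \<tau> / \<beta>1)"
        using pos \<Lambda> by (simp add: J_def powr_mult powr_powr)
      also have "\<dots> \<le> (1 + B) powr \<tau> * P"
        unfolding P_def using \<Lambda> e by (intro mult_left_mono powr_mono) auto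
      finally have "J powr \<tau> * (- ln \<gamma>) \<le> (1 + B) powr \<tau> * P * (- ln \<gamma>)"
        using lns by (intro mult_right_mono)
      then have "J powr \<tau> * (- ln \<gamma>) \<le> (1 + B) powr \<tau> * (- ln \<gamma>) * P" by (simp only: mult_ac)
      moreover have "ln J \<le> (ln (1 + B) + 2 / \<beta>1 / e) * P"
        using lnJ_bound[OF e] mult_left_mono[OF eP, of "ln (1 + B) + 2 / \<beta>1 / e"] pos e
        by (smt (verit) divide_nonneg_pos ln_ge_zero)
      then have "\<beta>2 / 2 * ln J \<le> \<beta>2 / 2 * ((ln (1 + B) + 2 / \<beta>1 / e) * P)"
        using pos by (intro mult_left_mono) auto
      then have "\<beta>2 / 2 * ln J \<le> \<beta>2 / 2 * (ln (1 + B) + 2 / \<beta>1 / e) * P" by (simp only: mult.assoc)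
      moreover have "- ln c \<le> - ln c * P" using pos by (intro toP) auto
      ultimately show ?thesis unfolding ln\<delta> distrib_right[of _ _ P] by (intro add_mono)
    qed
    define Q where "Q = 1 + 16 * (2 * real k) ^ 3 * W\<^sup>2 / \<delta>"
    have kW: "1 \<le> real k ^ 3 * W\<^sup>2"
      using k1 W1(1) mult_mono[of 1 "real k ^ 3" 1 "W\<^sup>2"] by simp
    \<comment> \<open>16 * 2^3 = 128, and the summand 1 is at most k^3 W^2 / \<delta>.\<close>
    have Q_le: "Q \<le> 129 * (real k ^ 3 * W\<^sup>2 / \<delta>)"
    proof -
      have "1 \<le> real k ^ 3 * W\<^sup>2 / \<delta>" using kW \<delta>0 \<delta>1 by (simp add: le_divide_eq)
      then show ?thesis by (simp add: Q_def power_mult_distrib)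
    qed
    have Q2: "2 / \<delta> \<le> Q"
    proof -
      have "2 / \<delta> \<le> 128 * (real k ^ 3 * W\<^sup>2) / \<delta>" by (rule divide_right_mono) (use kW \<delta>0 in linarith)+
      moreover have "Q = 1 + 128 * (real k ^ 3 * W\<^sup>2) / \<delta>" by (simp add: Q_def power_mult_distrib)
      ultimately show ?thesis by linarith
    qed
    have Q1: "1 \<le> Q" using \<delta>0 by (simp add: Q_def)
    have lnQ: "ln Q \<le> CQ * P"
    proof -
      have "ln Q \<le> ln (129 * (real k ^ 3 * W\<^sup>2 / \<delta>))"
        using Q_le Q1 by (subst ln_le_cancel_iff) auto
      also have "\<dots> = ln 129 + 3 * ln (real k) + 2 * ln W + (- ln \<delta>)"
        using k1 W1 \<delta>0 by (simp add: ln_mult_pos ln_div ln_realpow)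
      also have "\<dots> \<le> ln 129 * P + 3 * ((ln (Ck + 1) + (1 + 2 * e) / e) * P) + 2 * ((ln CW + 1) * P) +
          (- ln c + (1 + B) powr \<tau> * (- ln \<gamma>) + \<beta>2 / 2 * (ln (1 + B) + 2 / \<beta>1 / e)) * P"
        by (intro add_mono mult_left_mono toP 1 2 3) auto
      also have "\<dots> = CQ * P" by (simp only: CQ_def distrib_right mult.assoc)
      finally show ?thesis .
    qed
    \<comment> \<open>A crude bound, by which the square root costs just one more factor
      \<open>Q\<close>.\<close>
    have sq: "sqrt (2 / \<delta>) \<le> Q"
    proof -
      have "1 \<le> 2 / \<delta>" using \<delta>0 \<delta>1 by (simp add: le_divide_eq)
      then have "2 / \<delta> \<le> (2 / \<delta>)\<^sup>2" by (rule self_le_power) simp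
      then have "sqrt (2 / \<delta>) \<le> 2 / \<delta>" using \<delta>0 by (intro real_le_lsqrt) simp_all
      then show ?thesis using Q2 by linarith
    qed
    have "12 * sqrt X * W * sqrt (2 / \<delta>) * Q ^ (2 * k) * exp (real k) \<le> exp (real k) * Q * Q ^ (2 * k) * exp (real k)"
    proof -
      have X0: "0 \<le> X" using pos by (simp add: X_def)
      have "12 * sqrt X * W * 1 \<le> 12 * sqrt X * W * \<Lambda>" using X0 W1 \<Lambda> by (intro mult_left_mono) auto
      then have "12 * sqrt X * W \<le> exp (real k)" using k_exp by simp
      then show ?thesis using sq Q1 X0 W1 \<delta>0 by (intro mult_mono) auto
    qed
    also have "\<dots> = exp (2 * real k + (2 * real k + 1) * ln Q)"
    proof -
      have "Q * Q ^ (2 * k) = exp ((2 * real k + 1) * ln Q)"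
      proof -
        have "Q * Q ^ (2 * k) = exp (ln Q) ^ (2 * k + 1)" using Q1 by simp
        also have "\<dots> = exp (real (2 * k + 1) * ln Q)" by (rule exp_of_nat_mult[symmetric])
        finally show ?thesis by simp
      qed
      moreover have "exp (real k) * Q * Q ^ (2 * k) * exp (real k) = exp (real k) * exp (real k) * (Q * Q ^ (2 * k))"
        by (simp only: mult_ac)
      ultimately have "exp (real k) * Q * Q ^ (2 * k) * exp (real k) = exp (real k) * exp (real k) * exp ((2 * real k + 1) * ln Q)"
        by (simp only:)
      then show ?thesis by (simp add: exp_add[symmetric])
    qed
    also have "\<dots> \<le> exp (C * \<Lambda> powr ((4 * \<tau> + \<epsilon>) / \<beta>1 + 1))"
    proof -
      \<comment> \<open>2 k + 1 <= 3 k as k >= 1, and the term 2 k is enlarged by P >= 1.\<close>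
      have "2 * real k + (2 * real k + 1) * ln Q \<le> 2 * (real k * P) + 3 * real k * (CQ * P)"
        using toP[of "real k"] k1 lnQ Q1 by (intro add_mono mult_mono) auto
      also have "\<dots> = (2 + 3 * CQ) * (real k * P)" by (simp add: algebra_simps)
      also have "\<dots> \<le> (2 + 3 * CQ) * ((Ck + 1) * \<Lambda> powr (1 + 2 * e) * P)"
        using k_upper CQ P1 by (intro mult_left_mono mult_right_mono) auto
      also have "\<dots> = C * \<Lambda> powr (1 + 3 * e + 2 * \<tau> / \<beta>1)"
        by (simp add: C_def P_def powr_add[symmetric] mult_ac add_ac)
      also have "\<dots> \<le> C * \<Lambda> powr ((4 * \<tau> + \<epsilon>) / \<beta>1 + 1)"
      proof -
        have "3 * e = \<epsilon> / \<beta>1" by (simp add: e_def)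
        moreover have "2 * \<tau> / \<beta>1 \<le> 4 * \<tau> / \<beta>1" using pos by (intro divide_right_mono) auto
        ultimately have "1 + 3 * e + 2 * \<tau> / \<beta>1 \<le> (4 * \<tau> + \<epsilon>) / \<beta>1 + 1"
          by (simp add: add_divide_distrib)
        then show ?thesis using C \<Lambda> by (intro mult_left_mono powr_mono) auto
      qed
      finally show ?thesis by simp
    qed
    finally have "observation_cost X W \<delta> k \<le> exp (C * \<Lambda> powr ((4 * \<tau> + \<epsilon>) / \<beta>1 + 1))"
      by (simp add: observation_cost_def Q_def)
    moreover have "0 < k" using k1 by (cases k) auto
    ultimately show "\<exists>W k. 1 \<le> W \<and> 0 < k \<and> W1 \<le> W \<and> ln J powr D \<le> W \<and> 4 * \<Lambda> * W\<^sup>2 * r \<le> real k \<and>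
      12 * sqrt X * W * \<Lambda> \<le> exp (real k) \<and>
      observation_cost X W \<delta> k \<le> exp (C * \<Lambda> powr ((4 * \<tau> + \<epsilon>) / \<beta>1 + 1))"
      using W1 lnJD k_r k_exp by blast
  qed
qed

theorem theorem1p8:
  fixes V :: "real \<Rightarrow> real" and \<beta>\<^sub>1 \<beta>\<^sub>2 c\<^sub>1 c\<^sub>2 c\<^sub>3 \<tau> \<epsilon> :: real
  assumes "0 < \<beta>\<^sub>1" and "\<beta>\<^sub>1 \<le> \<beta>\<^sub>2"
    and "V \<in> Linf_loc" and "\<And>x. 0 \<le> V x"
    and "0 < c\<^sub>1" and "0 < c\<^sub>2" and "0 < c\<^sub>3"
    and "\<And>x. c\<^sub>1 * (max 0 (\<bar>x\<bar> - c\<^sub>3)) powr \<beta>\<^sub>1 \<le> V x"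
    and "\<And>x. V x \<le> c\<^sub>2 * jbracket x powr \<beta>\<^sub>2"
    and "0 \<le> \<tau>" and "0 < \<epsilon>"
  shows "\<exists>R\<^sub>0>0. \<forall>R. 0 < R \<and> R < R\<^sub>0 \<longrightarrow>
    (\<forall>\<Omega>. thick (loglog_scale \<beta>\<^sub>2 R) \<tau> \<Omega> \<longrightarrow>
      (\<exists>C>0. \<forall>H \<phi> \<mu>. is_schrodinger_operator V H \<and> is_eigenbasis H \<phi> \<mu> \<longrightarrow>
        (\<forall>l>0. \<forall>f \<in> spectral_subspace \<phi> \<mu> l.
           L2_norm_on UNIV f
             \<le> C * exp (C * l powr ((4 * \<tau> + \<epsilon>) / \<beta>\<^sub>1 + 1)) * L2_norm_on \<Omega> f)))"
proof (rule exI[of _ 1], intro conjI allI impI)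
  show "(0::real) < 1" by simp
  fix R :: real and \<Omega> :: "real set"
  assume "0 < R \<and> R < 1" and thick: "thick (loglog_scale \<beta>\<^sub>2 R) \<tau> \<Omega>"
  then have R: "0 < R" by simp
  have \<beta>2: "0 < \<beta>\<^sub>2" using assms(1,2) by linarith
  note V_upper = assms(9)
  have V_meas: "V \<in> borel_measurable lebesgue" using assms(3) by (simp add: Linf_loc_def)
  have V_bounded: "\<exists>M. \<forall>x\<in>{-r..r}. \<bar>V x\<bar> \<le> M" for r
  proof (intro exI[of _ "(sqrt c\<^sub>2 * jbracket r powr (\<beta>\<^sub>2 / 2))\<^sup>2"] ballI)
    fix x assume "x \<in> {-r..r}"
    then have "jbracket x \<le> jbracket r" by (intro jbracket_mono) auto
    from potential_le_square[where V = V, OF V_upper this assms(6)] \<beta>2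
    show "\<bar>V x\<bar> \<le> (sqrt c\<^sub>2 * jbracket r powr (\<beta>\<^sub>2 / 2))\<^sup>2"
      using assms(4)[of x] by simp
  qed
  from thick obtain \<gamma> L where \<Omega>: "\<Omega> \<in> sets lebesgue" and \<gamma>: "0 < \<gamma>" "\<gamma> < 1" and L: "0 < L"
    and dens: "\<And>x. 0 < loglog_scale \<beta>\<^sub>2 R x \<Longrightarrow>
      \<gamma> powr (jbracket x powr \<tau>) * measure lebesgue (Ivl (L * loglog_scale \<beta>\<^sub>2 R x) x)
        \<le> measure lebesgue (\<Omega> \<inter> Ivl (L * loglog_scale \<beta>\<^sub>2 R x) x)"
    unfolding thick_def by blast
  obtain a0 b0 \<sigma>0 \<delta>0 where near: "0 \<le> \<sigma>0" "0 < \<delta>0" "a0 \<le> b0" "\<forall>y\<in>{a0..b0}. V y \<le> \<sigma>0\<^sup>2"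
    "\<delta>0 \<le> measure lebesgue (\<Omega> \<inter> {a0..b0})"
    "\<forall>x. \<not> 1 \<le> R * ln (ln (jbracket x)) - inverse R \<longrightarrow> x \<in> {a0..b0}"
    by (rule near_interval[OF R \<beta>2 L \<gamma>(1) assms(6) \<Omega> V_upper dens])
  define D where "D = 2 * L * R * sqrt c\<^sub>2 * (2 + L) powr (\<beta>\<^sub>2 / 2)"
  \<comment> \<open>The first summand compensates the shift \<open>c\<^sub>3\<close> in the lower
    bound for V, the second makes that bound at least \<open>2 * \<Lambda>\<^sup>2\<close> beyond
    X.\<close>
  define B where "B = c\<^sub>3 + (2 / c\<^sub>1) powr (1 / \<beta>\<^sub>1)"
  define W1 where "W1 = exp (\<sigma>0 * (b0 - a0))"
  \<comment> \<open>At most 1 for the sign of its logarithm, at most \<delta>0 for the fixed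
    interval, at most 2 L for the intervals of far points.\<close>
  define c where "c = min 1 (min \<delta>0 (2 * L))"
  define r where "r = max (2 * L) (b0 - a0)"
  define \<zeta> where "\<zeta> = (4 * \<tau> + \<epsilon>) / \<beta>\<^sub>1 + 1"
  have pos: "0 \<le> D" "0 < B" "1 \<le> W1" "0 < c" "c \<le> 1" "0 \<le> r"
    using L R assms(5,6,7) near(1-3) by (auto simp: D_def B_def W1_def c_def r_def add_pos_nonneg)
  obtain C where C: "0 < C" and growth: "\<And>\<Lambda> X J \<delta>. 1 \<le> \<Lambda> \<Longrightarrow> X = B * \<Lambda> powr (2 / \<beta>\<^sub>1) \<Longrightarrow>
    J = (1 + B) * \<Lambda> powr (2 / \<beta>\<^sub>1) \<Longrightarrow> \<delta> = c * \<gamma> powr (J powr \<tau>) * J powr (- \<beta>\<^sub>2 / 2) \<Longrightarrow>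
    \<exists>W k. 1 \<le> W \<and> 0 < k \<and> W1 \<le> W \<and> ln J powr D \<le> W \<and> 4 * \<Lambda> * W\<^sup>2 * r \<le> real k \<and>
      12 * sqrt X * W * \<Lambda> \<le> exp (real k) \<and> observation_cost X W \<delta> k \<le> exp (C * \<Lambda> powr \<zeta>)"
    unfolding \<zeta>_def
    using parameter_growth[OF assms(1) \<beta>2 assms(10,11) pos(1-5) \<gamma> pos(6)] by blast
  \<comment> \<open>The bound \<Lambda> >= 1 is kept apart from \<open>l\<close>, so that small
    \<open>l\<close> can be treated with \<Lambda> = 1.\<close>
  have main: "L2_norm_on UNIV f \<le> exp (C * \<Lambda> powr \<zeta>) * L2_norm_on \<Omega> f"
    if H: "is_schrodinger_operator V H" "is_eigenbasis H \<phi> \<mu>" and f: "f \<in> spectral_subspace \<phi> \<mu> l"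
      and l: "l \<le> \<Lambda>" "1 \<le> \<Lambda>" for H \<phi> \<mu> l f \<Lambda>
  proof -
    define X where "X = B * \<Lambda> powr (2 / \<beta>\<^sub>1)"
    \<comment> \<open>As \<Lambda> >= 1, \<open>J\<close> dominates 1 + X and so <x> for all |x| <=
      X; density and logarithm are then bounded uniformly there.\<close>
    define J where "J = (1 + B) * \<Lambda> powr (2 / \<beta>\<^sub>1)"
    define \<delta> where "\<delta> = c * \<gamma> powr (J powr \<tau>) * J powr (- \<beta>\<^sub>2 / 2)"
    obtain W k where W: "1 \<le> W" "W1 \<le> W" "ln J powr D \<le> W" and k: "0 < k" "4 * \<Lambda> * W\<^sup>2 * r \<le> real k"
        "12 * sqrt X * W * \<Lambda> \<le> exp (real k)"
      and bound: "observation_cost X W \<delta> k \<le> exp (C * \<Lambda> powr \<zeta>)"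
      using growth[OF l(2) X_def J_def \<delta>_def] by blast
    have p1: "1 \<le> \<Lambda> powr (2 / \<beta>\<^sub>1)" using l(2) assms(1) by (simp add: ge_one_powr_ge_zero)
    have X0: "0 < X" unfolding X_def using pos(2) p1 by (intro mult_pos_pos) auto
    have J1: "1 \<le> J" using mult_mono[of 1 "1 + B" 1 "\<Lambda> powr (2 / \<beta>\<^sub>1)"] pos(2) p1 by (simp add: J_def)
    have \<delta>: "0 < \<delta>" using pos(4) \<gamma> J1 by (simp add: \<delta>_def)
    have jX: "jbracket x \<le> J" if "\<bar>x\<bar> \<le> X" for x
      using jbracket_le[of x] that p1 by (simp add: J_def X_def distrib_right)
    have V_lower: "2 * \<Lambda>\<^sup>2 \<le> V x" if x: "X < \<bar>x\<bar>" for x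
    proof -
      have "c\<^sub>3 + (2 * \<Lambda>\<^sup>2 / c\<^sub>1) powr (1 / \<beta>\<^sub>1) \<le> X"
      proof -
        have "(2 * \<Lambda>\<^sup>2 / c\<^sub>1) powr (1 / \<beta>\<^sub>1) = (2 / c\<^sub>1 * \<Lambda> powr 2) powr (1 / \<beta>\<^sub>1)"
          using l(2) by (simp add: powr_numeral)
        also have "\<dots> = (2 / c\<^sub>1) powr (1 / \<beta>\<^sub>1) * \<Lambda> powr (2 / \<beta>\<^sub>1)"
          using l(2) assms(5) by (subst powr_mult) (simp_all only: powr_powr, simp_all)
        finally show ?thesis
          using mult_left_mono[OF p1, of c\<^sub>3] assms(7) by (simp add: X_def B_def distrib_right)
      qed
      then have "(2 * \<Lambda>\<^sup>2 / c\<^sub>1) powr (1 / \<beta>\<^sub>1) \<le> max 0 (\<bar>x\<bar> - c\<^sub>3)" using x by simp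
      then have "((2 * \<Lambda>\<^sup>2 / c\<^sub>1) powr (1 / \<beta>\<^sub>1)) powr \<beta>\<^sub>1 \<le> (max 0 (\<bar>x\<bar> - c\<^sub>3)) powr \<beta>\<^sub>1"
        using assms(1) by (intro powr_mono2) auto
      then have "2 * \<Lambda>\<^sup>2 / c\<^sub>1 \<le> (max 0 (\<bar>x\<bar> - c\<^sub>3)) powr \<beta>\<^sub>1"
        using assms(1,5) l(2) by (simp add: powr_powr)
      then have "2 * \<Lambda>\<^sup>2 \<le> c\<^sub>1 * (max 0 (\<bar>x\<bar> - c\<^sub>3)) powr \<beta>\<^sub>1"
        using assms(5) by (simp add: divide_le_eq mult.commute)
      then show ?thesis using assms(8)[of x] by linarith
    qed
    have "\<exists>a b \<sigma>. x \<in> {a..b} \<and> b - a \<le> r \<and> 0 \<le> \<sigma> \<and> (\<forall>y\<in>{a..b}. V y \<le> \<sigma>\<^sup>2) \<and>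
      exp (\<sigma> * (b - a)) \<le> W \<and> \<delta> \<le> measure lebesgue (\<Omega> \<inter> {a..b})" if x: "\<bar>x\<bar> \<le> X" for x
    proof (cases "1 \<le> R * ln (ln (jbracket x)) - inverse R")
      case True
      obtain a b \<sigma> where ab: "x \<in> {a..b}" "b - a \<le> 2 * L" "0 \<le> \<sigma>" "\<forall>y\<in>{a..b}. V y \<le> \<sigma>\<^sup>2"
        "exp (\<sigma> * (b - a)) \<le> ln (jbracket x) powr D"
        "\<gamma> powr (jbracket x powr \<tau>) * (2 * L * jbracket x powr (- \<beta>\<^sub>2 / 2)) \<le> measure lebesgue (\<Omega> \<inter> {a..b})"
        using far_interval[OF R \<beta>2 L \<gamma> assms(6) V_upper dens True] unfolding D_def by blast
      have "ln (jbracket x) powr D \<le> ln J powr D"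
        using jX[OF x] jbracket_ge_1[of x] J1 pos(1) by (intro powr_mono2) auto
      then have "exp (\<sigma> * (b - a)) \<le> W" using ab(5) W(3) by linarith
      moreover have "\<delta> \<le> measure lebesgue (\<Omega> \<inter> {a..b})"
      proof -
        have 1: "jbracket x powr \<tau> \<le> J powr \<tau>"
          using jX[OF x] jbracket_ge_1[of x] assms(10) by (intro powr_mono2) auto
        have "\<gamma> powr (J powr \<tau>) \<le> \<gamma> powr (jbracket x powr \<tau>)"
          using \<gamma> 1 by (intro powr_mono') auto
        moreover have "J powr (- \<beta>\<^sub>2 / 2) \<le> jbracket x powr (- \<beta>\<^sub>2 / 2)"
          using jX[OF x] jbracket_ge_1[of x] \<beta>2 by (intro powr_mono2') auto
        moreover have "c \<le> 2 * L" by (simp add: c_def)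
        ultimately have "c * \<gamma> powr (J powr \<tau>) * J powr (- \<beta>\<^sub>2 / 2)
            \<le> (2 * L) * \<gamma> powr (jbracket x powr \<tau>) * jbracket x powr (- \<beta>\<^sub>2 / 2)"
          using pos(4) L by (intro mult_mono) auto
        then show ?thesis using ab(6) by (simp add: \<delta>_def mult_ac)
      qed
      moreover have "b - a \<le> r" using ab(2) by (simp add: r_def)
      ultimately show ?thesis using ab(1,3,4) by blast
    next
      case False
      have "\<delta> \<le> c"
      proof -
        have "\<gamma> powr (J powr \<tau>) \<le> 1" using \<gamma> by (intro powr_le1) auto
        moreover have "J powr (- \<beta>\<^sub>2 / 2) \<le> 1" using J1 \<beta>2 powr_mono2'[of "- \<beta>\<^sub>2 / 2" 1 J] by simp
        ultimately have "\<gamma> powr (J powr \<tau>) * J powr (- \<beta>\<^sub>2 / 2) \<le> 1 * 1"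
          by (intro mult_mono) simp_all
        then show ?thesis using mult_left_mono[of "\<gamma> powr (J powr \<tau>) * J powr (- \<beta>\<^sub>2 / 2)" 1 c] pos(4)
          by (simp add: \<delta>_def mult.assoc)
      qed
      also have "\<dots> \<le> \<delta>0" by (simp add: c_def)
      finally have "\<delta> \<le> measure lebesgue (\<Omega> \<inter> {a0..b0})" using near(5) by linarith
      moreover have "exp (\<sigma>0 * (b0 - a0)) \<le> W" using W(2) by (simp add: W1_def)
      moreover have "b0 - a0 \<le> r" by (simp add: r_def)
      ultimately show ?thesis using near(1,4,6) False by blast
    qed
    from spectral_inequality_of_parameters[OF H V_meas V_bounded assms(4) f l \<Omega> X0 V_lower W(1) \<delta> this k]
    have "L2_norm_on UNIV f \<le> observation_cost X W \<delta> k * L2_norm_on \<Omega> f" .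
    also have "\<dots> \<le> exp (C * \<Lambda> powr \<zeta>) * L2_norm_on \<Omega> f"
      by (rule mult_right_mono[OF bound])
         (simp add: L2_norm_on_def set_lebesgue_integral_def)
    finally show ?thesis .
  qed
  show "\<exists>C>0. \<forall>H \<phi> \<mu>. is_schrodinger_operator V H \<and> is_eigenbasis H \<phi> \<mu> \<longrightarrow>
        (\<forall>l>0. \<forall>f \<in> spectral_subspace \<phi> \<mu> l.
           L2_norm_on UNIV f \<le> C * exp (C * l powr ((4 * \<tau> + \<epsilon>) / \<beta>\<^sub>1 + 1)) * L2_norm_on \<Omega> f)"
  \<comment> \<open>The outer factor exp C pays for replacing l by max l 1; in the exponent C is
    enlarged to exp C, so that one constant serves both places.\<close>
  proof (intro exI[of _ "exp C"] conjI allI impI ballI)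
    show "0 < exp C" by simp
    fix H \<phi> \<mu> l f
    assume H: "is_schrodinger_operator V H \<and> is_eigenbasis H \<phi> \<mu>" and l: "(0::real) < l" and f: "f \<in> spectral_subspace \<phi> \<mu> l"
    have "L2_norm_on UNIV f \<le> exp (C * max l 1 powr \<zeta>) * L2_norm_on \<Omega> f"
      using H by (intro main[OF _ _ f]) auto
    also have "\<dots> \<le> exp C * exp (exp C * l powr \<zeta>) * L2_norm_on \<Omega> f"
    proof (rule mult_right_mono)
      have "max l 1 powr \<zeta> \<le> 1 + l powr \<zeta>" by (auto simp: max_def)
      then have "C * max l 1 powr \<zeta> \<le> C * (1 + l powr \<zeta>)" using C by (intro mult_left_mono) auto
      also have "\<dots> \<le> C + exp C * l powr \<zeta>"
      proof -
        have "C \<le> exp C" using exp_ge_add_one_self[of C] by linarith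
        then show ?thesis by (simp add: distrib_left mult_right_mono)
      qed
      finally show "exp (C * max l 1 powr \<zeta>) \<le> exp C * exp (exp C * l powr \<zeta>)"
        by (simp add: exp_add[symmetric])
      show "0 \<le> L2_norm_on \<Omega> f" by (simp add: L2_norm_on_def set_lebesgue_integral_def)
    qed
    finally show "L2_norm_on UNIV f \<le> exp C * exp (exp C * l powr ((4 * \<tau> + \<epsilon>) / \<beta>\<^sub>1 + 1)) * L2_norm_on \<Omega> f"
      by (simp add: \<zeta>_def)
  qed
qed

end
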